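(* Let $0<q<1$, let $n=n_0+n_1$ with integers $n_0\ge 0$, $n_1\ge 2$, let $\alpha,\beta\in\mathbb{C}$ with $\operatorname{Re}\alpha>0$, $\operatorname{Re}\beta>0$, and let $k\in\mathbb{Z}_{\ge 0}$. Put $$P=\prod_{i=1}^{n_0}\frac{\Gamma_q(1+ik)\Gamma_q(\alpha+(i-1)k)\Gamma_q(\beta+(i-1)k)}{\Gamma_q(1+k)\Gamma_q(\alpha+\beta+(n_0+i-2)k)}\ \prod_{j=1}^{n_1}\frac{[(1+k)j]_q\,\Gamma_q(j+(n_0+j)k)}{\Gamma_q(2+k)}$$ $$\times\prod_{j=1}^{n_1}\Gamma_q(\alpha+j+(n_0+j-1)k)\,\Gamma_q(\beta+j+(n_0+j-1)k)\,\Gamma_q(\alpha+\beta+j+(n_0+j-2)k)\ \prod_{j=1}^{2n_1}\big\{\Gamma_q(\alpha+\beta+j+(2n_0+j-2)k)\big\}^{-1}.$$ Then $$\int_{[0,1]^n}\prod_{i=n_0+1}^n t_i(1-q^{\beta}t_i)\prod_{n_0+1\le i<j\le n}(t_i-q^{-k}t_j)(t_i-q^{k+1}t_j)\prod_{i=1}^n t_i^{\alpha-1}\frac{(qt_i)_\infty}{(q^\beta t_i)_\infty}\prod_{1\le i<j\le n}t_i^{2k}\Big(q^{1-k}\frac{t_j}{t_i}\Big)_{2k}\,d_qt_1\cdots d_qt_n=q^{C_I}\,P,$$ where $$C_I=\frac{n_1(n_1-1)(2n_1-1)}{6}+\binom{n_1}{2}\alpha+\Big(n_0n_1^2+\frac{n_1(n_1-1)(4n_1-5)}{6}\Big)k+\binom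 n2\alpha k+2\binom n3k^2,$$ and $$\int_{[0,1]^n}\prod_{i=n_0+1}^n t_i(1-t_i)\prod_{n_0+1\le i<j\le n}(t_i-q^{-k-1}t_j)(t_i-q^{k}t_j)\prod_{i=1}^n t_i^{\alpha-1}\frac{(qt_i)_\infty}{(q^\beta t_i)_\infty}\prod_{1\le i<j\le n}t_i^{2k}\Big(q^{-k}\frac{t_j}{t_i}\Big)_{2k}\,d_qt_1\cdots d_qt_n=q^{C_{II}}\,P,$$ where $$C_{II}=\frac{n_1(n_1^2+2)}{3}+\frac{n_1(n_1+1)}{2}\alpha+\Big(\frac{n_1(n_1+1)(3n-n_1-2)}{3}-\binom{n_1}{2}-\binom n2\Big)k+\binom n2\alpha k+2\binom n3k^2.$$
   Context: Notation: $(x)_\infty=\prod_{i\ge 0}(1-xq^i)$; $(x)_m=(x)_\infty/(q^mx)_\infty=\prod_{i=0}^{m-1}(1-xq^i)$ for $m\in\mathbb{Z}_{\ge0}$; $[x]_q=\frac{1-q^x}{1-q}$; $\Gamma_q(x)=\frac{(q)_\infty}{(q^x)_\infty}(1-q)^{1-x}$. The $q$-integral is $$\int_{[0,1]^n}f(t_1,\dots,t_n)\,d_qt_1\cdots d_qt_n=(1-q)^n\sum_{j_1,\dots,j_n=0}^\infty f(q^{j_1},\dots,q^{j_n})\,q^{j_1+\cdots+j_n}.$$ Complex powers of $q$ are $q^z=e^{z\log q}$, and $(q^{j})^{\alpha-1}=q^{j(\alpha-1)}$. When $n_0=0$, the factor $\Gamma_q(\alpha+\beta+1-k)$ (from $j=1$)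 occurs once in the numerator and once in the denominator of $P$ and is understood to be cancelled. *)

theory Defs
  imports "HOL-Analysis.Analysis"
begin

text \<open>Throughout, \<open>0 < q < 1\<close>, and complex powers of positive reals are taken with
  \<^const>\<open>powr\<close> on complex numbers, i.e. \<open>x powr z = exp (z * ln x)\<close>.\<close>

definition qpoch_inf :: "real \<Rightarrow> complex \<Rightarrow> complex" where
  "qpoch_inf q x = (\<Prod>i. 1 - x * complex_of_real q ^ i)"

definition qpoch :: "real \<Rightarrow> complex \<Rightarrow> nat \<Rightarrow> complex" where
  "qpoch q x m = (\<Prod>i<m. 1 - x * complex_of_real q ^ i)"

definition qnumber :: "real \<Rightarrow> complex \<Rightarrow> complex" where
  "qnumber q x = (1 - complex_of_real q powr x) / (1 - complex_of_real q)"

definition qGamma :: "real \<Rightarrow> complex \<Rightarrow> complex" where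
  "qGamma q x = qpoch_inf q (complex_of_real q) / qpoch_inf q (complex_of_real q powr x)
                  * complex_of_real (1 - q) powr (1 - x)"

text \<open>Points of \<open>[0,1]\<^sup>n\<close> are functions on the index set \<open>{1..n}\<close>; integrands only look at
  these indices. The sum over the exponents is the unconditional sum \<^const>\<open>infsum\<close>, and
  \<open>q_integrable\<close> says that it converges (absolutely, as the values are complex).\<close>

definition q_integrable :: "real \<Rightarrow> nat \<Rightarrow> ((nat \<Rightarrow> real) \<Rightarrow> complex) \<Rightarrow> bool" where
  "q_integrable q n f \<longleftrightarrow>
     (\<lambda>e. f (\<lambda>i. q ^ e i) * complex_of_real (q ^ (\<Sum>i=1..n. e i)))
       summable_on ({1..n} \<rightarrow>\<^sub>E (UNIV :: nat set))"

definition q_integral :: "real \<Rightarrow> nat \<Rightarrow> ((nat \<Rightarrow> real) \<Rightarrow> complex) \<Rightarrow> complex" where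
  "q_integral q n f = complex_of_real (1 - q) ^ n *
     (\<Sum>\<^sub>\<infinity>e\<in>{1..n} \<rightarrow>\<^sub>E (UNIV :: nat set).
        f (\<lambda>i. q ^ e i) * complex_of_real (q ^ (\<Sum>i=1..n. e i)))"

text \<open>For \<open>n\<^sub>0 = 0\<close> the factor \<open>\<Gamma>\<^sub>q(\<alpha>+\<beta>+1-k)\<close> occurs for \<open>j = 1\<close> both in the numerator and
  in the denominator, and it may be a pole. It is cancelled by letting the two products
  in which it occurs start at \<open>j = 2\<close> in that case. The numbers \<open>n\<^sub>0 + j - 2\<close> may be
  negative, so all arithmetic in the arguments takes place in the complex numbers.\<close>

definition gamma_product :: "real \<Rightarrow> nat \<Rightarrow> nat \<Rightarrow> complex \<Rightarrow> complex \<Rightarrow> nat \<Rightarrow> complex" where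
  "gamma_product q n0 n1 \<alpha> \<beta> k =
    (let N0 = complex_of_nat n0; K = complex_of_nat k; c = complex_of_nat;
         j0 = (if n0 = 0 then 2 else 1)
     in (\<Prod>i=1..n0. qGamma q (1 + c i * K) * qGamma q (\<alpha> + (c i - 1) * K)
                       * qGamma q (\<beta> + (c i - 1) * K)
                     / (qGamma q (1 + K) * qGamma q (\<alpha> + \<beta> + (N0 + c i - 2) * K)))
      * (\<Prod>j=1..n1. qnumber q ((1 + K) * c j) * qGamma q (c j + (N0 + c j) * K)
                     / qGamma q (2 + K))
      * (\<Prod>j=1..n1. qGamma q (\<alpha> + c j + (N0 + c j - 1) * K)
                     * qGamma q (\<beta> + c j + (N0 + c j - 1) * K))
      * (\<Prod>j=j0..n1. qGamma q (\<alpha> + \<beta> + c j + (N0 + c j - 2) * K))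
      * (\<Prod>j=j0..2*n1. inverse (qGamma q (\<alpha> + \<beta> + c j + (2 * N0 + c j - 2) * K))))"

definition exponent_I :: "nat \<Rightarrow> nat \<Rightarrow> complex \<Rightarrow> nat \<Rightarrow> complex" where
  "exponent_I n0 n1 \<alpha> k =
    (let n = n0 + n1; N0 = complex_of_nat n0; N1 = complex_of_nat n1; K = complex_of_nat k
     in N1 * (N1 - 1) * (2 * N1 - 1) / 6
        + of_nat (n1 choose 2) * \<alpha>
        + (N0 * N1\<^sup>2 + N1 * (N1 - 1) * (4 * N1 - 5) / 6) * K
        + of_nat (n choose 2) * \<alpha> * K
        + 2 * of_nat (n choose 3) * K\<^sup>2)"

definition exponent_II :: "nat \<Rightarrow> nat \<Rightarrow> complex \<Rightarrow> nat \<Rightarrow> complex" where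
  "exponent_II n0 n1 \<alpha> k =
    (let n = n0 + n1; N = complex_of_nat n; N1 = complex_of_nat n1; K = complex_of_nat k
     in N1 * (N1\<^sup>2 + 2) / 3
        + N1 * (N1 + 1) / 2 * \<alpha>
        + (N1 * (N1 + 1) * (3 * N - N1 - 2) / 3
             - of_nat (n1 choose 2) - of_nat (n choose 2)) * K
        + of_nat (n choose 2) * \<alpha> * K
        + 2 * of_nat (n choose 3) * K\<^sup>2)"

definition integrand_I ::
    "real \<Rightarrow> nat \<Rightarrow> nat \<Rightarrow> complex \<Rightarrow> complex \<Rightarrow> nat \<Rightarrow> (nat \<Rightarrow> real) \<Rightarrow> complex" where
  "integrand_I q n0 n1 \<alpha> \<beta> k t =
    (let n = n0 + n1; Q = complex_of_real q; T = (\<lambda>i. complex_of_real (t i))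
     in (\<Prod>i=n0+1..n. T i * (1 - Q powr \<beta> * T i))
      * (\<Prod>i=n0+1..n. \<Prod>j=i+1..n.
           (T i - Q powi (- int k) * T j) * (T i - Q ^ (k + 1) * T j))
      * (\<Prod>i=1..n. T i powr (\<alpha> - 1) * (qpoch_inf q (Q * T i) / qpoch_inf q (Q powr \<beta> * T i)))
      * (\<Prod>i=1..n. \<Prod>j=i+1..n.
           T i ^ (2 * k) * qpoch q (Q powi (1 - int k) * (T j / T i)) (2 * k)))"

definition integrand_II ::
    "real \<Rightarrow> nat \<Rightarrow> nat \<Rightarrow> complex \<Rightarrow> complex \<Rightarrow> nat \<Rightarrow> (nat \<Rightarrow> real) \<Rightarrow> complex" where
  "integrand_II q n0 n1 \<alpha> \<beta> k t =
    (let n = n0 + n1; Q = complex_of_real q; T = (\<lambda>i. complex_of_real (t i))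
     in (\<Prod>i=n0+1..n. T i * (1 - T i))
      * (\<Prod>i=n0+1..n. \<Prod>j=i+1..n.
           (T i - Q powi (- int k - 1) * T j) * (T i - Q ^ k * T j))
      * (\<Prod>i=1..n. T i powr (\<alpha> - 1) * (qpoch_inf q (Q * T i) / qpoch_inf q (Q powr \<beta> * T i)))
      * (\<Prod>i=1..n. \<Prod>j=i+1..n.
           T i ^ (2 * k) * qpoch q (Q powi (- int k) * (T j / T i)) (2 * k)))"

end

theory Submission
  imports Defs "HOL-Computational_Algebra.Polynomial"
begin

text \<open>Write \<open>A = q\<^sup>\<alpha>\<close>, \<open>B = q\<^sup>\<beta>\<close>, \<open>c = A B\<close>. By the \<open>q\<close>-binomial theorem the moments of the weight in
  one variable are proportional to \<open>(A)\<^sub>m / (c)\<^sub>m\<close>, so each integral is a finite sum over the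
  coefficients of a homogeneous polynomial \<open>V\<close>, a product of linear factors \<open>t\<^sub>i - q\<^sup>s t\<^sub>j\<close>. At points
  \<open>t\<^sub>i = q\<^sup>e\<close> the polynomial \<open>V\<close> vanishes unless the exponents are well separated. With the
  combinatorial Nullstellensatz this makes the sum divisible by an explicit polynomial \<open>R(A)\<close>, and
  with Newton interpolation (the moment functional takes \<open>(B t)\<^sub>m\<close> to \<open>(B)\<^sub>m / (c)\<^sub>m\<close>) by
  \<open>R(B)\<close>. For fixed \<open>c\<close> this exhausts the degree in \<open>A\<close>, so only a factor depending on \<open>c\<close> is
  left; letting \<open>A\<close> tend to \<open>1\<close> sends one variable to \<open>0\<close> and gives a recursion in \<open>n\<^sub>0\<close> for it.
  The case \<open>n\<^sub>0 = 0\<close> is the case \<open>n\<^sub>1 = 0\<close> with \<open>k + 1\<close> in place of \<open>k\<close>. The second integral is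
  reduced to the first by reversing the order of the variables inside both groups.\<close>

subsection \<open>Newton interpolation\<close>

text \<open>For fixed \<open>c\<close> the sum is a polynomial in \<open>A\<close> whose degree is
  at most \<open>D\<close>, the degree of \<open>V\<close>, while \<open>R\<close> has degree
  \<open>D / 2\<close>. The factor \<open>R(B)\<close> comes from the values of \<open>V\<close> at
  points \<open>q^(-e)\<close>: interpolation there expresses \<open>B^m (A)_m / (c)_m\<close>
  through the quotients \<open>(B)_j / (c)_j\<close>, and homogeneity is essential, because it makes
  the powers \<open>B^m\<close> of the single variables combine to the constant \<open>B^D\<close>.
  The two divisors may be multiplied since their roots, powers of \<open>1 / q\<close> and numbers
  \<open>c q^e\<close> with \<open>|c| < 1\<close>, never meet. At \<open>A = 1\<close> the
  functional of a first type variable is evaluation at 0. If \<open>k >= 1\<close>, separation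
  admits only one such zero, so all but one of these variables contribute a factor
  \<open>1 - A\<close>. For \<open>k = 0\<close> this breaks down, but then the first type does not
  occur in \<open>V\<close> at all. Second type variables have moments
  \<open>(A q)_m / (c q^2)_m\<close> and never degenerate in this limit. Hence the recursion stops
  at \<open>n0 = 0\<close>, and that case has to be reached by exchanging the roles of the
  types.\<close>

primrec newton_weight :: "(nat \<Rightarrow> complex) \<Rightarrow> nat \<Rightarrow> nat \<Rightarrow> complex" where
  "newton_weight x 0 = (\<lambda>e. 1)"
| "newton_weight x (Suc m) = (\<lambda>e. if e \<le> m then newton_weight x m e / (x e - x (Suc m))
      else - (\<Sum>j\<le>m. newton_weight x m j / (x j - x (Suc m))))"

text \<open>This is the divided difference of \<open>t ^ \<nu>\<close> at the nodes
  \<open>x 0\<close>, ..., \<open>x m\<close>, that is, the coefficient of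
  \<open>(t - x 0) ... (t - x (m - 1))\<close> in the Newton expansion of \<open>t ^ \<nu>\<close>.
  For \<open>m > 0\<close> the last weight in \<open>newton_weight\<close> is fixed by the demand
  that constants are annihilated, which avoids the partial fraction form of the weights.\<close>

definition newton_coeff :: "(nat \<Rightarrow> complex) \<Rightarrow> nat \<Rightarrow> nat \<Rightarrow> complex" where
  "newton_coeff x m \<nu> = (\<Sum>e\<le>m. newton_weight x m e * x e ^ \<nu>)"

lemma newton_coeff_0: "newton_coeff x m 0 = (if m = 0 then 1 else 0)"
  by (cases m) (simp_all add: newton_coeff_def)

lemma newton_coeff_0_Suc: "newton_coeff x 0 (Suc \<nu>) = x 0 * newton_coeff x 0 \<nu>"
  by (simp add: newton_coeff_def)

text \<open>Leibniz rule for the divided difference of \<open>t * t ^ \<nu>\<close>. Multiplying a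
  weight by \<open>x e - x (Suc m)\<close> removes the last node and leaves the weight for the
  shorter list.\<close>

lemma newton_coeff_Suc_Suc:
  assumes "inj x"
  shows "newton_coeff x (Suc m) (Suc \<nu>) = newton_coeff x m \<nu> + x (Suc m) * newton_coeff x (Suc m) \<nu>"
proof -
  have "newton_coeff x (Suc m) (Suc \<nu>) - x (Suc m) * newton_coeff x (Suc m) \<nu>
      = (\<Sum>e\<le>Suc m. newton_weight x (Suc m) e * (x e - x (Suc m)) * x e ^ \<nu>)"
    unfolding newton_coeff_def sum_distrib_left sum_subtractf[symmetric]
    by (intro sum.cong) (auto simp: algebra_simps)
  also have "\<dots> = (\<Sum>e\<le>m. newton_weight x (Suc m) e * (x e - x (Suc m)) * x e ^ \<nu>)"
    by simp
  also have "\<dots> = newton_coeff x m \<nu>"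
    unfolding newton_coeff_def
  proof (intro sum.cong refl)
    fix e assume "e \<in> {..m}"
    hence "x e \<noteq> x (Suc m)" using assms by (auto dest: injD)
    thus "newton_weight x (Suc m) e * (x e - x (Suc m)) * x e ^ \<nu> = newton_weight x m e * x e ^ \<nu>"
      using \<open>e \<in> {..m}\<close> by simp
  qed
  finally show ?thesis by (simp add: algebra_simps)
qed

lemma newton_coeff_triangular:
  assumes "inj x" and "\<nu> \<le> m"
  shows "newton_coeff x m \<nu> = (if m = \<nu> then 1 else 0)"
  using assms(2)
proof (induction \<nu> arbitrary: m)
  case 0
  thus ?case by (simp add: newton_coeff_0)
next
  case (Suc \<nu>)
  then obtain m' where m: "m = Suc m'" by (cases m) auto
  show ?case using Suc by (simp add: m newton_coeff_Suc_Suc[OF assms(1)])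
qed

text \<open>Think of a linear functional with value \<open>\<Phi> m\<close> at the Newton polynomial
  of degree \<open>m\<close>. Multiplication by \<open>t\<close> sends this polynomial to the next
  one plus \<open>x m\<close> times itself, so the right-hand side is the functional at
  \<open>t * t ^ \<nu>\<close>. The bound on \<open>\<nu>\<close> makes the term with
  \<open>\<Phi> (Suc M)\<close> vanish.\<close>

lemma newton_sum:
  fixes \<Phi> :: "nat \<Rightarrow> complex"
  assumes "inj x" and "\<nu> < M"
  shows "(\<Sum>m\<le>M. newton_coeff x m (Suc \<nu>) * \<Phi> m)
       = (\<Sum>m\<le>M. newton_coeff x m \<nu> * (\<Phi> (Suc m) + x m * \<Phi> m))"
proof -
  obtain M' where M: "M = Suc M'" using assms(2) by (cases M) auto
  have z: "newton_coeff x (Suc M') \<nu> = 0"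
    using newton_coeff_triangular[OF assms(1), of \<nu> "Suc M'"] assms(2) M by auto
  have "(\<Sum>m\<le>M. newton_coeff x m (Suc \<nu>) * \<Phi> m)
      = x 0 * newton_coeff x 0 \<nu> * \<Phi> 0 + (\<Sum>m\<le>M'. newton_coeff x (Suc m) (Suc \<nu>) * \<Phi> (Suc m))"
    unfolding M by (subst sum.atMost_Suc_shift) (simp add: newton_coeff_0_Suc)
  also have "(\<Sum>m\<le>M'. newton_coeff x (Suc m) (Suc \<nu>) * \<Phi> (Suc m))
      = (\<Sum>m\<le>M'. newton_coeff x m \<nu> * \<Phi> (Suc m)) + (\<Sum>m\<le>M'. x (Suc m) * newton_coeff x (Suc m) \<nu> * \<Phi> (Suc m))"
    unfolding sum.distrib[symmetric]
    by (intro sum.cong refl) (simp add: newton_coeff_Suc_Suc[OF assms(1)] algebra_simps)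
  also have "(\<Sum>m\<le>M'. newton_coeff x m \<nu> * \<Phi> (Suc m)) = (\<Sum>m\<le>M. newton_coeff x m \<nu> * \<Phi> (Suc m))"
    unfolding M using z by simp
  also have "x 0 * newton_coeff x 0 \<nu> * \<Phi> 0 + (\<dots> + (\<Sum>m\<le>M'. x (Suc m) * newton_coeff x (Suc m) \<nu> * \<Phi> (Suc m)))
     = (\<Sum>m\<le>M. newton_coeff x m \<nu> * \<Phi> (Suc m)) + (\<Sum>m\<le>M. x m * newton_coeff x m \<nu> * \<Phi> m)"
    unfolding M by (subst (3) sum.atMost_Suc_shift) simp
  also have "\<dots> = (\<Sum>m\<le>M. newton_coeff x m \<nu> * (\<Phi> (Suc m) + x m * \<Phi> m))"
    unfolding sum.distrib[symmetric] by (intro sum.cong refl) (simp add: ring_distribs)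
  finally show ?thesis .
qed

subsection \<open>Chains of separated exponents\<close>

text \<open>The indices in \<open>S\<close> and \<open>T\<close> stand for the variables \<open>t\<^sub>i\<close> with \<open>i \<le> n\<^sub>0\<close> and \<open>i > n\<^sub>0\<close>. Exponents
  of indices in \<open>T\<close> are counted from \<open>1\<close>; this makes the minimal length of a chain independent of
  the order in which the two types alternate.\<close>

definition separated :: "nat \<Rightarrow> nat set \<Rightarrow> nat set \<Rightarrow> (nat \<Rightarrow> nat) \<Rightarrow> bool" where
  "separated k S T e \<longleftrightarrow>
     (\<forall>i\<in>S. \<forall>j\<in>S. i \<noteq> j \<longrightarrow> e j \<ge> e i + k \<or> e i \<ge> e j + k) \<and>
     (\<forall>i\<in>T. \<forall>j\<in>T. i \<noteq> j \<longrightarrow> e j \<ge> e i + k + 1 \<or> e i \<ge> e j + k + 1) \<and>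
     (\<forall>i\<in>S. \<forall>j\<in>T. e j \<ge> e i + k + 1 \<or> e i \<ge> e j + k) \<and>
     (\<forall>i\<in>T. e i \<ge> 1)"

lemma separated_mono: "separated k S T e \<Longrightarrow> S' \<subseteq> S \<Longrightarrow> T' \<subseteq> T \<Longrightarrow> separated k S' T' e"
  unfolding separated_def by (meson subsetD)

text \<open>With ties broken suitably, the largest exponent exceeds every other one by at least
  \<open>k\<close>, and by at least \<open>k + 1\<close> if it belongs to \<open>T\<close>. Removing
  it again and again adds up to a bound that does not depend on how the types alternate.\<close>

lemma separated_max:
  assumes "finite S" "finite T" "S \<inter> T = {}" "separated k S T e" "S \<union> T \<noteq> {}"
  shows "\<exists>m\<in>S \<union> T. e m \<ge> k * (card (S \<union> T) - 1) + card T"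
  using assms
proof (induction "card (S \<union> T)" arbitrary: S T)
  case 0
  thus ?case by simp
next
  case (Suc u)
  \<comment> \<open>Lexicographic order with ties decided in favour of \<open>S\<close>. Exponents
    of different types can be equal when \<open>k = 0\<close>; with this choice a maximum in
    \<open>T\<close> is strictly larger than every exponent in \<open>S\<close>, which yields the
    additional 1.\<close>
  define key where "key = (\<lambda>i. 2 * e i + of_bool (i \<in> S))"
  have "finite (key ` (S \<union> T))" "key ` (S \<union> T) \<noteq> {}" using Suc.prems by auto
  from Max_in[OF this] obtain m where m: "m \<in> S \<union> T" "key m = Max (key ` (S \<union> T))" by (metis imageE)
  have mx: "key i \<le> key m" if "i \<in> S \<union> T" for i
    using that Suc.prems m(2) by auto
  define S' T' where "S' = S - {m}" and "T' = T - {m}"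
  have un: "S' \<union> T' = (S \<union> T) - {m}" unfolding S'_def T'_def by auto
  have cu: "card (S' \<union> T') = u" unfolding un using m(1) Suc.hyps(2) Suc.prems by simp
  have cS: "card (S \<union> T) = Suc u" using Suc.hyps(2) by simp
  have cT: "card T = card T' + of_bool (m \<in> T)"
    unfolding T'_def using Suc.prems(2) card.remove[of T m] by (cases "m \<in> T") simp_all
  have sep: "separated k S' T' e" using Suc.prems(4) by (rule separated_mono) (auto simp: S'_def T'_def)
  show ?case
  proof (cases "S' \<union> T' = {}")
    case True
    hence "u = 0" "T' = {}" using cu by auto
    hence "k * (card (S \<union> T) - 1) + card T = of_bool (m \<in> T)" using cS cT by simp
    also have "\<dots> \<le> e m" using Suc.prems(4) by (auto simp: separated_def)
    finally show ?thesis using m(1) by blast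
  next
    case False
    have "\<exists>m'\<in>S' \<union> T'. e m' \<ge> k * (card (S' \<union> T') - 1) + card T'"
      by (rule Suc.hyps(1)) (use Suc.prems sep False cu in \<open>auto simp: S'_def T'_def\<close>)
    then obtain m' where m': "m' \<in> S' \<union> T'" "e m' \<ge> k * (u - 1) + card T'" using cu by auto
    have "u \<noteq> 0" using False cu Suc.prems(1,2) by (auto simp: S'_def T'_def)
    then obtain v where v: "u = Suc v" by (cases u) auto
    have ne: "m' \<noteq> m" "m' \<in> S \<union> T" using m'(1) by (auto simp: S'_def T'_def)
    have "e m \<ge> e m' + k + of_bool (m \<in> T)"
    proof -
      consider "m \<in> S" "m' \<in> S" | "m \<in> T" "m' \<in> T" | "m \<in> S" "m' \<in> T" | "m \<in> T" "m' \<in> S"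
        using m(1) ne by blast
      thus ?thesis
      proof cases
        case 1
        hence "m \<notin> T" using Suc.prems(3) by auto
        moreover have "e m \<ge> e m'" using mx[of m'] 1 by (simp add: key_def)
        moreover have "e m \<ge> e m' + k \<or> e m' \<ge> e m + k" using Suc.prems(4) 1 ne unfolding separated_def by blast
        ultimately show ?thesis by auto
      next
        case 2
        hence "m \<notin> S" "m' \<notin> S" using Suc.prems(3) by auto
        hence "e m \<ge> e m'" using mx[of m'] 2 by (simp add: key_def)
        moreover have "e m \<ge> e m' + k + 1 \<or> e m' \<ge> e m + k + 1" using Suc.prems(4) 2 ne unfolding separated_def by blast
        ultimately show ?thesis using 2 by auto
      next
        case 3
        hence nt: "m \<notin> T" "m' \<notin> S" using Suc.prems(3) by auto
        hence "e m \<ge> e m'" using mx[of m'] 3 by (simp add: key_def)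
        moreover have "e m' \<ge> e m + k + 1 \<or> e m \<ge> e m' + k" using Suc.prems(4) 3 unfolding separated_def by blast
        ultimately show ?thesis using nt by auto
      next
        case 4
        hence nt: "m \<notin> S" "m' \<notin> T" using Suc.prems(3) by auto
        hence "e m > e m'" using mx[of m'] 4 by (simp add: key_def)
        moreover have "e m \<ge> e m' + k + 1 \<or> e m' \<ge> e m + k" using Suc.prems(4) 4 unfolding separated_def by blast
        ultimately show ?thesis using 4 by auto
      qed
    qed
    moreover have "k * (card (S \<union> T) - 1) + card T = k * (u - 1) + card T' + k + of_bool (m \<in> T)"
      unfolding cS cT v by simp
    ultimately have "e m \<ge> k * (card (S \<union> T) - 1) + card T" using m'(2) by linarith
    thus ?thesis using m(1) by blast
  qed
qed

text \<open>Divisibility form of the bound on chains: a largest exponent is peeled off and compared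
  with the last factor on the left. The hypothesis is \<open>card S \<le> n0\<close> and not an
  equality because the removed index may lie in \<open>S\<close> while \<open>n0\<close> has to stay
  fixed.\<close>

lemma separated_prod_dvd:
  fixes f :: "nat \<Rightarrow> 'a :: comm_semiring_1"
  assumes "finite S" "finite T" "S \<inter> T = {}" "separated k S T e" "card S \<le> n0"
    and f: "\<And>m m'. m \<le> m' \<Longrightarrow> f m dvd f m'"
  shows "(\<Prod>u<card (S \<union> T). f (k * u + (u + 1 - n0))) dvd (\<Prod>i\<in>S \<union> T. f (e i))"
  using assms(1-5)
proof (induction "card (S \<union> T)" arbitrary: S T)
  case 0
  thus ?case by simp
next
  case (Suc u)
  have "S \<union> T \<noteq> {}" using Suc.hyps(2) by auto
  from separated_max[OF Suc.prems(1-4) this]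
  obtain m where m: "m \<in> S \<union> T" "e m \<ge> k * u + card T" using Suc.hyps(2)[symmetric] by auto
  define S' T' where "S' = S - {m}" and "T' = T - {m}"
  have un: "S' \<union> T' = (S \<union> T) - {m}" unfolding S'_def T'_def by auto
  have cu: "card (S' \<union> T') = u" unfolding un using m(1) Suc.hyps(2) Suc.prems by simp
  have sep: "separated k S' T' e" using Suc.prems(4) by (rule separated_mono) (auto simp: S'_def T'_def)
  have "card S' \<le> n0" using Suc.prems(1,5) by (auto simp: S'_def intro: le_trans[OF card_Diff1_le])
  hence IH: "(\<Prod>u<u. f (k * u + (u + 1 - n0))) dvd (\<Prod>i\<in>S' \<union> T'. f (e i))"
    using Suc.hyps(1)[of S' T'] Suc.prems sep cu by (auto simp: S'_def T'_def)
  have "card (S \<union> T) = card S + card T" using Suc.prems by (simp add: card_Un_disjoint)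
  hence "u + 1 - n0 \<le> card T" using Suc.hyps(2) Suc.prems(5) by linarith
  hence "f (k * u + (u + 1 - n0)) dvd f (e m)" using m(2) by (intro f) linarith
  hence "(\<Prod>u<Suc u. f (k * u + (u + 1 - n0))) dvd (\<Prod>i\<in>S' \<union> T'. f (e i)) * f (e m)"
    using IH by (simp add: mult_dvd_mono)
  also have "(\<Prod>i\<in>S' \<union> T'. f (e i)) * f (e m) = (\<Prod>i\<in>S \<union> T. f (e i))"
    unfolding un using m(1) Suc.prems(1,2) by (subst prod.remove[of "S \<union> T" m]) (auto simp: mult.commute)
  finally show ?case using Suc.hyps(2) by simp
qed

subsection \<open>Homogeneous polynomials in finitely many variables\<close>

definition multi_exps :: "nat set \<Rightarrow> nat \<Rightarrow> (nat \<Rightarrow> nat) set" where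
  "multi_exps I D = {d \<in> PiE I (\<lambda>_. {..D}). sum d I = D}"

text \<open>The coefficient of \<open>t\<^sup>d\<close>, read off from the values on a grid. It is the right one
  for polynomials that are homogeneous of degree \<open>sum d I\<close>.\<close>

definition mcoeff :: "(nat \<Rightarrow> complex) \<Rightarrow> nat set \<Rightarrow> ((nat \<Rightarrow> complex) \<Rightarrow> complex) \<Rightarrow> (nat \<Rightarrow> nat) \<Rightarrow> complex" where
  "mcoeff x I F d = (\<Sum>e\<in>PiE I (\<lambda>i. {..d i}). (\<Prod>i\<in>I. newton_weight x (d i) (e i)) * F (\<lambda>i. x (e i)))"

text \<open>Polynomials are plain functions here, and the property says that the coefficients read
  off from the grid reproduce the function. In this form a nonzero coefficient leads directly to a
  nonzero value at a grid point.\<close>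

definition homogeneous :: "(nat \<Rightarrow> complex) \<Rightarrow> nat set \<Rightarrow> nat \<Rightarrow> ((nat \<Rightarrow> complex) \<Rightarrow> complex) \<Rightarrow> bool" where
  "homogeneous x I D F \<longleftrightarrow> (\<forall>t. F t = (\<Sum>d\<in>multi_exps I D. mcoeff x I F d * (\<Prod>i\<in>I. t i ^ d i)))"

lemma finite_multi_exps [simp]: "finite I \<Longrightarrow> finite (multi_exps I D)"
  unfolding multi_exps_def by (rule finite_subset[of _ "PiE I (\<lambda>_. {..D})"]) (auto intro: finite_PiE)

lemma multi_expsD: "d \<in> multi_exps I D \<Longrightarrow> sum d I = D" "d \<in> multi_exps I D \<Longrightarrow> i \<in> I \<Longrightarrow> d i \<le> D"
  "d \<in> multi_exps I D \<Longrightarrow> d \<in> extensional I"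
  by (auto simp: multi_exps_def PiE_def)

lemma restrict_in_multi_exps:
  assumes "finite I" "sum m I = D"
  shows "restrict m I \<in> multi_exps I D"
  using assms member_le_sum[of _ I m] by (auto simp: multi_exps_def)

text \<open>The combinatorial Nullstellensatz for one monomial. If two exponent vectors have equal
  sums and differ, then \<open>m i < d i\<close> for some \<open>i\<close>, and the divided
  difference of order \<open>d i\<close> kills \<open>t ^ m i\<close>.\<close>

lemma mcoeff_monomial:
  assumes "finite I" "inj x" "sum m I = D" "d \<in> multi_exps I D"
  shows "mcoeff x I (\<lambda>t. \<Prod>i\<in>I. t i ^ m i) d = (if d = restrict m I then 1 else 0)"
proof -
  have "mcoeff x I (\<lambda>t. \<Prod>i\<in>I. t i ^ m i) d = (\<Prod>i\<in>I. newton_coeff x (d i) (m i))"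
    unfolding mcoeff_def newton_coeff_def using assms(1)
    by (subst prod_sum_PiE) (auto simp: prod.distrib)
  also have "\<dots> = (if d = restrict m I then 1 else 0)"
  proof (cases "d = restrict m I")
    case True
    thus ?thesis by (auto simp: newton_coeff_triangular[OF assms(2)])
  next
    case False
    have "\<exists>i\<in>I. m i < d i"
    proof (rule ccontr)
      assume "\<not> ?thesis"
      hence le: "\<And>i. i \<in> I \<Longrightarrow> d i \<le> m i" by force
      have "sum d I = sum m I" using assms multi_expsD by auto
      hence "\<And>i. i \<in> I \<Longrightarrow> d i = m i"
        using le assms(1) by (metis sum_mono_inv)
      hence "d = restrict m I" using multi_expsD(3)[OF assms(4)] by (auto simp: fun_eq_iff extensional_def)
      thus False using False by simp
    qed
    then obtain i where "i \<in> I" "m i < d i" by blast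
    hence "newton_coeff x (d i) (m i) = 0" by (simp add: newton_coeff_triangular[OF assms(2)])
    thus ?thesis using False \<open>i \<in> I\<close> assms(1) by (auto intro!: prod_zero)
  qed
  finally show ?thesis .
qed

text \<open>A functional given on monomials by \<open>\<psi>\<close> has the same value for every
  presentation of \<open>F\<close> by monomials of degree \<open>D\<close>. This is what allows two
  presentations of one kernel to be compared.\<close>

lemma mcoeff_sum:
  fixes \<psi> :: "(nat \<Rightarrow> nat) \<Rightarrow> complex"
  assumes "finite I" "inj x" "finite Y" "\<And>y. y \<in> Y \<Longrightarrow> sum (m y) I = D"
    and F: "\<And>t. F t = (\<Sum>y\<in>Y. c y * (\<Prod>i\<in>I. t i ^ m y i))"
  shows "(\<Sum>d\<in>multi_exps I D. mcoeff x I F d * \<psi> d) = (\<Sum>y\<in>Y. c y * \<psi> (restrict (m y) I))"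
proof -
  have "mcoeff x I F d = (\<Sum>y\<in>Y. c y * mcoeff x I (\<lambda>t. \<Prod>i\<in>I. t i ^ m y i) d)" for d
    unfolding mcoeff_def F sum_distrib_left
    by (subst sum.swap) (simp add: algebra_simps)
  hence "(\<Sum>d\<in>multi_exps I D. mcoeff x I F d * \<psi> d)
      = (\<Sum>d\<in>multi_exps I D. \<Sum>y\<in>Y. c y * mcoeff x I (\<lambda>t. \<Prod>i\<in>I. t i ^ m y i) d * \<psi> d)"
    by (simp add: sum_distrib_right)
  also have "\<dots> = (\<Sum>y\<in>Y. \<Sum>d\<in>multi_exps I D. c y * mcoeff x I (\<lambda>t. \<Prod>i\<in>I. t i ^ m y i) d * \<psi> d)"
    by (rule sum.swap)
  also have "\<dots> = (\<Sum>y\<in>Y. \<Sum>d\<in>multi_exps I D. if d = restrict (m y) I then c y * \<psi> d else 0)"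
    using assms by (intro sum.cong refl) (auto simp: mcoeff_monomial)
  also have "\<dots> = (\<Sum>y\<in>Y. c y * \<psi> (restrict (m y) I))"
    using assms by (intro sum.cong refl) (simp add: restrict_in_multi_exps)
  finally show ?thesis .
qed

lemma homogeneousI:
  assumes "finite I" "inj x" "finite Y" "\<And>y. y \<in> Y \<Longrightarrow> sum (m y) I = D"
    and F: "\<And>t. F t = (\<Sum>y\<in>Y. c y * (\<Prod>i\<in>I. t i ^ m y i))"
  shows "homogeneous x I D F"
  unfolding homogeneous_def
proof
  fix t :: "nat \<Rightarrow> complex"
  show "F t = (\<Sum>d\<in>multi_exps I D. mcoeff x I F d * (\<Prod>i\<in>I. t i ^ d i))"
  proof -
    have "(\<Sum>d\<in>multi_exps I D. mcoeff x I F d * (\<Prod>i\<in>I. t i ^ d i))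
        = (\<Sum>y\<in>Y. c y * (\<Prod>i\<in>I. t i ^ restrict (m y) I i))"
      by (rule mcoeff_sum[OF assms])
    thus ?thesis by (simp add: F)
  qed
qed

lemma homogeneous_1: "finite I \<Longrightarrow> inj x \<Longrightarrow> homogeneous x I 0 (\<lambda>t. 1)"
  by (rule homogeneousI[where Y = "{()}" and m = "\<lambda>_ _. 0" and c = "\<lambda>_. 1"]) auto

lemma homogeneous_mult_linear:
  assumes "finite I" "inj x" "homogeneous x I D F" "a \<in> I" "b \<in> I"
  shows "homogeneous x I (Suc D) (\<lambda>t. F t * (t a - z * t b))"
proof (rule homogeneousI[where Y = "multi_exps I D \<times> {False, True}"
      and m = "\<lambda>y i. fst y i + of_bool (i = (if snd y then b else a))"
      and c = "\<lambda>y. mcoeff x I F (fst y) * (if snd y then - z else 1)"])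
  show "sum (\<lambda>i. fst y i + of_bool (i = (if snd y then b else a))) I = Suc D"
    if "y \<in> multi_exps I D \<times> {False, True}" for y
    using that assms by (auto simp: sum.distrib multi_expsD(1) of_bool_def)
  fix t :: "nat \<Rightarrow> complex"
  have one: "(\<Prod>i\<in>I. t i ^ (d i + of_bool (i = a))) = (\<Prod>i\<in>I. t i ^ d i) * t a" if "a \<in> I" for d a
  proof -
    have "(\<Prod>i\<in>I. t i ^ of_bool (i = a)) = (\<Prod>i\<in>I. if i = a then t i else 1)"
      by (intro prod.cong) auto
    also have "\<dots> = t a" using assms(1) that by (simp add: prod.delta)
    finally show ?thesis by (simp add: power_add prod.distrib)
  qed
  have "F t * (t a - z * t b) = (\<Sum>d\<in>multi_exps I D. mcoeff x I F d * (\<Prod>i\<in>I. t i ^ d i) * (t a - z * t b))"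
    using assms(3)[unfolded homogeneous_def, rule_format, of t] by (simp add: sum_distrib_right)
  also have "\<dots> = (\<Sum>d\<in>multi_exps I D. \<Sum>s\<in>{False,True}. mcoeff x I F d * (if s then - z else 1) *
     (\<Prod>i\<in>I. t i ^ (d i + of_bool (i = (if s then b else a)))))"
    using assms by (intro sum.cong refl) (simp add: one algebra_simps)
  also have "\<dots> = (\<Sum>y\<in>multi_exps I D \<times> {False, True}. mcoeff x I F (fst y) * (if snd y then - z else 1) *
     (\<Prod>i\<in>I. t i ^ (fst y i + of_bool (i = (if snd y then b else a)))))"
    by (subst sum.cartesian_product) (simp only: case_prod_unfold)
  finally show "F t * (t a - z * t b) = (\<Sum>y\<in>multi_exps I D \<times> {False, True}. mcoeff x I F (fst y) * (if snd y then - z else 1) *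
     (\<Prod>i\<in>I. t i ^ (fst y i + of_bool (i = (if snd y then b else a)))))" .
qed (use assms in auto)

lemma homogeneous_mult_linears:
  assumes "finite I" "inj x" "homogeneous x I D F" "finite J" "\<And>j. j \<in> J \<Longrightarrow> a j \<in> I \<and> b j \<in> I"
  shows "homogeneous x I (D + card J) (\<lambda>t. F t * (\<Prod>j\<in>J. t (a j) - z j * t (b j)))"
  using assms(4,5)
proof (induction J rule: finite_induct)
  case empty
  thus ?case using assms(3) by simp
next
  case (insert j J)
  have "homogeneous x I (Suc (D + card J)) (\<lambda>t. F t * (\<Prod>j\<in>J. t (a j) - z j * t (b j)) * (t (a j) - z j * t (b j)))"
    by (rule homogeneous_mult_linear) (use insert assms in auto)
  thus ?case using insert by (simp add: algebra_simps)
qed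

text \<open>Each variable is expanded in the Newton basis of its own nodes \<open>X i\<close>. After
  exchanging the sums, the coefficient of a product of Newton polynomials is an iterated divided
  difference of \<open>F\<close>, hence zero unless \<open>F\<close> is nonzero at one of these
  nodes.\<close>

lemma homogeneous_newton:
  fixes \<phi> \<Phi> :: "nat \<Rightarrow> nat \<Rightarrow> complex"
  assumes "finite I" "homogeneous x I D F"
    and \<phi>: "\<And>i \<nu>. i \<in> I \<Longrightarrow> \<nu> \<le> D \<Longrightarrow> \<phi> i \<nu> = (\<Sum>m\<le>D. newton_coeff (X i) m \<nu> * \<Phi> i m)"
  shows "(\<Sum>d\<in>multi_exps I D. mcoeff x I F d * (\<Prod>i\<in>I. \<phi> i (d i)))
       = (\<Sum>m\<in>PiE I (\<lambda>_. {..D}). (\<Sum>e\<in>PiE I (\<lambda>i. {..m i}).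
            (\<Prod>i\<in>I. newton_weight (X i) (m i) (e i)) * F (\<lambda>i. X i (e i))) * (\<Prod>i\<in>I. \<Phi> i (m i)))"
proof -
  have "(\<Sum>d\<in>multi_exps I D. mcoeff x I F d * (\<Prod>i\<in>I. \<phi> i (d i)))
     = (\<Sum>d\<in>multi_exps I D. mcoeff x I F d *
          (\<Sum>m\<in>PiE I (\<lambda>_. {..D}). (\<Prod>i\<in>I. newton_coeff (X i) (m i) (d i)) * (\<Prod>i\<in>I. \<Phi> i (m i))))"
  proof (intro sum.cong refl)
    fix d assume d: "d \<in> multi_exps I D"
    have "(\<Prod>i\<in>I. \<phi> i (d i)) = (\<Prod>i\<in>I. \<Sum>m\<le>D. newton_coeff (X i) m (d i) * \<Phi> i m)"
      using d by (intro prod.cong refl \<phi>) (auto simp: multi_expsD)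
    also have "\<dots> = (\<Sum>m\<in>PiE I (\<lambda>_. {..D}). (\<Prod>i\<in>I. newton_coeff (X i) (m i) (d i)) * (\<Prod>i\<in>I. \<Phi> i (m i)))"
      using assms(1) by (subst prod_sum_PiE) (auto simp: prod.distrib)
    finally show "mcoeff x I F d * (\<Prod>i\<in>I. \<phi> i (d i)) = mcoeff x I F d * \<dots>" by simp
  qed
  also have "\<dots> = (\<Sum>m\<in>PiE I (\<lambda>_. {..D}). \<Sum>d\<in>multi_exps I D. mcoeff x I F d *
          (\<Prod>i\<in>I. newton_coeff (X i) (m i) (d i)) * (\<Prod>i\<in>I. \<Phi> i (m i)))"
    unfolding sum_distrib_left by (subst sum.swap) (simp add: mult.assoc)
  also have "\<dots> = (\<Sum>m\<in>PiE I (\<lambda>_. {..D}). (\<Sum>d\<in>multi_exps I D. mcoeff x I F d *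
          (\<Prod>i\<in>I. newton_coeff (X i) (m i) (d i))) * (\<Prod>i\<in>I. \<Phi> i (m i)))"
    by (simp add: sum_distrib_right)
  also have "\<dots> = (\<Sum>m\<in>PiE I (\<lambda>_. {..D}). (\<Sum>e\<in>PiE I (\<lambda>i. {..m i}).
            (\<Prod>i\<in>I. newton_weight (X i) (m i) (e i)) * F (\<lambda>i. X i (e i))) * (\<Prod>i\<in>I. \<Phi> i (m i)))"
  proof (intro sum.cong refl)
    fix m
    have "(\<Sum>d\<in>multi_exps I D. mcoeff x I F d * (\<Prod>i\<in>I. newton_coeff (X i) (m i) (d i)))
      = (\<Sum>d\<in>multi_exps I D. \<Sum>e\<in>PiE I (\<lambda>i. {..m i}). mcoeff x I F d *
           ((\<Prod>i\<in>I. newton_weight (X i) (m i) (e i)) * (\<Prod>i\<in>I. X i (e i) ^ d i)))"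
      unfolding newton_coeff_def using assms(1)
      by (subst prod_sum_PiE) (auto simp: prod.distrib sum_distrib_left)
    also have "\<dots> = (\<Sum>e\<in>PiE I (\<lambda>i. {..m i}). (\<Prod>i\<in>I. newton_weight (X i) (m i) (e i)) *
           (\<Sum>d\<in>multi_exps I D. mcoeff x I F d * (\<Prod>i\<in>I. X i (e i) ^ d i)))"
      unfolding sum_distrib_left by (subst sum.swap) (simp add: mult_ac)
    also have "\<dots> = (\<Sum>e\<in>PiE I (\<lambda>i. {..m i}). (\<Prod>i\<in>I. newton_weight (X i) (m i) (e i)) * F (\<lambda>i. X i (e i)))"
      using assms(2) unfolding homogeneous_def by metis
    finally show "(\<Sum>d\<in>multi_exps I D. mcoeff x I F d * (\<Prod>i\<in>I. newton_coeff (X i) (m i) (d i))) * (\<Prod>i\<in>I. \<Phi> i (m i))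
        = \<dots> * (\<Prod>i\<in>I. \<Phi> i (m i))" by simp
  qed
  finally show ?thesis .
qed

subsection \<open>The kernel\<close>

text \<open>Homogeneous form of \<open>a ^ (2 * k)\<close> times the q-shifted factorial of
  \<open>q^(1 - k) b / a\<close> with \<open>2 * k\<close> factors. It stays meaningful at
  \<open>a = 0\<close>, which is needed when a variable is sent to zero.\<close>

definition pair_factor :: "real \<Rightarrow> nat \<Rightarrow> complex \<Rightarrow> complex \<Rightarrow> complex" where
  "pair_factor q k a b = (\<Prod>s<2*k. a - complex_of_real q powi (1 - int k + int s) * b)"

text \<open>The two additional linear factors of a pair inside \<open>T\<close> extend the product
  of the pair by one factor at either end, so they amount to replacing \<open>k\<close> by
  \<open>k + 1\<close>.\<close>

definition pair_mult :: "nat \<Rightarrow> nat set \<Rightarrow> nat \<Rightarrow> nat \<Rightarrow> nat" where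
  "pair_mult k T i j = (if i \<in> T \<and> j \<in> T then k + 1 else k)"

definition pairs :: "nat set \<Rightarrow> (nat \<times> nat) set" where
  "pairs I = {(i, j). i \<in> I \<and> j \<in> I \<and> i < j}"

definition pair_kernel :: "real \<Rightarrow> nat \<Rightarrow> nat set \<Rightarrow> nat set \<Rightarrow> (nat \<Rightarrow> complex) \<Rightarrow> complex" where
  "pair_kernel q k S T t = (\<Prod>(i, j)\<in>pairs (S \<union> T). pair_factor q (pair_mult k T i j) (t i) (t j))"

definition kernel_deg :: "nat \<Rightarrow> nat set \<Rightarrow> nat set \<Rightarrow> nat" where
  "kernel_deg k S T = (\<Sum>(i, j)\<in>pairs (S \<union> T). 2 * pair_mult k T i j)"

lemma finite_pairs [simp]: "finite I \<Longrightarrow> finite (pairs I)"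
  by (rule finite_subset[of _ "I \<times> I"]) (auto simp: pairs_def)

lemma card_pairs: "finite I \<Longrightarrow> card (pairs I) = card I choose 2"
proof (induction I rule: finite_linorder_max_induct)
  case empty
  thus ?case by (simp add: pairs_def)
next
  case (insert b A)
  have "pairs (insert b A) = pairs A \<union> (\<lambda>a. (a, b)) ` A"
    using insert by (force simp: pairs_def)
  moreover have "pairs A \<inter> (\<lambda>a. (a, b)) ` A = {}" using insert by (auto simp: pairs_def)
  ultimately have "card (pairs (insert b A)) = (card A choose 2) + card A"
    using insert by (simp add: card_Un_disjoint card_image inj_on_def)
  thus ?case using insert by (auto simp: numeral_2_eq_2)
qed

lemma kernel_homogeneous:
  assumes "finite S" "finite T" "inj x"
  shows "homogeneous x (S \<union> T) (kernel_deg k S T) (pair_kernel q k S T)"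
proof -
  let ?J = "Sigma (pairs (S \<union> T)) (\<lambda>(i, j). {..<2 * pair_mult k T i j})"
  let ?z = "\<lambda>((i, j), s). complex_of_real q powi (1 - int (pair_mult k T i j) + int s)"
  have "homogeneous x (S \<union> T) (0 + card ?J) (\<lambda>t. 1 * (\<Prod>y\<in>?J. t (fst (fst y)) - ?z y * t (snd (fst y))))"
    by (rule homogeneous_mult_linears) (use assms in \<open>auto simp: homogeneous_1 pairs_def[symmetric] intro!: finite_SigmaI\<close>, auto simp: pairs_def)
  moreover have "card ?J = kernel_deg k S T"
    unfolding kernel_deg_def using assms by (subst card_SigmaI) (auto simp: case_prod_unfold)
  moreover have "(\<Prod>y\<in>?J. t (fst (fst y)) - ?z y * t (snd (fst y))) = pair_kernel q k S T t" for t
    unfolding pair_kernel_def pair_factor_def using assms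
    by (simp add: case_prod_unfold prod.Sigma)
  ultimately show ?thesis by simp
qed

lemma kernel_deg_eq:
  assumes "finite S" "finite T" "S \<inter> T = {}"
  shows "kernel_deg k S T = 2 * (k * (card S + card T choose 2) + (card T choose 2))"
proof -
  have "kernel_deg k S T = (\<Sum>p\<in>pairs (S \<union> T). 2 * k + (if p \<in> pairs T then 2 else 0))"
    unfolding kernel_deg_def by (intro sum.cong refl) (auto simp: pair_mult_def pairs_def split: if_splits)
  also have "\<dots> = 2 * k * card (pairs (S \<union> T)) + (\<Sum>p\<in>pairs (S \<union> T). if p \<in> pairs T then 2 else 0)"
    by (simp add: sum.distrib)
  also have "(\<Sum>p\<in>pairs (S \<union> T). if p \<in> pairs T then 2 else (0::nat)) = (\<Sum>p\<in>pairs T. 2)"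
    by (rule sum.mono_neutral_cong_right) (use assms in simp, auto simp: pairs_def)
  finally show ?thesis using assms by (simp add: card_pairs card_Un_disjoint)
qed

subsection \<open>Divisibility of the moment sum\<close>

definition type_shift :: "nat set \<Rightarrow> nat \<Rightarrow> nat" where
  "type_shift T i = of_bool (i \<in> T)"

definition qpoly :: "real \<Rightarrow> nat \<Rightarrow> nat \<Rightarrow> complex poly" where
  "qpoly q r m = (\<Prod>s<m. [:1, - (complex_of_real q ^ (s + r)):])"

text \<open>The \<open>(u + 1)\<close>-st smallest exponent of a separated family with \<open>n\<^sub>0\<close> members of the first type is
  at least \<open>k u + (u + 1 - n\<^sub>0)\<close>. One root is split off for the members beyond the first \<open>n\<^sub>0\<close>, so that
  \<open>chain_poly\<close> can be compared with the moments \<open>(A q)\<^sub>m\<close> of the second type.\<close>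

definition chain_exp :: "nat \<Rightarrow> nat \<Rightarrow> nat \<Rightarrow> nat" where
  "chain_exp k n0 u = k * u + (u - n0)"

definition chain_poly :: "real \<Rightarrow> nat \<Rightarrow> nat \<Rightarrow> nat \<Rightarrow> complex poly" where
  "chain_poly q k n0 n = (\<Prod>u<n. qpoly q (of_bool (n0 \<le> u)) (chain_exp k n0 u))"

text \<open>For a variable of the second type the factor \<open>t (1 - B t)\<close> in the integrand
  raises \<open>\<alpha>\<close> and \<open>\<beta>\<close> by one; this replaces \<open>A\<close>
  by \<open>A q\<close> and \<open>c = A B\<close> by \<open>c q^2\<close>.\<close>

definition type_moment :: "real \<Rightarrow> nat set \<Rightarrow> complex \<Rightarrow> complex \<Rightarrow> nat \<Rightarrow> nat \<Rightarrow> complex" where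
  "type_moment q T A c i m =
     qpoch q (A * complex_of_real q ^ type_shift T i) m / qpoch q (c * complex_of_real q ^ (2 * type_shift T i)) m"

definition moment_sum :: "real \<Rightarrow> nat \<Rightarrow> nat set \<Rightarrow> nat set \<Rightarrow> complex \<Rightarrow> complex \<Rightarrow> complex" where
  "moment_sum q k S T A c = (\<Sum>d\<in>multi_exps (S \<union> T) (kernel_deg k S T).
     mcoeff (\<lambda>e. complex_of_real q ^ e) (S \<union> T) (pair_kernel q k S T) d * (\<Prod>i\<in>S \<union> T. type_moment q T A c i (d i)))"

lemma poly_qpoly: "poly (qpoly q r m) A = qpoch q (A * complex_of_real q ^ r) m"
  by (simp add: qpoly_def qpoch_def poly_prod power_add algebra_simps)

lemma qpoly_dvd_mono: "m \<le> m' \<Longrightarrow> qpoly q r m dvd qpoly q r m'"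
  unfolding qpoly_def by (rule prod_dvd_prod_subset) auto

lemma qpoly_shift: "qpoly q 1 m * [:1, -1:] = qpoly q 0 (Suc m)"
  unfolding qpoly_def prod.lessThan_Suc_shift by (simp add: mult.commute)

lemma qpoly_shift': "r \<le> 1 \<Longrightarrow> qpoly q r m * [:1, -1:] ^ r = qpoly q 0 (m + r)"
  using qpoly_shift[of q m] by (cases r) auto

lemma qpoly_nonzero: "qpoly q r m \<noteq> 0"
  unfolding qpoly_def by (auto simp: prod_zero_iff)

lemma degree_qpoly: "0 < q \<Longrightarrow> degree (qpoly q r m) = m"
  unfolding qpoly_def by (subst degree_prod_eq_sum_degree) auto

text \<open>Multiplication by \<open>1 - A\<close> turns the shifted product of a second type
  variable into one that starts at \<open>A\<close> and has one more factor. Both sides contain such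
  products equally often, so the chain bound can be applied first and the factors
  \<open>1 - A\<close> cancelled afterwards.\<close>

lemma chain_poly_dvd:
  assumes "finite S" "finite T" "S \<inter> T = {}" "separated k S T (\<lambda>i. e i + type_shift T i)"
  shows "chain_poly q k (card S) (card (S \<union> T)) dvd (\<Prod>i\<in>S \<union> T. qpoly q (type_shift T i) (e i))"
proof -
  let ?a = "card S" and ?N = "card (S \<union> T)"
  let ?x = "[:1, -1:] :: complex poly"
  have "(\<Prod>u<?N. qpoly q 0 (k * u + (u + 1 - ?a))) dvd (\<Prod>i\<in>S \<union> T. qpoly q 0 (e i + type_shift T i))"
    by (rule separated_prod_dvd[OF assms order.refl]) (auto intro: qpoly_dvd_mono)
  also have "(\<Prod>i\<in>S \<union> T. qpoly q 0 (e i + type_shift T i))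
     = (\<Prod>i\<in>S \<union> T. qpoly q (type_shift T i) (e i)) * ?x ^ (\<Sum>i\<in>S \<union> T. type_shift T i)"
    unfolding power_sum prod.distrib[symmetric]
    by (intro prod.cong refl qpoly_shift'[symmetric]) (auto simp: type_shift_def)
  also have "(\<Sum>i\<in>S \<union> T. type_shift T i) = (\<Sum>i\<in>T. 1)"
    using assms by (intro sum.mono_neutral_cong_right) (auto simp: type_shift_def)
  also have "(\<Prod>u<?N. qpoly q 0 (k * u + (u + 1 - ?a)))
     = (\<Prod>u<?N. qpoly q (of_bool (?a \<le> u)) (chain_exp k ?a u) * ?x ^ of_bool (?a \<le> u))"
  proof (intro prod.cong refl)
    fix u
    have "chain_exp k ?a u + of_bool (?a \<le> u) = k * u + (u + 1 - ?a)"
      by (auto simp: chain_exp_def)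
    thus "qpoly q 0 (k * u + (u + 1 - ?a)) = qpoly q (of_bool (?a \<le> u)) (chain_exp k ?a u) * ?x ^ of_bool (?a \<le> u)"
      by (subst qpoly_shift') auto
  qed
  also have "\<dots> = chain_poly q k ?a ?N * ?x ^ (\<Sum>u<?N. of_bool (?a \<le> u))"
    unfolding chain_poly_def prod.distrib power_sum ..
  also have "(\<Sum>u<?N. of_bool (?a \<le> u)) = (\<Sum>u\<in>{?a..<?N}. (1::nat))"
    by (rule sum.mono_neutral_cong_right) auto
  also have "\<dots> = (\<Sum>i\<in>T. 1)" using assms by (simp add: card_Un_disjoint)
  finally show ?thesis by (subst (asm) dvd_mult_cancel_right) simp
qed

text \<open>The exponents in the product run through \<open>1 - k\<close>, ..., \<open>k\<close>,
  and a factor is zero as soon as \<open>a - b\<close> is one of them.\<close>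

lemma pair_factor_nonzeroD:
  assumes "0 < q" "pair_factor q k (complex_of_real q powi a) (complex_of_real q powi b) \<noteq> 0"
  shows "b \<ge> a + int k \<or> a \<ge> b + int k + 1"
proof (rule ccontr)
  assume "\<not> ?thesis"
  hence s: "nat (a - b - 1 + int k) < 2 * k" "int (nat (a - b - 1 + int k)) = a - b - 1 + int k" by auto
  have "complex_of_real q powi a - complex_of_real q powi (1 - int k + int (nat (a - b - 1 + int k))) * complex_of_real q powi b = 0"
    unfolding s(2) using assms(1) by (subst power_int_add[symmetric]) auto
  hence "pair_factor q k (complex_of_real q powi a) (complex_of_real q powi b) = 0"
    unfolding pair_factor_def by (intro prod_zero finite_lessThan bexI[OF _ lessThan_iff[THEN iffD2, OF s(1)]])
  thus False using assms by simp
qed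

lemma kernel_nonzeroD:
  assumes "pair_kernel q k S T t \<noteq> 0" "finite S" "finite T" "i \<in> S \<union> T" "j \<in> S \<union> T" "i < j"
  shows "pair_factor q (pair_mult k T i j) (t i) (t j) \<noteq> 0"
proof
  assume z: "pair_factor q (pair_mult k T i j) (t i) (t j) = 0"
  have "pair_kernel q k S T t = 0" unfolding pair_kernel_def
  proof (rule prod_zero)
    show "finite (pairs (S \<union> T))" using assms by simp
    show "\<exists>p\<in>pairs (S \<union> T). (case p of (i, j) \<Rightarrow> pair_factor q (pair_mult k T i j) (t i) (t j)) = 0"
      by (rule bexI[of _ "(i, j)"]) (use assms z in \<open>auto simp: pairs_def\<close>)
  qed
  thus False using assms(1) by simp
qed

lemma separatedI:
  assumes "\<And>i j. i \<in> S \<Longrightarrow> j \<in> T \<Longrightarrow> i < j" "\<And>i. i \<in> T \<Longrightarrow> f i \<ge> 1"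
    and *: "\<And>i j. i \<in> S \<union> T \<Longrightarrow> j \<in> S \<union> T \<Longrightarrow> i < j \<Longrightarrow> (i \<in> S \<longleftrightarrow> j \<in> S) \<Longrightarrow>
      f j \<ge> f i + pair_mult k T i j \<or> f i \<ge> f j + pair_mult k T i j"
    and cross: "\<And>i j. i \<in> S \<Longrightarrow> j \<in> T \<Longrightarrow> f j \<ge> f i + k + 1 \<or> f i \<ge> f j + k"
  shows "separated k S T f"
proof -
  have d: "x \<notin> T" if "x \<in> S" for x using assms(1)[of x x] that by auto
  have S: "f i + k \<le> f j \<or> f j + k \<le> f i" if "i \<in> S" "j \<in> S" "i < j" for i j
    using *[of i j] that d[of i] by (simp add: pair_mult_def)
  have T: "f i + k + 1 \<le> f j \<or> f j + k + 1 \<le> f i" if "i \<in> T" "j \<in> T" "i < j" for i j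
    using *[of i j] that d[of i] d[of j] by (simp add: pair_mult_def) blast
  show ?thesis unfolding separated_def
  proof (intro conjI ballI impI)
    fix i j assume "i \<in> S" "j \<in> S" "i \<noteq> j"
    thus "f i + k \<le> f j \<or> f j + k \<le> f i" using S[of i j] S[of j i] by (metis nat_neq_iff)
  next
    fix i j assume "i \<in> T" "j \<in> T" "i \<noteq> j"
    thus "f i + k + 1 \<le> f j \<or> f j + k + 1 \<le> f i" using T[of i j] T[of j i] by (metis nat_neq_iff)
  qed (use assms(2) cross in auto)
qed

lemma kernel_separated:
  assumes "0 < q" "finite S" "finite T" "\<And>i j. i \<in> S \<Longrightarrow> j \<in> T \<Longrightarrow> i < j"
    and "pair_kernel q k S T (\<lambda>i. complex_of_real q ^ e i) \<noteq> 0"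
  shows "separated k S T (\<lambda>i. e i + type_shift T i)"
proof -
  have *: "e j \<ge> e i + pair_mult k T i j \<or> e i \<ge> e j + pair_mult k T i j + 1"
    if "i \<in> S \<union> T" "j \<in> S \<union> T" "i < j" for i j
    using pair_factor_nonzeroD[OF assms(1), of "pair_mult k T i j" "int (e i)" "int (e j)"]
      kernel_nonzeroD[OF assms(5,2,3) that] by auto
  have d: "x \<notin> T" if "x \<in> S" for x using assms(4)[of x x] that by auto
  show ?thesis
  proof (rule separatedI)
    fix i j assume ij: "i \<in> S \<union> T" "j \<in> S \<union> T" "i < j" "i \<in> S \<longleftrightarrow> j \<in> S"
    hence "type_shift T i = type_shift T j" using d by (auto simp: type_shift_def)
    thus "e j + type_shift T j \<ge> e i + type_shift T i + pair_mult k T i j \<or>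
        e i + type_shift T i \<ge> e j + type_shift T j + pair_mult k T i j"
      using *[OF ij(1-3)] by auto
  next
    fix i j assume "i \<in> S" "j \<in> T"
    thus "e j + type_shift T j \<ge> e i + type_shift T i + k + 1 \<or> e i + type_shift T i \<ge> e j + type_shift T j + k"
      using *[of i j] d assms(4)[of i j] by (auto simp: type_shift_def pair_mult_def)
  qed (use assms(4) in \<open>auto simp: type_shift_def\<close>)
qed

text \<open>Inverting the points reverses the inequalities of a pair, so for a mixed pair the gaps
  \<open>k\<close> and \<open>k + 1\<close> change places. In \<open>kernel_separated\<close> the
  points are unshifted, here they carry the shift of the second type, and this difference
  compensates the exchange. Both kinds of nodes therefore lead to the same separated
  families.\<close>

lemma kernel_inverse_separated:
  assumes "0 < q" "finite S" "finite T" "\<And>i j. i \<in> S \<Longrightarrow> j \<in> T \<Longrightarrow> i < j"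
    and "pair_kernel q k S T (\<lambda>i. inverse (complex_of_real q ^ (e i + type_shift T i))) \<noteq> 0"
  shows "separated k S T (\<lambda>i. e i + type_shift T i)"
proof -
  define f where "f = (\<lambda>i. e i + type_shift T i)"
  have *: "f i \<ge> f j + pair_mult k T i j \<or> f j \<ge> f i + pair_mult k T i j + 1"
    if "i \<in> S \<union> T" "j \<in> S \<union> T" "i < j" for i j
  proof -
    have "pair_factor q (pair_mult k T i j) (complex_of_real q powi (- int (f i))) (complex_of_real q powi (- int (f j))) \<noteq> 0"
      using kernel_nonzeroD[OF assms(5,2,3) that] unfolding power_int_minus power_int_of_nat by (simp add: f_def)
    from pair_factor_nonzeroD[OF assms(1) this] show ?thesis by linarith
  qed
  have "separated k S T f"
  proof (rule separatedI)
    fix i j assume "i \<in> S \<union> T" "j \<in> S \<union> T" "i < j"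
    from *[OF this] show "f j \<ge> f i + pair_mult k T i j \<or> f i \<ge> f j + pair_mult k T i j" by linarith
  next
    fix i j assume ij: "i \<in> S" "j \<in> T"
    hence "i \<notin> T" using assms(4)[of i i] by auto
    thus "f j \<ge> f i + k + 1 \<or> f i \<ge> f j + k"
      using *[of i j] assms(4)[of i j] ij by (auto simp: pair_mult_def)
  qed (use assms(4) in \<open>auto simp: f_def type_shift_def\<close>)
  thus ?thesis by (simp add: f_def)
qed

lemma inj_powers: "0 < q \<Longrightarrow> q < 1 \<Longrightarrow> inj (\<lambda>e. complex_of_real q ^ e)"
  by (auto simp: inj_def of_real_power[symmetric] power_inject_exp' simp del: of_real_power)

lemma inj_inverse_powers:
  assumes "0 < q" "q < 1"
  shows "inj (\<lambda>e. inverse (complex_of_real q ^ (e + r)))"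
proof (rule injI)
  fix a b assume "inverse (complex_of_real q ^ (a + r)) = inverse (complex_of_real q ^ (b + r))"
  hence "complex_of_real q ^ (a + r) = complex_of_real q ^ (b + r)" by simp
  from injD[OF inj_powers[OF assms] this] show "a = b" by simp
qed

text \<open>The coefficient is a weighted sum of values of the kernel on the grid below
  \<open>d\<close>, so one of these values is nonzero.\<close>

lemma mcoeff_nonzero_separated:
  assumes "0 < q" "finite S" "finite T" "\<And>i j. i \<in> S \<Longrightarrow> j \<in> T \<Longrightarrow> i < j"
    and "mcoeff (\<lambda>e. complex_of_real q ^ e) (S \<union> T) (pair_kernel q k S T) d \<noteq> 0"
  shows "\<exists>e. (\<forall>i\<in>S \<union> T. e i \<le> d i) \<and> separated k S T (\<lambda>i. e i + type_shift T i)"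
proof -
  from sum.not_neutral_contains_not_neutral[OF assms(5)[unfolded mcoeff_def]]
  obtain e where "e \<in> PiE (S \<union> T) (\<lambda>i. {..d i})" "pair_kernel q k S T (\<lambda>i. complex_of_real q ^ e i) \<noteq> 0"
    by auto
  thus ?thesis using kernel_separated[OF assms(1-4), of k e] by (intro exI[of _ e]) auto
qed

lemma chain_poly_dvd_above:
  assumes "finite S" "finite T" "S \<inter> T = {}" "separated k S T (\<lambda>i. e i + type_shift T i)"
    "\<forall>i\<in>S \<union> T. e i \<le> d i"
  shows "chain_poly q k (card S) (card (S \<union> T)) dvd (\<Prod>i\<in>S \<union> T. qpoly q (type_shift T i) (d i))"
  by (rule dvd_trans[OF chain_poly_dvd[OF assms(1-4)]]) (use assms(5) in \<open>auto intro!: prod_dvd_prod qpoly_dvd_mono\<close>)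

lemma qpoch_nonzero:
  assumes "0 < q" "q < 1" "norm c < 1"
  shows "qpoch q c m \<noteq> 0"
proof -
  have "1 - c * complex_of_real q ^ i \<noteq> 0" for i
  proof
    assume "1 - c * complex_of_real q ^ i = 0"
    hence "norm (c * complex_of_real q ^ i) = 1" by (metis eq_iff_diff_eq_0 norm_one)
    moreover have "norm c * q ^ i \<le> norm c * 1"
      using assms by (intro mult_left_mono power_le_one) auto
    ultimately show False using assms by (simp add: norm_mult norm_power)
  qed
  thus ?thesis by (auto simp: qpoch_def)
qed

lemma qpoch_Suc: "qpoch q x (Suc m) = qpoch q x m * (1 - x * complex_of_real q ^ m)"
  by (simp add: qpoch_def)

lemma qpoch_Suc_shift: "qpoch q x (Suc m) = (1 - x) * qpoch q (x * complex_of_real q) m"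
  unfolding qpoch_def prod.lessThan_Suc_shift by (simp add: algebra_simps)

text \<open>The \<open>q\<close>-Chu--Vandermonde sum: the functional with moments \<open>(A)\<^sub>\<nu> / (c)\<^sub>\<nu>\<close> takes the
  value \<open>(B)\<^sub>m / (c)\<^sub>m\<close> at \<open>(B t)\<^sub>m\<close> when \<open>A B = c\<close>.\<close>

lemma moment_newton:
  fixes A B c r :: complex
  assumes q: "0 < q" "q < 1" and r: "r \<noteq> 0" and "norm c < 1" "A * B = c" "\<nu> \<le> M"
  defines "x \<equiv> (\<lambda>e. r * inverse (complex_of_real q ^ e))"
  shows "(r * B) ^ \<nu> * (qpoch q A \<nu> / qpoch q c \<nu>) =
    (\<Sum>m\<le>M. newton_coeff x m \<nu> * ((\<Prod>s<m. - x s) * (qpoch q B m / qpoch q c m)))"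
  using assms(4-6)
proof (induction \<nu> arbitrary: A c)
  case 0
  have "(\<Sum>m\<le>M. newton_coeff x m 0 * ((\<Prod>s<m. - x s) * (qpoch q B m / qpoch q c m)))
      = (\<Sum>m\<le>M. if m = 0 then (\<Prod>s<m. - x s) * (qpoch q B m / qpoch q c m) else 0)"
    by (intro sum.cong) (auto simp: newton_coeff_0)
  also have "\<dots> = 1" by (simp add: qpoch_def)
  finally show ?case by (simp add: qpoch_def)
next
  case (Suc \<nu>)
  let ?Q = "complex_of_real q"
  have inj: "inj x"
    using inj_inverse_powers[OF q, of 0] r by (auto simp: inj_def x_def)
  have cq: "norm (c * ?Q) < 1"
    using Suc.prems(1) q mult_left_le[of q "norm c"] by (simp add: norm_mult)
  have c1: "1 - c \<noteq> 0" using Suc.prems(1) by auto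
  have "(r * B) ^ Suc \<nu> * (qpoch q A (Suc \<nu>) / qpoch q c (Suc \<nu>))
      = r * B * (1 - A) / (1 - c) * ((r * B) ^ \<nu> * (qpoch q (A * ?Q) \<nu> / qpoch q (c * ?Q) \<nu>))"
    by (simp add: qpoch_Suc_shift)
  \<comment> \<open>Splitting off the first factors passes to the parameters \<open>A q\<close> and
    \<open>c q\<close> with the same \<open>B\<close>, so the induction hypothesis applies. What
    remains is an identity for each \<open>m\<close> in the form required by
    \<open>newton_sum\<close>.\<close>
  also have "(r * B) ^ \<nu> * (qpoch q (A * ?Q) \<nu> / qpoch q (c * ?Q) \<nu>)
      = (\<Sum>m\<le>M. newton_coeff x m \<nu> * ((\<Prod>s<m. - x s) * (qpoch q B m / qpoch q (c * ?Q) m)))"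
    using Suc.prems cq by (intro Suc.IH) auto
  also have "r * B * (1 - A) / (1 - c) * \<dots> = (\<Sum>m\<le>M. newton_coeff x m \<nu> *
     ((\<Prod>s<Suc m. - x s) * (qpoch q B (Suc m) / qpoch q c (Suc m)) + x m * ((\<Prod>s<m. - x s) * (qpoch q B m / qpoch q c m))))"
    unfolding sum_distrib_left
  proof (intro sum.cong refl)
    fix m
    let ?p = "\<Prod>s<m. - x s"
    have nz: "qpoch q c m \<noteq> 0" "qpoch q (c * ?Q) m \<noteq> 0" "qpoch q c (Suc m) \<noteq> 0"
      using qpoch_nonzero[OF q] Suc.prems(1) cq by auto
    have cm: "1 - c * ?Q ^ m \<noteq> 0" using nz(3) by (auto simp: qpoch_Suc)
    have rel: "qpoch q c m * (1 - c * ?Q ^ m) = (1 - c) * qpoch q (c * ?Q) m"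
      using qpoch_Suc[of q c m] qpoch_Suc_shift[of q c m] by simp
    have "(\<Prod>s<Suc m. - x s) * (qpoch q B (Suc m) / qpoch q c (Suc m)) + x m * (?p * (qpoch q B m / qpoch q c m))
        = ?p * x m * qpoch q B m * ((1 - c * ?Q ^ m) - (1 - B * ?Q ^ m)) / (qpoch q c m * (1 - c * ?Q ^ m))"
      using nz cm by (simp add: qpoch_Suc divide_simps) (simp add: algebra_simps)
    also have "\<dots> = ?p * qpoch q B m * (x m * ?Q ^ m) * (B - c) / (qpoch q c m * (1 - c * ?Q ^ m))"
      by (simp add: algebra_simps)
    also have "x m * ?Q ^ m = r" using q by (simp add: x_def)
    also have "B - c = B * (1 - A)" using Suc.prems(2) by (simp add: algebra_simps)
    finally show "r * B * (1 - A) / (1 - c) * (newton_coeff x m \<nu> * (?p * (qpoch q B m / qpoch q (c * ?Q) m)))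
       = newton_coeff x m \<nu> * ((\<Prod>s<Suc m. - x s) * (qpoch q B (Suc m) / qpoch q c (Suc m)) + x m * (?p * (qpoch q B m / qpoch q c m)))"
      unfolding rel by simp
  qed
  also have "\<dots> = (\<Sum>m\<le>M. newton_coeff x m (Suc \<nu>) * ((\<Prod>s<m. - x s) * (qpoch q B m / qpoch q c m)))"
    using Suc.prems by (intro newton_sum[symmetric] inj) auto
  finally show ?case .
qed

text \<open>Coprimality tested by values. Roots are counted with multiplicity through the index set:
  every linear factor is split off \<open>u\<close>, because \<open>W\<close> does not vanish at its
  root.\<close>

lemma prod_linear_dvd_cancel:
  fixes r :: "'a \<Rightarrow> complex"
  assumes "finite J" "\<And>j. j \<in> J \<Longrightarrow> poly W (r j) \<noteq> 0" "(\<Prod>j\<in>J. [:- r j, 1:]) dvd W * u"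
  shows "(\<Prod>j\<in>J. [:- r j, 1:]) dvd u"
  using assms
proof (induction J arbitrary: u rule: finite_induct)
  case empty
  thus ?case by simp
next
  case (insert a J)
  have "[:- r a, 1:] dvd W * u"
    using insert.prems(2) insert.hyps by (auto intro: dvd_trans[OF dvd_triv_left])
  hence "poly u (r a) = 0" using insert.prems(1)[of a] by (simp add: dvd_iff_poly_eq_0)
  then obtain u' where u': "u = [:- r a, 1:] * u'" by (auto simp: poly_eq_0_iff_dvd)
  have "[:- r a, 1:] * (\<Prod>j\<in>J. [:- r j, 1:]) dvd W * u"
    using insert.prems(2) unfolding prod.insert[OF insert.hyps] .
  also have "W * u = [:- r a, 1:] * (W * u')" unfolding u' by (rule mult.left_commute)
  finally have "[:- r a, 1:] * (\<Prod>j\<in>J. [:- r j, 1:]) dvd [:- r a, 1:] * (W * u')" .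
  hence dv: "(\<Prod>j\<in>J. [:- r j, 1:]) dvd W * u'" by (subst (asm) dvd_mult_cancel_left) auto
  have "(\<Prod>j\<in>J. [:- r j, 1:]) dvd u'"
    by (rule insert.IH[OF _ dv]) (simp add: insert.prems(1))
  thus ?case unfolding prod.insert[OF insert.hyps] u' by (rule mult_dvd_mono[OF dvd_refl])
qed

lemma degree_prod_qpoly:
  assumes "0 < q" "finite I"
  shows "degree (\<Prod>i\<in>I. qpoly q (r i) (m i)) = sum m I"
  using assms by (subst degree_prod_eq_sum_degree) (auto simp: degree_qpoly qpoly_nonzero)

text \<open>By \<open>kernel_deg_eq\<close> this is half the degree of the kernel, so the two
  divisors of the moment sum fill its degree exactly.\<close>

lemma sum_chain_exp: "(\<Sum>u<a + b. chain_exp k a u) = k * (a + b choose 2) + (b choose 2)"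
proof (induction b)
  case 0
  have "(\<Sum>u<a. chain_exp k a u) = (\<Sum>u<a. k * u)"
    by (intro sum.cong) (auto simp: chain_exp_def)
  also have "\<dots> = k * (a choose 2)"
  proof (induction a)
    case (Suc a)
    thus ?case by (simp add: numeral_2_eq_2 algebra_simps)
  qed simp
  finally show ?case by simp
next
  case (Suc b)
  thus ?case by (simp add: numeral_2_eq_2 algebra_simps chain_exp_def)
qed

lemma poly_eqI_nonzero:
  fixes f g :: "complex poly"
  assumes "\<And>x. x \<noteq> 0 \<Longrightarrow> poly f x = poly g x"
  shows "f = g"
proof (rule ccontr)
  assume "f \<noteq> g"
  hence "finite {x. poly (f - g) x = 0}" by (intro poly_roots_finite) auto
  hence "finite (insert 0 {x. poly (f - g) x = 0})" by simp
  moreover have "insert 0 {x. poly (f - g) x = 0} = UNIV" using assms by auto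
  ultimately show False using infinite_UNIV_char_0 by metis
qed

lemma moment_sum_factor:
  fixes c :: complex
  assumes q: "0 < q" "q < 1" and ST: "finite S" "finite T" "\<And>i j. i \<in> S \<Longrightarrow> j \<in> T \<Longrightarrow> i < j"
    and c: "c \<noteq> 0" "norm c < 1"
  shows "\<exists>\<kappa>. \<forall>A. A \<noteq> 0 \<longrightarrow> moment_sum q k S T A c =
     \<kappa> * A ^ (k * (card S + card T choose 2) + (card T choose 2)) *
     poly (chain_poly q k (card S) (card S + card T)) A * poly (chain_poly q k (card S) (card S + card T)) (c / A)"
proof -
  let ?Q = "complex_of_real q"
  have Q0: "?Q \<noteq> 0" using q by simp
  define I where "I = S \<union> T"
  define D where "D = kernel_deg k S T"
  define Y where "Y = k * (card S + card T choose 2) + (card T choose 2)"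
  define R where "R = chain_poly q k (card S) (card I)"
  define cf where "cf = mcoeff (\<lambda>e. ?Q ^ e) I (pair_kernel q k S T)"
  define \<delta> where "\<delta> = type_shift T"
  have disj: "S \<inter> T = {}" using ST(3) by force
  have fI: "finite I" using ST by (simp add: I_def)
  have cardI: "card I = card S + card T" unfolding I_def using ST disj by (simp add: card_Un_disjoint)
  have DY: "D = 2 * Y" unfolding D_def Y_def using ST disj by (simp add: kernel_deg_eq)
  have hom: "homogeneous (\<lambda>e. ?Q ^ e) I D (pair_kernel q k S T)"
    unfolding I_def D_def by (rule kernel_homogeneous[OF ST(1,2) inj_powers[OF q]])
  have ncq: "norm (c * ?Q ^ m) < 1" for m
  proof -
    have "norm c * q ^ m \<le> norm c * 1"
      using q by (intro mult_left_mono power_le_one) auto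
    thus ?thesis using c(2) q by (simp add: norm_mult norm_power)
  qed

  define p where "p = (\<Sum>d\<in>multi_exps I D. smult (cf d / (\<Prod>i\<in>I. qpoch q (c * ?Q ^ (2 * \<delta> i)) (d i)))
     (\<Prod>i\<in>I. qpoly q (\<delta> i) (d i)))"
  have poly_p: "poly p A = moment_sum q k S T A c" for A
    unfolding p_def moment_sum_def type_moment_def I_def[symmetric] D_def[symmetric] cf_def[symmetric] \<delta>_def[symmetric]
    by (simp add: poly_sum poly_prod poly_qpoly prod_dividef)
  have "degree p \<le> D"
    unfolding p_def using fI
  proof (intro degree_sum_le)
    fix d assume "d \<in> multi_exps I D"
    hence "degree (\<Prod>i\<in>I. qpoly q (\<delta> i) (d i)) = D"
      using multi_expsD(1)[of d I D] by (simp add: degree_prod_qpoly[OF q(1) fI])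
    thus "degree (smult (cf d / (\<Prod>i\<in>I. qpoch q (c * ?Q ^ (2 * \<delta> i)) (d i))) (\<Prod>i\<in>I. qpoly q (\<delta> i) (d i))) \<le> D"
      using degree_smult_le le_trans by blast
  qed auto
  have "R dvd p"
    unfolding p_def
  proof (rule dvd_sum)
    fix d assume "d \<in> multi_exps I D"
    show "R dvd smult (cf d / (\<Prod>i\<in>I. qpoch q (c * ?Q ^ (2 * \<delta> i)) (d i))) (\<Prod>i\<in>I. qpoly q (\<delta> i) (d i))"
    proof (cases "cf d = 0")
      case False
      from mcoeff_nonzero_separated[OF q(1) ST False[unfolded cf_def I_def]]
      show ?thesis unfolding R_def I_def \<delta>_def
        using chain_poly_dvd_above[OF ST(1,2) disj] by (intro dvd_smult) blast
    qed simp
  qed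
  then obtain u where u: "p = R * u" by (rule dvdE)

  \<comment> \<open>In the variable \<open>B t\<close>, with \<open>B = c / A\<close>, these nodes
    are the zeros of the products \<open>(B q^r t)_m\<close>, where \<open>r\<close> is the type
    shift.\<close>
  define X where "X = (\<lambda>i e. inverse (?Q ^ (e + \<delta> i)))"
  define W where "W = (\<lambda>m. \<Sum>e\<in>PiE I (\<lambda>i. {..m i}). (\<Prod>i\<in>I. newton_weight (X i) (m i) (e i)) * pair_kernel q k S T (\<lambda>i. X i (e i)))"
  define p' where "p' = (\<Sum>m\<in>PiE I (\<lambda>_. {..D}). smult (W m * (\<Prod>i\<in>I. (\<Prod>s<m i. - X i s) / qpoch q (c * ?Q ^ (2 * \<delta> i)) (m i)))
     (\<Prod>i\<in>I. qpoly q (\<delta> i) (m i)))"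
  have "R dvd p'"
    unfolding p'_def
  proof (rule dvd_sum)
    fix m assume "m \<in> PiE I (\<lambda>_. {..D})"
    show "R dvd smult (W m * (\<Prod>i\<in>I. (\<Prod>s<m i. - X i s) / qpoch q (c * ?Q ^ (2 * \<delta> i)) (m i))) (\<Prod>i\<in>I. qpoly q (\<delta> i) (m i))"
    proof (cases "W m = 0")
      case False
      from sum.not_neutral_contains_not_neutral[OF False[unfolded W_def]]
      obtain e where e: "e \<in> PiE I (\<lambda>i. {..m i})" "pair_kernel q k S T (\<lambda>i. X i (e i)) \<noteq> 0" by auto
      have "separated k S T (\<lambda>i. e i + type_shift T i)"
        by (rule kernel_inverse_separated[OF q(1) ST]) (use e(2) in \<open>auto simp: X_def \<delta>_def\<close>)
      from chain_poly_dvd_above[OF ST(1,2) disj this, of m q]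
      show ?thesis unfolding R_def \<delta>_def I_def[symmetric] using e(1) by (intro dvd_smult) auto
    qed simp
  qed
  then obtain v where v: "p' = R * v" by (rule dvdE)

  \<comment> \<open>The factor \<open>(c / A) ^ D\<close> collects the powers of
    \<open>B = c / A\<close> that interpolation attaches to the moments of the single
    variables.\<close>
  have dual: "(c / A) ^ D * poly p A = poly p' (c / A)" if "A \<noteq> 0" for A
  proof -
    let ?B = "c / A"
    have "(\<Sum>d\<in>multi_exps I D. cf d * (\<Prod>i\<in>I. ?B ^ d i * type_moment q T A c i (d i)))
       = (\<Sum>m\<in>PiE I (\<lambda>_. {..D}). W m * (\<Prod>i\<in>I. (\<Prod>s<m i. - X i s) *
            (qpoch q (?B * ?Q ^ \<delta> i) (m i) / qpoch q (c * ?Q ^ (2 * \<delta> i)) (m i))))"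
      unfolding cf_def W_def
    proof (rule homogeneous_newton[OF fI hom])
      fix i \<nu> assume "i \<in> I" "\<nu> \<le> D"
      have "(inverse (?Q ^ \<delta> i) * (?B * ?Q ^ \<delta> i)) ^ \<nu> *
          (qpoch q (A * ?Q ^ \<delta> i) \<nu> / qpoch q (c * ?Q ^ (2 * \<delta> i)) \<nu>) =
         (\<Sum>m\<le>D. newton_coeff (\<lambda>e. inverse (?Q ^ \<delta> i) * inverse (?Q ^ e)) m \<nu> *
           ((\<Prod>s<m. - (inverse (?Q ^ \<delta> i) * inverse (?Q ^ s))) *
            (qpoch q (?B * ?Q ^ \<delta> i) m / qpoch q (c * ?Q ^ (2 * \<delta> i)) m)))"
        by (rule moment_newton[OF q]) (use Q0 ncq[of "2 * \<delta> i"] \<open>A \<noteq> 0\<close> \<open>\<nu> \<le> D\<close> in \<open>auto simp: mult_2 power_add\<close>)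
      moreover have "inverse (?Q ^ \<delta> i) * (?B * ?Q ^ \<delta> i) = ?B" using Q0 by simp
      moreover have "(\<lambda>e. inverse (?Q ^ \<delta> i) * inverse (?Q ^ e)) = X i"
        by (auto simp: X_def power_add)
      moreover have "inverse (?Q ^ \<delta> i) * inverse (?Q ^ s) = X i s" for s
        by (auto simp: X_def power_add)
      ultimately show "?B ^ \<nu> * type_moment q T A c i \<nu> = (\<Sum>m\<le>D. newton_coeff (X i) m \<nu> *
           ((\<Prod>s<m. - X i s) * (qpoch q (?B * ?Q ^ \<delta> i) m / qpoch q (c * ?Q ^ (2 * \<delta> i)) m)))"
        unfolding type_moment_def \<delta>_def[symmetric] by (simp only:)
    qed
    also have "\<dots> = poly p' ?B"
      unfolding p'_def by (simp add: poly_sum poly_prod poly_qpoly prod.distrib prod_dividef mult.assoc)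
    finally have "(\<Sum>d\<in>multi_exps I D. cf d * (\<Prod>i\<in>I. ?B ^ d i * type_moment q T A c i (d i))) = poly p' ?B" .
    moreover have "(\<Sum>d\<in>multi_exps I D. cf d * (\<Prod>i\<in>I. ?B ^ d i * type_moment q T A c i (d i))) = ?B ^ D * poly p A"
      unfolding poly_p moment_sum_def I_def[symmetric] D_def[symmetric] cf_def[symmetric] sum_distrib_left
      by (intro sum.cong refl) (simp add: prod.distrib power_sum[symmetric] multi_expsD(1))
    ultimately show ?thesis by simp
  qed

  \<comment> \<open>One index for each factor of \<open>R\<close>, so that multiple roots are kept
    apart.\<close>
  define J where "J = Sigma {..<card I} (\<lambda>u. {..<chain_exp k (card S) u})"
  define e where "e = (\<lambda>(u, s). s + (of_bool (card S \<le> u) :: nat))"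
  have fJ: "finite J" by (auto simp: J_def)
  have cJ: "card J = Y"
    unfolding J_def Y_def cardI by (simp add: sum_chain_exp)
  have Rprod: "R = (\<Prod>j\<in>J. [:1, - (?Q ^ e j):])"
    unfolding R_def chain_poly_def qpoly_def J_def e_def
    by (simp add: prod.Sigma case_prod_unfold)
  define P where "P = (\<Prod>j\<in>J. [:- (c * ?Q ^ e j), 1:])"
  have polyP: "poly P A = A ^ Y * poly R (c / A)" if "A \<noteq> 0" for A
  proof -
    have "poly P A = (\<Prod>j\<in>J. A * (1 - c / A * ?Q ^ e j))"
      unfolding P_def poly_prod using that by (intro prod.cong refl) (simp add: field_simps)
    also have "\<dots> = A ^ Y * poly R (c / A)"
      unfolding Rprod poly_prod prod.distrib by (simp add: cJ mult.commute)
    finally show ?thesis .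
  qed
  have P0: "P \<noteq> 0" unfolding P_def using fJ by (auto simp: prod_zero_iff)
  have R0: "R \<noteq> 0" unfolding Rprod using fJ by (auto simp: prod_zero_iff)
  have degP: "degree P = Y"
    unfolding P_def by (subst degree_prod_eq_sum_degree) (auto simp: cJ)
  have degR: "degree R = Y"
    unfolding Rprod using Q0 by (subst degree_prod_eq_sum_degree) (auto simp: cJ)
  \<comment> \<open>\<open>v\<close> is evaluated at \<open>c / A\<close>. Reversing the
    coefficients of \<open>v(c x)\<close> gives a polynomial in \<open>A\<close> that agrees with it
    up to a power of \<open>A\<close>, so the argument can continue among polynomials.\<close>
  define vr where "vr = reflect_poly (pcompose v [:0, c:])"
  define N where "N = degree (pcompose v [:0, c:])"
  have vr: "poly vr A = A ^ N * poly v (c / A)" if "A \<noteq> 0" for A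
    unfolding vr_def N_def using that by (simp add: poly_reflect_poly_nz poly_pcompose divide_inverse mult.commute)
  have key: "smult (c ^ D) (monom 1 (Y + N) * R) * u = P * (monom 1 D * vr)"
  proof (rule poly_eqI_nonzero)
    fix A :: complex assume A: "A \<noteq> 0"
    have "(c / A) ^ D * (poly R A * poly u A) = poly R (c / A) * poly v (c / A)"
      using dual[OF A] unfolding u v by simp
    hence "c ^ D * (poly R A * poly u A) = A ^ D * (poly R (c / A) * poly v (c / A))"
      using A by (simp add: field_simps)
    hence "c ^ D * (poly R A * poly u A) * (A ^ Y * A ^ N)
        = A ^ D * (poly R (c / A) * poly v (c / A)) * (A ^ Y * A ^ N)" by simp
    thus "poly (smult (c ^ D) (monom 1 (Y + N) * R) * u) A = poly (P * (monom 1 D * vr)) A"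
      using A by (simp add: polyP vr poly_monom power_add mult_ac)
  qed
  have "P dvd u"
    unfolding P_def
  proof (rule prod_linear_dvd_cancel[OF fJ])
    show "(\<Prod>j\<in>J. [:- (c * ?Q ^ e j), 1:]) dvd smult (c ^ D) (monom 1 (Y + N) * R) * u"
      unfolding key P_def[symmetric] by simp
    fix j assume "j \<in> J"
    \<comment> \<open>The roots of \<open>P\<close> are numbers \<open>c q^e\<close> of norm less
      than 1, those of \<open>R\<close> are powers of \<open>1 / q\<close> of norm at least
      1.\<close>
    have "1 - c * ?Q ^ e j * ?Q ^ e i \<noteq> 0" for i
    proof
      assume "1 - c * ?Q ^ e j * ?Q ^ e i = 0"
      hence "norm (c * ?Q ^ (e j + e i)) = 1" by (metis eq_iff_diff_eq_0 norm_one power_add mult.assoc)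
      thus False using ncq[of "e j + e i"] by simp
    qed
    hence "poly R (c * ?Q ^ e j) \<noteq> 0"
      unfolding Rprod poly_prod using fJ by (auto simp: prod_zero_iff)
    thus "poly (smult (c ^ D) (monom 1 (Y + N) * R)) (c * ?Q ^ e j) \<noteq> 0"
      using c Q0 by (simp add: poly_monom)
  qed
  then obtain w where w: "u = P * w" by (rule dvdE)
  have "degree w = 0"
  proof (cases "w = 0")
    case False
    hence "degree p = Y + (Y + degree w)"
      unfolding u w using P0 R0 by (simp add: degree_mult_eq degP degR)
    thus ?thesis using \<open>degree p \<le> D\<close> DY by simp
  qed simp
  then obtain \<kappa> where \<kappa>: "w = [:\<kappa>:]" by (rule degree_eq_zeroE)
  show ?thesis
  proof (intro exI allI impI)
    fix A :: complex assume A: "A \<noteq> 0"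
    show "moment_sum q k S T A c = \<kappa> * A ^ (k * (card S + card T choose 2) + (card T choose 2)) *
     poly (chain_poly q k (card S) (card S + card T)) A * poly (chain_poly q k (card S) (card S + card T)) (c / A)"
      unfolding poly_p[symmetric] u w \<kappa> Y_def[symmetric]
      unfolding cardI[symmetric] R_def[symmetric]
      by (simp add: polyP[OF A] mult_ac)
  qed
qed

subsection \<open>Sending one variable to zero\<close>

lemma pair_factor_Suc:
  "pair_factor q (Suc k) a b = (a - complex_of_real q powi (- int k) * b) * pair_factor q k a b *
     (a - complex_of_real q ^ (k + 1) * b)"
proof -
  have "pair_factor q (Suc k) a b = (\<Prod>s<Suc (Suc (2 * k)). a - complex_of_real q powi (int s - int k) * b)"
    unfolding pair_factor_def by (intro prod.cong) (auto simp: algebra_simps)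
  also have "\<dots> = (a - complex_of_real q powi (- int k) * b) *
      (\<Prod>s<2 * k. a - complex_of_real q powi (int (Suc s) - int k) * b) * (a - complex_of_real q powi (int (Suc (2 * k)) - int k) * b)"
    by (subst prod.lessThan_Suc, subst prod.lessThan_Suc_shift) (simp add: mult.assoc)
  also have "(\<Prod>s<2 * k. a - complex_of_real q powi (int (Suc s) - int k) * b) = pair_factor q k a b"
    unfolding pair_factor_def by (intro prod.cong) (auto simp: algebra_simps)
  also have "int (Suc (2 * k)) - int k = int (k + 1)" by simp
  finally show ?thesis by (simp only: power_int_of_nat)
qed

lemma pair_factor_0_left: "q \<noteq> 0 \<Longrightarrow> pair_factor q k 0 b = complex_of_real q ^ k * b ^ (2 * k)"
proof (induction k)
  case (Suc k)
  have "complex_of_real q powi (- int k) * complex_of_real q ^ k = 1"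
    using Suc.prems by (simp add: power_int_minus)
  thus ?case using Suc by (simp add: pair_factor_Suc algebra_simps power2_eq_square)
qed (simp add: pair_factor_def)

lemma pair_factor_0_right: "pair_factor q k a 0 = a ^ (2 * k)"
  by (simp add: pair_factor_def)

text \<open>Each pair containing \<open>i\<close> leaves the \<open>2 * k\<close>-th power of its
  other variable. An additional \<open>q^k\<close> appears when \<open>i\<close> is the smaller
  index, because then the zero stands in the first argument of \<open>pair_factor\<close>.\<close>

lemma kernel_zero:
  assumes "q \<noteq> 0" "finite S" "finite T" "S \<inter> T = {}" "i \<in> S"
  shows "pair_kernel q k S T (t(i := 0)) = complex_of_real q ^ (k * card {j\<in>S \<union> T. i < j}) *
     (\<Prod>j\<in>S \<union> T - {i}. t j ^ (2 * k)) * pair_kernel q k (S - {i}) T t"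
proof -
  let ?I = "S \<union> T" and ?t = "t(i := 0)"
  let ?g = "\<lambda>(a, b). pair_factor q (pair_mult k T a b) (?t a) (?t b)"
  let ?L = "{j\<in>?I. j < i}" and ?U = "{j\<in>?I. i < j}"
  have iT: "i \<notin> T" using assms by auto
  have I': "S - {i} \<union> T = ?I - {i}" using iT by auto
  have fin: "finite ?I" using assms by auto
  have p: "pairs ?I = pairs (?I - {i}) \<union> ((\<lambda>j. (i, j)) ` ?U \<union> (\<lambda>j. (j, i)) ` ?L)"
    using assms(5) by (force simp: pairs_def)
  have fp: "finite (pairs (?I - {i}))" using fin by simp
  have d1: "pairs (?I - {i}) \<inter> ((\<lambda>j. (i, j)) ` ?U \<union> (\<lambda>j. (j, i)) ` ?L) = {}" by (auto simp: pairs_def)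
  have d2: "(\<lambda>j. (i, j)) ` ?U \<inter> (\<lambda>j. (j, i)) ` ?L = {}" by auto
  have "pair_kernel q k S T ?t = prod ?g (pairs (?I - {i})) * (prod ?g ((\<lambda>j. (i, j)) ` ?U) * prod ?g ((\<lambda>j. (j, i)) ` ?L))"
    unfolding pair_kernel_def p
    using fp fin d1 d2 by (simp add: prod.union_disjoint)
  also have "prod ?g (pairs (?I - {i})) = pair_kernel q k (S - {i}) T t"
    unfolding pair_kernel_def I' by (intro prod.cong refl) (auto simp: pairs_def)
  also have "prod ?g ((\<lambda>j. (i, j)) ` ?U) = (\<Prod>j\<in>?U. complex_of_real q ^ k * t j ^ (2 * k))"
    by (subst prod.reindex) (auto simp: inj_on_def pair_mult_def iT pair_factor_0_left[OF assms(1)] intro!: prod.cong)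
  also have "prod ?g ((\<lambda>j. (j, i)) ` ?L) = (\<Prod>j\<in>?L. t j ^ (2 * k))"
    by (subst prod.reindex) (auto simp: inj_on_def pair_mult_def iT pair_factor_0_right intro!: prod.cong)
  also have "(\<Prod>j\<in>?U. complex_of_real q ^ k * t j ^ (2 * k)) * (\<Prod>j\<in>?L. t j ^ (2 * k))
     = complex_of_real q ^ (k * card ?U) * ((\<Prod>j\<in>?U. t j ^ (2 * k)) * (\<Prod>j\<in>?L. t j ^ (2 * k)))"
    by (simp add: prod.distrib power_mult mult.assoc)
  also have "(\<Prod>j\<in>?U. t j ^ (2 * k)) * (\<Prod>j\<in>?L. t j ^ (2 * k)) = (\<Prod>j\<in>?U \<union> ?L. t j ^ (2 * k))"
    using fin by (intro prod.union_disjoint[symmetric]) auto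
  also have "?U \<union> ?L = ?I - {i}" by auto
  finally show ?thesis by (simp only: mult_ac)
qed

lemma qpoch_add: "qpoch q x (m + n) = qpoch q x m * qpoch q (x * complex_of_real q ^ m) n"
proof (induction n)
  case (Suc n)
  thus ?case by (simp add: qpoch_Suc power_add mult_ac)
qed (simp add: qpoch_def)

lemma isCont_qpoch: "isCont (\<lambda>A. qpoch q (A * x) m) z"
  unfolding qpoch_def by (intro continuous_intros)

lemma isCont_eq_at:
  fixes f g :: "complex \<Rightarrow> complex"
  assumes "isCont f z" "isCont g z" "eventually (\<lambda>x. f x = g x) (at z)"
  shows "f z = g z"
proof -
  have "(f \<longlongrightarrow> f z) (at z)" "(g \<longlongrightarrow> g z) (at z)" using assms by (auto simp: isCont_def)
  moreover from this(2) have "(f \<longlongrightarrow> g z) (at z)"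
    by (rule Lim_transform_eventually) (use assms(3) in \<open>auto elim: eventually_mono\<close>)
  ultimately show ?thesis using tendsto_unique[OF trivial_limit_at] by blast
qed

lemma chain_poly_split:
  "poly (chain_poly q k a (a + b)) x =
     (\<Prod>u<a. qpoch q x (k * u)) * (\<Prod>j<b. qpoch q (x * complex_of_real q) (k * (a + j) + j))"
proof (induction b)
  case 0
  show ?case by (auto simp: chain_poly_def poly_prod poly_qpoly chain_exp_def intro!: prod.cong)
next
  case (Suc b)
  thus ?case by (simp add: chain_poly_def poly_qpoly chain_exp_def)
qed

text \<open>The coefficients with \<open>d i = 0\<close> are those of the kernel at
  \<open>t i = 0\<close>. By \<open>kernel_zero\<close> this restriction is also a multiple of the
  smaller kernel times a monomial, and \<open>mcoeff_sum\<close> equates the two presentations. The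
  monomial shifts the arguments of \<open>\<psi>\<close> by \<open>2 * k\<close>.\<close>

lemma moment_sum_remove:
  fixes \<psi> :: "nat \<Rightarrow> nat \<Rightarrow> complex"
  assumes q: "0 < q" "q < 1" and ST: "finite S" "finite T" "\<And>i j. i \<in> S \<Longrightarrow> j \<in> T \<Longrightarrow> i < j" and i: "i \<in> S"
  shows "(\<Sum>d\<in>{d\<in>multi_exps (S \<union> T) (kernel_deg k S T). d i = 0}.
      mcoeff (\<lambda>e. complex_of_real q ^ e) (S \<union> T) (pair_kernel q k S T) d * (\<Prod>j\<in>S \<union> T - {i}. \<psi> j (d j)))
    = complex_of_real q ^ (k * card {j\<in>S \<union> T. i < j}) *
      (\<Sum>d\<in>multi_exps (S - {i} \<union> T) (kernel_deg k (S - {i}) T).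
        mcoeff (\<lambda>e. complex_of_real q ^ e) (S - {i} \<union> T) (pair_kernel q k (S - {i}) T) d *
        (\<Prod>j\<in>S - {i} \<union> T. \<psi> j (d j + 2 * k)))"
proof -
  let ?Q = "complex_of_real q"
  let ?x = "\<lambda>e. complex_of_real q ^ e"
  define I I' D D' where "I = S \<union> T" and "I' = S - {i} \<union> T" and "D = kernel_deg k S T" and "D' = kernel_deg k (S - {i}) T"
  define cf where "cf = mcoeff ?x I (pair_kernel q k S T)"
  define cf' where "cf' = mcoeff ?x I' (pair_kernel q k (S - {i}) T)"
  have disj: "S \<inter> T = {}" using ST(3) by force
  have I': "I' = I - {i}" using i disj by (auto simp: I_def I'_def)
  have fin: "finite I" "finite I'" "i \<in> I" using ST i by (auto simp: I_def I'_def)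
  have inj: "inj ?x" by (rule inj_powers[OF q])
  have hom: "homogeneous ?x I D (pair_kernel q k S T)" "homogeneous ?x I' D' (pair_kernel q k (S - {i}) T)"
    unfolding I_def D_def I'_def D'_def using ST inj by (auto intro: kernel_homogeneous)
  have cS: "card S = Suc (card (S - {i}))" using card.remove[OF ST(1) i] .
  have cI': "card I' = card (S - {i}) + card T"
    unfolding I'_def using ST disj by (subst card_Un_disjoint) auto
  have DD': "D = D' + 2 * k * card I'"
    unfolding D_def D'_def cI' using ST disj
    by (subst (1 2) kernel_deg_eq) (auto simp: cS numeral_2_eq_2 algebra_simps)
  define F where "F = (\<lambda>t. pair_kernel q k S T (t(i := 0)))"
  have F1: "F t = (\<Sum>d\<in>{d\<in>multi_exps I D. d i = 0}. cf d * (\<Prod>j\<in>I'. t j ^ d j))" for t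
  proof -
    have "F t = (\<Sum>d\<in>multi_exps I D. cf d * (\<Prod>j\<in>I. (t(i := 0)) j ^ d j))"
      unfolding F_def cf_def using hom(1) unfolding homogeneous_def by blast
    also have "\<dots> = (\<Sum>d\<in>multi_exps I D. if d i = 0 then cf d * (\<Prod>j\<in>I'. t j ^ d j) else 0)"
    proof (intro sum.cong refl)
      fix d
      have "(\<Prod>j\<in>I. (t(i := 0)) j ^ d j) = 0 ^ d i * (\<Prod>j\<in>I'. (t(i := 0)) j ^ d j)"
        using fin unfolding I' by (subst prod.remove[of I i]) auto
      also have "(\<Prod>j\<in>I'. (t(i := 0)) j ^ d j) = (\<Prod>j\<in>I'. t j ^ d j)"
        by (intro prod.cong) (auto simp: I')
      finally show "cf d * (\<Prod>j\<in>I. (t(i := 0)) j ^ d j) = (if d i = 0 then cf d * (\<Prod>j\<in>I'. t j ^ d j) else 0)"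
        by simp
    qed
    finally show ?thesis using fin by (simp add: sum.inter_filter)
  qed
  have F2: "F t = (\<Sum>d\<in>multi_exps I' D'. ?Q ^ (k * card {j\<in>I. i < j}) * cf' d * (\<Prod>j\<in>I'. t j ^ (d j + 2 * k)))" for t
  proof -
    have "F t = ?Q ^ (k * card {j\<in>I. i < j}) * (\<Prod>j\<in>I'. t j ^ (2 * k)) * pair_kernel q k (S - {i}) T t"
      unfolding F_def I' I_def using q ST disj i by (intro kernel_zero) auto
    also have "pair_kernel q k (S - {i}) T t = (\<Sum>d\<in>multi_exps I' D'. cf' d * (\<Prod>j\<in>I'. t j ^ d j))"
      unfolding cf'_def using hom(2) unfolding homogeneous_def by blast
    finally show ?thesis
      unfolding sum_distrib_left by (simp add: power_add prod.distrib mult_ac)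
  qed
  define \<Psi> where "\<Psi> = (\<lambda>d. \<Prod>j\<in>I'. \<psi> j (d j))"
  have sD: "sum d I' = D" if "d \<in> multi_exps I D" "d i = 0" for d
    using multi_expsD(1)[OF that(1)] that(2) fin unfolding I' by (subst (asm) sum.remove[of I i]) auto
  have e1: "(\<Sum>d\<in>multi_exps I' D. mcoeff ?x I' F d * \<Psi> d)
     = (\<Sum>d\<in>{d\<in>multi_exps I D. d i = 0}. cf d * \<Psi> (restrict d I'))"
    by (rule mcoeff_sum[OF fin(2) inj _ _ F1]) (use fin sD in auto)
  have e2: "(\<Sum>d\<in>multi_exps I' D. mcoeff ?x I' F d * \<Psi> d)
     = (\<Sum>d\<in>multi_exps I' D'. ?Q ^ (k * card {j\<in>I. i < j}) * cf' d * \<Psi> (restrict (\<lambda>j. d j + 2 * k) I'))"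
    by (rule mcoeff_sum[OF fin(2) inj _ _ F2]) (use fin in \<open>auto simp: sum.distrib multi_expsD(1) DD'\<close>)
  have r: "\<Psi> (restrict g I') = \<Psi> g" for g unfolding \<Psi>_def by (intro prod.cong) auto
  have "(\<Sum>d\<in>{d\<in>multi_exps I D. d i = 0}. cf d * \<Psi> d)
      = ?Q ^ (k * card {j\<in>I. i < j}) * (\<Sum>d\<in>multi_exps I' D'. cf' d * \<Psi> (\<lambda>j. d j + 2 * k))"
    using e1 e2 unfolding r sum_distrib_left by (simp add: mult_ac)
  thus ?thesis unfolding \<Psi>_def cf_def cf'_def I'_def[symmetric] I_def[symmetric] D_def[symmetric] D'_def[symmetric]
    I'[symmetric] by (simp add: I')
qed

text \<open>The number of larger elements takes each of the values \<open>0\<close>, ...,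
  \<open>card S - 1\<close> exactly once.\<close>

lemma sum_power_rank:
  fixes x :: complex and S :: "nat set"
  assumes "finite S"
  shows "(\<Sum>i\<in>S. x ^ card {j\<in>S. i < j}) = (\<Sum>r<card S. x ^ r)"
  using assms
proof (induction S rule: finite_linorder_min_induct)
  case empty
  thus ?case by simp
next
  case (insert b A)
  have b: "b \<notin> A" using insert by auto
  have "{j\<in>insert b A. b < j} = A" using insert by auto
  moreover have "{j\<in>insert b A. i < j} = {j\<in>A. i < j}" if "i \<in> A" for i
    using insert that by force
  ultimately show ?case using insert b by (simp add: sum.insert)
qed

text \<open>At \<open>A = 1\<close> a first type moment of positive degree vanishes. A nonzero
  coefficient has degree 0 at no more than one index of \<open>S\<close>, so the sum is divisible by
  \<open>(1 - A) ^ a\<close>; after this division precisely the terms with one zero degree survive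
  at \<open>A = 1\<close>.\<close>

lemma moment_sum_limit:
  fixes c \<kappa> :: complex
  assumes q: "0 < q" "q < 1" and ST: "finite S" "finite T" "\<And>i j. i \<in> S \<Longrightarrow> j \<in> T \<Longrightarrow> i < j"
    and "k \<ge> 1" "card S = Suc a" "card T = b"
    and \<kappa>: "\<And>A. A \<noteq> 0 \<Longrightarrow> moment_sum q k S T A c =
     \<kappa> * A ^ Y * poly (chain_poly q k (Suc a) (Suc a + b)) A * poly (chain_poly q k (Suc a) (Suc a + b)) (c / A)"
  shows "\<kappa> * (\<Prod>u<a. qpoch q (complex_of_real q) (k * Suc u - 1)) *
      (\<Prod>j<b. qpoch q (complex_of_real q) (k * (Suc a + j) + j)) * poly (chain_poly q k (Suc a) (Suc a + b)) c
    = (\<Sum>i\<in>S. complex_of_real q ^ (k * card {j\<in>S \<union> T. i < j}) *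
        ((qpoch q (complex_of_real q) (2 * k - 1) / qpoch q c (2 * k)) ^ a *
         (qpoch q (complex_of_real q) (2 * k) / qpoch q (c * complex_of_real q ^ 2) (2 * k)) ^ b *
         moment_sum q k (S - {i}) T (complex_of_real q ^ (2 * k)) (c * complex_of_real q ^ (2 * k))))"
proof -
  let ?Q = "complex_of_real q"
  define I D where "I = S \<union> T" and "D = kernel_deg k S T"
  define cf where "cf = mcoeff (\<lambda>e. ?Q ^ e) I (pair_kernel q k S T)"
  define Z where "Z = (\<lambda>d. {i\<in>S. d i = (0::nat)})"
  have disj: "S \<inter> T = {}" using ST(3) by force
  have fin: "finite I" using ST by (auto simp: I_def)
  have cf0: "cf d = 0" if "card (Z d) > 1" for d
  proof (rule ccontr)
    assume "cf d \<noteq> 0"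
    from mcoeff_nonzero_separated[OF q(1) ST this[unfolded cf_def I_def]]
    obtain e where e: "\<forall>i\<in>S \<union> T. e i \<le> d i" "separated k S T (\<lambda>i. e i + type_shift T i)" by blast
    have "card (Z d) \<noteq> 0" "card (Z d) \<noteq> 1" using that by auto
    then obtain i where i: "i \<in> Z d" by (metis card.empty ex_in_conv)
    have "Z d \<noteq> {i}" using that by auto
    then obtain j where j: "j \<in> Z d" "j \<noteq> i" using i by blast
    have ij: "e i = 0" "e j = 0" "i \<in> S" "j \<in> S" "i \<notin> T" "j \<notin> T"
      using e(1)[rule_format, of i] e(1)[rule_format, of j] i j disj unfolding Z_def by auto
    have "e j + type_shift T j \<ge> e i + type_shift T i + k \<or> e i + type_shift T i \<ge> e j + type_shift T j + k"
      using e(2) ij(3,4) j(2) unfolding separated_def by metis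
    thus False using ij \<open>k \<ge> 1\<close> by (simp add: type_shift_def)
  qed
  \<comment> \<open>The lengths \<open>d i - 1\<close> arise because one factor \<open>1 - A\<close>
    has been taken out of each first type moment of positive degree; at degree 0 the moment is
    1.\<close>
  define rest where "rest = (\<lambda>A d. (\<Prod>i\<in>S - Z d. qpoch q (A * ?Q) (d i - 1) / qpoch q c (d i)) *
      (\<Prod>i\<in>T. qpoch q (A * ?Q) (d i) / qpoch q (c * ?Q ^ 2) (d i)))"
  \<comment> \<open>The truncated difference \<open>1 - card (Z d)\<close> is 1 if no degree is zero
    and 0 if one is; further zeros are excluded by \<open>cf0\<close>.\<close>
  define h where "h = (\<lambda>A. \<Sum>d\<in>multi_exps I D. cf d * ((1 - A) ^ (1 - card (Z d)) * rest A d))"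
  have G: "moment_sum q k S T A c = (1 - A) ^ a * h A" for A
    unfolding moment_sum_def h_def I_def[symmetric] D_def[symmetric] cf_def[symmetric] sum_distrib_left
  proof (intro sum.cong refl)
    fix d
    show "cf d * (\<Prod>i\<in>I. type_moment q T A c i (d i)) = (1 - A) ^ a * (cf d * ((1 - A) ^ (1 - card (Z d)) * rest A d))"
    proof (cases "card (Z d) > 1")
      case False
      have ZS: "Z d \<subseteq> S" "finite (Z d)" using ST by (auto simp: Z_def)
      have "(\<Prod>i\<in>I. type_moment q T A c i (d i)) = (\<Prod>i\<in>S. type_moment q T A c i (d i)) * (\<Prod>i\<in>T. type_moment q T A c i (d i))"
        unfolding I_def using ST disj by (intro prod.union_disjoint) auto
      also have "(\<Prod>i\<in>T. type_moment q T A c i (d i)) = (\<Prod>i\<in>T. qpoch q (A * ?Q) (d i) / qpoch q (c * ?Q ^ 2) (d i))"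
        by (intro prod.cong refl) (simp add: type_moment_def type_shift_def)
      also have "(\<Prod>i\<in>S. type_moment q T A c i (d i)) = (\<Prod>i\<in>S - Z d. type_moment q T A c i (d i)) * (\<Prod>i\<in>Z d. type_moment q T A c i (d i))"
        using ST(1) ZS by (intro prod.subset_diff) auto
      also have "(\<Prod>i\<in>Z d. type_moment q T A c i (d i)) = 1"
        by (intro prod.neutral) (auto simp: Z_def type_moment_def qpoch_def)
      also have "(\<Prod>i\<in>S - Z d. type_moment q T A c i (d i)) = (\<Prod>i\<in>S - Z d. (1 - A) * (qpoch q (A * ?Q) (d i - 1) / qpoch q c (d i)))"
      proof (intro prod.cong refl)
        fix i assume i: "i \<in> S - Z d"
        hence "i \<notin> T" using disj by auto
        moreover obtain m where "d i = Suc m" using i by (cases "d i") (auto simp: Z_def)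
        ultimately show "type_moment q T A c i (d i) = (1 - A) * (qpoch q (A * ?Q) (d i - 1) / qpoch q c (d i))"
          by (simp add: type_moment_def type_shift_def qpoch_Suc_shift)
      qed
      also have "\<dots> = (1 - A) ^ (card S - card (Z d)) * (\<Prod>i\<in>S - Z d. qpoch q (A * ?Q) (d i - 1) / qpoch q c (d i))"
        using ZS by (simp only: prod.distrib prod_constant card_Diff_subset)
      also have "card S - card (Z d) = a + (1 - card (Z d))" using False \<open>card S = Suc a\<close> by auto
      finally show ?thesis by (simp add: rest_def power_add mult_ac)
    qed (simp add: cf0)
  qed
  define Rt where "Rt = (\<lambda>A. (\<Prod>u<a. qpoch q (A * ?Q) (k * Suc u - 1)) * (\<Prod>j<b. qpoch q (A * ?Q) (k * (Suc a + j) + j)))"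
  let ?R = "poly (chain_poly q k (Suc a) (Suc a + b))"
  \<comment> \<open>The factor for \<open>u = 0\<close> is an empty product, so only
    \<open>a\<close> of the \<open>Suc a\<close> factors of the first type contain
    \<open>1 - A\<close>.\<close>
  have R: "?R A = (1 - A) ^ a * Rt A" for A
  proof -
    have "(\<Prod>u<Suc a. qpoch q A (k * u)) = (\<Prod>u<a. (1 - A) * qpoch q (A * ?Q) (k * Suc u - 1))"
    proof -
      have "qpoch q A (k * Suc u) = (1 - A) * qpoch q (A * ?Q) (k * Suc u - 1)" for u
        using qpoch_Suc_shift[of q A "k * Suc u - 1"] \<open>k \<ge> 1\<close> by simp
      thus ?thesis unfolding prod.lessThan_Suc_shift by (simp add: qpoch_def)
    qed
    thus ?thesis unfolding chain_poly_split Rt_def by (simp add: prod.distrib)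
  qed
  \<comment> \<open>Near 1, but away from it, \<open>(1 - A) ^ a\<close> may be cancelled from both
    expressions for the sum; continuity carries the result to \<open>A = 1\<close>.\<close>
  have "h 1 = \<kappa> * 1 ^ Y * Rt 1 * ?R (c / 1)"
  proof (rule isCont_eq_at[where f = h and z = 1 and g = "\<lambda>A. \<kappa> * A ^ Y * Rt A * ?R (c / A)"])
    show "isCont h 1"
      unfolding h_def rest_def divide_inverse by (intro continuous_intros isCont_qpoch)
    show "isCont (\<lambda>A. \<kappa> * A ^ Y * Rt A * ?R (c / A)) 1"
      unfolding Rt_def by (intro continuous_intros isCont_qpoch isCont_o2[where g = ?R]) auto
    have "eventually (\<lambda>A::complex. A \<in> - {0}) (at 1)" by (intro eventually_at_in_open') auto
    moreover have "eventually (\<lambda>A::complex. A \<noteq> 1) (at 1)" by (simp add: eventually_at_filter)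
    ultimately show "eventually (\<lambda>A. h A = \<kappa> * A ^ Y * Rt A * ?R (c / A)) (at 1)"
    proof eventually_elim
      case (elim A)
      have "(1 - A) ^ a * h A = (1 - A) ^ a * (\<kappa> * A ^ Y * Rt A * ?R (c / A))"
        using \<kappa>[of A] elim unfolding G R[of A] by (simp add: mult_ac)
      thus ?case using elim by simp
    qed
  qed
  hence h1: "h 1 = \<kappa> * Rt 1 * ?R c" by simp
  define \<psi> where "\<psi> = (\<lambda>j m. if j \<in> T then qpoch q ?Q m / qpoch q (c * ?Q ^ 2) m
     else if m = 0 then 0 else qpoch q ?Q (m - 1) / qpoch q c m)"
  have "h 1 = (\<Sum>d\<in>multi_exps I D. \<Sum>i\<in>S. if d i = 0 then cf d * (\<Prod>j\<in>I - {i}. \<psi> j (d j)) else 0)"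
    unfolding h_def
  proof (intro sum.cong refl)
    fix d
    have ZS: "Z d \<subseteq> S" "finite (Z d)" using ST by (auto simp: Z_def)
    have eq: "(\<Sum>i\<in>S. if d i = 0 then cf d * (\<Prod>j\<in>I - {i}. \<psi> j (d j)) else 0)
       = (\<Sum>i\<in>Z d. cf d * (\<Prod>j\<in>I - {i}. \<psi> j (d j)))"
      unfolding Z_def using ST(1) by (subst sum.inter_filter) auto
    show "cf d * ((1 - 1) ^ (1 - card (Z d)) * rest 1 d) =
       (\<Sum>i\<in>S. if d i = 0 then cf d * (\<Prod>j\<in>I - {i}. \<psi> j (d j)) else 0)"
    proof -
      consider "card (Z d) = 0" | "card (Z d) = 1" | "card (Z d) > 1" by linarith
      thus ?thesis
      proof cases
        case 1
        hence "Z d = {}" using ZS by auto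
        thus ?thesis unfolding eq by simp
      next
        case 2
        then obtain i where Zi: "Z d = {i}" by (rule card_1_singletonE)
        have iS: "i \<in> S" "i \<notin> T" using ZS Zi disj by auto
        have "I - {i} = (S - {i}) \<union> T" using iS by (auto simp: I_def)
        hence "(\<Prod>j\<in>I - {i}. \<psi> j (d j)) = (\<Prod>j\<in>S - {i}. \<psi> j (d j)) * (\<Prod>j\<in>T. \<psi> j (d j))"
          using ST disj by (simp only:) (intro prod.union_disjoint; auto)
        also have "\<dots> = rest 1 d"
          unfolding rest_def Zi
        proof (intro arg_cong2[where f = "(*)"] prod.cong refl)
          fix j assume j: "j \<in> S - {i}"
          hence "j \<notin> Z d" using Zi by auto
          hence "d j \<noteq> 0" using j by (auto simp: Z_def)
          thus "\<psi> j (d j) = qpoch q (1 * ?Q) (d j - 1) / qpoch q c (d j)"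
            using j disj by (auto simp: \<psi>_def)
        qed (simp add: \<psi>_def)
        finally show ?thesis unfolding eq Zi by simp
      next
        case 3
        thus ?thesis unfolding eq using cf0[of d] by simp
      qed
    qed
  qed
  also have "\<dots> = (\<Sum>i\<in>S. \<Sum>d\<in>multi_exps I D. if d i = 0 then cf d * (\<Prod>j\<in>I - {i}. \<psi> j (d j)) else 0)"
    by (rule sum.swap)
  also have "\<dots> = (\<Sum>i\<in>S. \<Sum>d\<in>{d\<in>multi_exps I D. d i = 0}. cf d * (\<Prod>j\<in>I - {i}. \<psi> j (d j)))"
    using fin by (intro sum.cong refl sum.inter_filter[symmetric]) auto
  also have "\<dots> = (\<Sum>i\<in>S. ?Q ^ (k * card {j\<in>S \<union> T. i < j}) *
      (\<Sum>d\<in>multi_exps (S - {i} \<union> T) (kernel_deg k (S - {i}) T).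
        mcoeff (\<lambda>e. ?Q ^ e) (S - {i} \<union> T) (pair_kernel q k (S - {i}) T) d *
        (\<Prod>j\<in>S - {i} \<union> T. \<psi> j (d j + 2 * k))))"
    unfolding cf_def I_def D_def by (intro sum.cong refl moment_sum_remove[OF q ST])
  also have "\<dots> = (\<Sum>i\<in>S. ?Q ^ (k * card {j\<in>S \<union> T. i < j}) *
        ((qpoch q ?Q (2 * k - 1) / qpoch q c (2 * k)) ^ a * (qpoch q ?Q (2 * k) / qpoch q (c * ?Q ^ 2) (2 * k)) ^ b *
         moment_sum q k (S - {i}) T (?Q ^ (2 * k)) (c * ?Q ^ (2 * k))))"
  proof (intro sum.cong refl arg_cong2[where f = "(*)"])
    fix i assume i: "i \<in> S"
    let ?\<alpha> = "qpoch q ?Q (2 * k - 1) / qpoch q c (2 * k)" and ?\<beta> = "qpoch q ?Q (2 * k) / qpoch q (c * ?Q ^ 2) (2 * k)"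
    let ?m = "type_moment q T (?Q ^ (2 * k)) (c * ?Q ^ (2 * k))"
    have cS: "card (S - {i}) = a" using i ST(1) \<open>card S = Suc a\<close> by simp
    \<comment> \<open>Splitting the first part off each shifted factorial turns the limits of the
      moments, with degrees raised by \<open>2 * k\<close>, into ordinary moments with parameters
      \<open>q^(2k)\<close> and \<open>c q^(2k)\<close>. The constants in front are the same for all
      indices of one type.\<close>
    have p: "(\<Prod>j\<in>S - {i} \<union> T. \<psi> j (d j + 2 * k)) = ?\<alpha> ^ a * ?\<beta> ^ b * (\<Prod>j\<in>S - {i} \<union> T. ?m j (d j))" for d
    proof -
      have 1: "\<psi> j (d j + 2 * k) = ?\<alpha> * ?m j (d j)" if "j \<in> S - {i}" for j
      proof -
        have jT: "j \<notin> T" using that disj by auto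
        have "d j + 2 * k - 1 = (2 * k - 1) + d j" using \<open>k \<ge> 1\<close> by simp
        moreover have "?Q * ?Q ^ (2 * k - 1) = ?Q ^ (2 * k)" using \<open>k \<ge> 1\<close> by (simp add: power_Suc[symmetric] del: power_Suc)
        ultimately have "qpoch q ?Q (d j + 2 * k - 1) = qpoch q ?Q (2 * k - 1) * qpoch q (?Q ^ (2 * k)) (d j)"
          by (simp only: qpoch_add)
        moreover have "qpoch q c (d j + 2 * k) = qpoch q c (2 * k) * qpoch q (c * ?Q ^ (2 * k)) (d j)"
          by (metis add.commute qpoch_add)
        moreover have "d j + 2 * k \<noteq> 0" using \<open>k \<ge> 1\<close> by simp
        ultimately have "\<psi> j (d j + 2 * k) = qpoch q ?Q (2 * k - 1) * qpoch q (?Q ^ (2 * k)) (d j) /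
            (qpoch q c (2 * k) * qpoch q (c * ?Q ^ (2 * k)) (d j))"
          unfolding \<psi>_def using jT by (simp only: if_False)
        thus ?thesis using jT unfolding type_moment_def type_shift_def by simp
      qed
      have 2: "\<psi> j (d j + 2 * k) = ?\<beta> * ?m j (d j)" if "j \<in> T" for j
      proof -
        have "qpoch q x (d j + 2 * k) = qpoch q x (2 * k) * qpoch q (x * ?Q ^ (2 * k)) (d j)" for x
          by (metis add.commute qpoch_add)
        thus ?thesis using that unfolding \<psi>_def type_moment_def type_shift_def
          by (simp add: mult_ac)
      qed
      have "(\<Prod>j\<in>S - {i} \<union> T. \<psi> j (d j + 2 * k)) = (\<Prod>j\<in>S - {i}. \<psi> j (d j + 2 * k)) * (\<Prod>j\<in>T. \<psi> j (d j + 2 * k))"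
        using ST disj by (intro prod.union_disjoint) auto
      also have "\<dots> = (\<Prod>j\<in>S - {i}. ?\<alpha> * ?m j (d j)) * (\<Prod>j\<in>T. ?\<beta> * ?m j (d j))"
        by (intro arg_cong2[where f = "(*)"] prod.cong refl 1 2)
      also have "\<dots> = ?\<alpha> ^ a * ?\<beta> ^ b * ((\<Prod>j\<in>S - {i}. ?m j (d j)) * (\<Prod>j\<in>T. ?m j (d j)))"
        unfolding prod.distrib prod_constant cS \<open>card T = b\<close> by (simp only: mult_ac)
      also have "(\<Prod>j\<in>S - {i}. ?m j (d j)) * (\<Prod>j\<in>T. ?m j (d j)) = (\<Prod>j\<in>S - {i} \<union> T. ?m j (d j))"
        using ST disj by (intro prod.union_disjoint[symmetric]) auto
      finally show ?thesis .
    qed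
    show "(\<Sum>d\<in>multi_exps (S - {i} \<union> T) (kernel_deg k (S - {i}) T).
        mcoeff (\<lambda>e. ?Q ^ e) (S - {i} \<union> T) (pair_kernel q k (S - {i}) T) d * (\<Prod>j\<in>S - {i} \<union> T. \<psi> j (d j + 2 * k)))
      = ?\<alpha> ^ a * ?\<beta> ^ b * moment_sum q k (S - {i}) T (?Q ^ (2 * k)) (c * ?Q ^ (2 * k))"
      unfolding p moment_sum_def sum_distrib_left by (intro sum.cong refl) (simp only: mult_ac)
  qed
  finally show ?thesis unfolding h1 Rt_def by (simp add: mult_ac)
qed

text \<open>Without first type variables every pair has multiplicity \<open>k + 1\<close>, and the
  shift of the second type can be absorbed in the parameters.\<close>

lemma moment_sum_only_T:
  "moment_sum q k {} T A c = moment_sum q (Suc k) T {} (A * complex_of_real q) (c * complex_of_real q ^ 2)"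
proof -
  have "pair_kernel q k {} T = pair_kernel q (Suc k) T {}"
    unfolding pair_kernel_def by (intro ext prod.cong) (auto simp: pair_mult_def pairs_def)
  moreover have "kernel_deg k {} T = kernel_deg (Suc k) T {}"
    unfolding kernel_deg_def by (intro sum.cong) (auto simp: pair_mult_def pairs_def)
  moreover have "(\<Prod>i\<in>T. type_moment q T A c i (d i)) =
      (\<Prod>i\<in>T. type_moment q {} (A * complex_of_real q) (c * complex_of_real q ^ 2) i (d i))" for d
    by (intro prod.cong) (auto simp: type_moment_def type_shift_def)
  ultimately show ?thesis unfolding moment_sum_def by simp
qed

text \<open>For \<open>k = 0\<close> no variable of the first type occurs in the kernel, so each of
  them has degree 0 and contributes the moment 1.\<close>

lemma moment_sum_k0:
  assumes q: "0 < q" "q < 1" and ST: "finite S" "finite T" "S \<inter> T = {}"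
  shows "moment_sum q 0 S T A c = moment_sum q 0 {} T A c"
proof -
  let ?x = "\<lambda>e. complex_of_real q ^ e"
  define D where "D = kernel_deg 0 {} T"
  have D: "kernel_deg 0 S T = D"
  proof -
    have "finite (pairs (S \<union> T))" using ST by simp
    thus ?thesis unfolding kernel_deg_def D_def
      by (intro sum.mono_neutral_right) (auto simp: pairs_def pair_mult_def split: if_splits)
  qed
  have K: "pair_kernel q 0 S T = pair_kernel q 0 {} T"
  proof
    fix t :: "nat \<Rightarrow> complex"
    have "finite (pairs (S \<union> T))" using ST by simp
    thus "pair_kernel q 0 S T t = pair_kernel q 0 {} T t"
      unfolding pair_kernel_def by (intro prod.mono_neutral_right)
        (auto simp: pair_factor_def pair_mult_def pairs_def split: if_splits)
  qed
  have inj: "inj ?x" by (rule inj_powers[OF q])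
  have hom: "homogeneous ?x T D (pair_kernel q 0 {} T)"
    unfolding D_def using kernel_homogeneous[of "{}" T ?x 0 q] ST inj by simp
  have Keq: "pair_kernel q 0 {} T t = (\<Sum>d\<in>multi_exps T D. mcoeff ?x T (pair_kernel q 0 {} T) d *
      (\<Prod>i\<in>S \<union> T. t i ^ (if i \<in> T then d i else 0)))" for t
  proof -
    have "(\<Prod>i\<in>S \<union> T. t i ^ (if i \<in> T then d i else 0)) = (\<Prod>i\<in>T. t i ^ d i)" for d
      using ST by (intro prod.mono_neutral_cong_right) auto
    thus ?thesis using hom unfolding homogeneous_def by simp
  qed
  have "(\<Sum>d\<in>multi_exps (S \<union> T) D. mcoeff ?x (S \<union> T) (pair_kernel q 0 {} T) d * (\<Prod>i\<in>S \<union> T. type_moment q T A c i (d i)))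
     = (\<Sum>d\<in>multi_exps T D. mcoeff ?x T (pair_kernel q 0 {} T) d *
        (\<Prod>i\<in>S \<union> T. type_moment q T A c i (restrict (\<lambda>i. if i \<in> T then d i else 0) (S \<union> T) i)))"
  proof (rule mcoeff_sum[OF _ inj _ _ Keq])
    fix d assume d: "d \<in> multi_exps T D"
    have "(\<Sum>i\<in>S \<union> T. if i \<in> T then d i else 0) = (\<Sum>i\<in>T. d i)"
      using ST by (intro sum.mono_neutral_cong_right) auto
    thus "(\<Sum>i\<in>S \<union> T. if i \<in> T then d i else 0) = D" using multi_expsD(1)[OF d] by simp
  qed (use ST in auto)
  also have "\<dots> = (\<Sum>d\<in>multi_exps T D. mcoeff ?x T (pair_kernel q 0 {} T) d * (\<Prod>i\<in>T. type_moment q T A c i (d i)))"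
    using ST by (intro sum.cong refl arg_cong2[where f = "(*)"] prod.mono_neutral_cong_right)
      (auto simp: type_moment_def qpoch_def)
  finally show ?thesis unfolding moment_sum_def D K D_def[symmetric] by simp
qed

subsection \<open>The closed form\<close>

text \<open>When a variable of \<open>S\<close> is sent to zero, all \<open>b\<close> indices of
  \<open>T\<close> lie behind it, which gives \<open>k * b\<close>. The smaller sum is then taken at
  \<open>A = q^(2k)\<close>, which gives \<open>2 * k\<close> times the exponent of \<open>A\<close>
  there. The initial value is the exponent of the case without second type at \<open>k + 1\<close>,
  plus the power of \<open>q\<close> that comes from \<open>A q\<close> in place of
  \<open>A\<close>.\<close>

primrec const_exp :: "nat \<Rightarrow> nat \<Rightarrow> nat \<Rightarrow> nat" where
  "const_exp k b 0 = (k + 1) * (b choose 2) + 2 * (k + 1)\<^sup>2 * (b choose 3)"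
| "const_exp k b (Suc a) = const_exp k b a + k * b + 2 * k * (k * (a + b choose 2) + (b choose 2))"

definition const_q :: "real \<Rightarrow> nat \<Rightarrow> nat \<Rightarrow> nat \<Rightarrow> complex" where
  "const_q q k a b = (let Q = complex_of_real q; f = qpoch q Q in
     (\<Prod>i<a. f (k * Suc i) / f k) *
     (\<Prod>j<b. (1 - Q ^ ((k + 1) * Suc j)) * f (j * (k + 1) + (a + 1) * k) / f (k + 1)))"

text \<open>The equation for \<open>0\<close> is what remains of the other one, read at \<open>a = - 1\<close>, after cancelling the
  possibly vanishing factors that occur in both numerator and denominator.\<close>

primrec const_c :: "real \<Rightarrow> nat \<Rightarrow> nat \<Rightarrow> complex \<Rightarrow> nat \<Rightarrow> complex" where
  "const_c q k b c 0 = (\<Prod>j<b. qpoch q c 2 / qpoch q c (b + j + 1 + (b + j - 1) * k))"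
| "const_c q k b c (Suc a) = (\<Prod>j<b. qpoch q c (j + 1 + (a + j) * k)) * qpoch q c 2 ^ b /
     ((\<Prod>i<Suc a. qpoch q c ((a + i) * k)) * (\<Prod>J<2*b. qpoch q c (J + 1 + (2 * a + 1 + J) * k)))"

definition moment_closed :: "real \<Rightarrow> nat \<Rightarrow> nat \<Rightarrow> nat \<Rightarrow> complex \<Rightarrow> complex \<Rightarrow> complex" where
  "moment_closed q k a b A c = complex_of_real q ^ const_exp k b a * const_q q k a b * const_c q k b c a *
     A ^ (k * (a + b choose 2) + (b choose 2)) *
     poly (chain_poly q k a (a + b)) A * poly (chain_poly q k a (a + b)) (c / A)"

lemma prod_lessThan_add:
  fixes m n :: nat
  shows "(\<Prod>j<m + n. g j) = (\<Prod>j<m. g j) * (\<Prod>j<n. g (m + j) :: complex)"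
  by (induction n) (simp_all add: mult.assoc)

section \<open>Recursions for the constants\<close>

context
  fixes q :: real
  assumes q: "0 < q" "q < 1"
begin

lemma norm_q_shift: "norm c < 1 \<Longrightarrow> norm (c * complex_of_real q ^ n) < 1"
  using q mult_mono[of "norm c" "norm c" "q ^ n" 1] by (simp add: norm_mult norm_power power_le_one)

lemma qpoch_shift:
  assumes "norm c < 1"
  shows "qpoch q (c * complex_of_real q ^ n) m = qpoch q c (n + m) / qpoch q c n"
  using qpoch_nonzero[OF q assms] by (simp add: qpoch_add)

text \<open>This is the part of the limit relation that depends on \<open>c\<close>. All shifted
  factorials are rewritten as quotients of \<open>p m\<close>, after which the products are matched
  factor by factor; \<open>a = 0\<close> is separate because \<open>const_c\<close> has its own
  equation there.\<close>

lemma const_c_recursion: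
  assumes c: "norm c < 1"
  shows "const_c q k b c (Suc a) * poly (chain_poly q k (Suc a) (Suc a + b)) c *
      (qpoch q c (2 * k) ^ a * qpoch q (c * complex_of_real q ^ 2) (2 * k) ^ b)
    = const_c q k b (c * complex_of_real q ^ (2 * k)) a * poly (chain_poly q k a (a + b)) c"
proof -
  let ?Q = "complex_of_real q"
  define p where "p = qpoch q c"
  have p0: "p m \<noteq> 0" for m unfolding p_def by (rule qpoch_nonzero[OF q c])
  have p00: "p 0 = 1" by (simp add: p_def qpoch_def)
  have sh1: "qpoch q (c * ?Q) m = p (1 + m) / p 1" for m
    using qpoch_shift[OF c, of 1 m] by (simp add: p_def)
  have sh: "qpoch q (c * ?Q ^ n) m = p (n + m) / p n" for n m
    using qpoch_shift[OF c] by (simp add: p_def)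
  show ?thesis
  proof (cases a)
    case 0
    have s: "(\<Prod>J<2*b. p (J + 1 + (2 * 0 + 1 + J) * k))
       = (\<Prod>j<b. p (j + 1 + (1 + j) * k)) * (\<Prod>j<b. p (b + j + 1 + (1 + (b + j)) * k))"
      using prod_lessThan_add[of "\<lambda>J. p (J + 1 + (2 * 0 + 1 + J) * k)" b b] by (simp add: mult_2)
    have "const_c q k b c (Suc 0) * poly (chain_poly q k (Suc 0) (Suc 0 + b)) c *
      (qpoch q c (2 * k) ^ 0 * qpoch q (c * ?Q ^ 2) (2 * k) ^ b)
     = (\<Prod>j<b. p (j + 1 + (0 + j) * k)) * p 2 ^ b / (p 0 * ((\<Prod>j<b. p (j + 1 + (1 + j) * k)) * (\<Prod>j<b. p (b + j + 1 + (1 + (b + j)) * k)))) *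
       (p 0 * (\<Prod>j<b. p (1 + (k * (1 + j) + j)) / p 1)) * (p (2 + 2 * k) / p 2) ^ b"
      unfolding const_c.simps chain_poly_split p_def[symmetric] s sh sh1 by simp
    also have "\<dots> = (\<Prod>j<b. p (j + 1 + (0 + j) * k) * p 2 / (p (j + 1 + (1 + j) * k) * p (b + j + 1 + (1 + (b + j)) * k)) *
        (p (1 + (k * (1 + j) + j)) / p 1) * (p (2 + 2 * k) / p 2))"
      unfolding prod.distrib prod_dividef prod_constant card_lessThan using p00 p0[of 2] by (simp add: power_divide mult_ac)
    also have "\<dots> = (\<Prod>j<b. (p (2 * k + 2) / p (2 * k)) / (p (2 * k + (b + j + 1 + (b + j - 1) * k)) / p (2 * k)) * (p (1 + (k * (0 + j) + j)) / p 1))"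
    proof (intro prod.cong refl)
      fix j assume "j \<in> {..<b}"
      then obtain b' where b': "b = Suc b'" by (cases b) auto
      have e1: "1 + (k * (1 + j) + j) = j + 1 + (1 + j) * k" by simp
      have e2: "2 * k + (b + j + 1 + (b + j - 1) * k) = b + j + 1 + (1 + (b + j)) * k"
        by (simp add: b' algebra_simps)
      have e3: "1 + (k * (0 + j) + j) = j + 1 + (0 + j) * k" by simp
      have e4: "2 * k + 2 = 2 + 2 * k" by simp
      show "p (j + 1 + (0 + j) * k) * p 2 / (p (j + 1 + (1 + j) * k) * p (b + j + 1 + (1 + (b + j)) * k)) *
        (p (1 + (k * (1 + j) + j)) / p 1) * (p (2 + 2 * k) / p 2) =
        (p (2 * k + 2) / p (2 * k)) / (p (2 * k + (b + j + 1 + (b + j - 1) * k)) / p (2 * k)) * (p (1 + (k * (0 + j) + j)) / p 1)"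
        unfolding e1 e2 e3 e4 using p0 by (simp add: field_simps)
    qed
    also have "\<dots> = const_c q k b (c * ?Q ^ (2 * k)) 0 * poly (chain_poly q k 0 (0 + b)) c"
      unfolding const_c.simps chain_poly_split sh sh1 prod.distrib by simp
    finally show ?thesis unfolding 0 .
  next
    case (Suc a')
    have i1: "(\<Prod>i<Suc a. p ((a + i) * k)) = p (a * k) * (\<Prod>i<a. p ((a + 1 + i) * k))"
      by (subst prod.lessThan_Suc_shift) simp
    have L: "const_c q k b c (Suc a) * poly (chain_poly q k (Suc a) (Suc a + b)) c
      = (\<Prod>j<b. p (j + 1 + (a + j) * k)) * p 2 ^ b /
         (p (a * k) * (\<Prod>i<a. p ((a + 1 + i) * k)) * (\<Prod>J<2*b. p (J + 1 + (2 * a + 1 + J) * k))) *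
        ((\<Prod>u<a. p (k * u)) * p (k * a) * ((\<Prod>j<b. p (1 + (k * (Suc a + j) + j))) / p 1 ^ b))"
      unfolding const_c.simps chain_poly_split p_def[symmetric] i1 sh1 by (simp add: prod_dividef)
    have j1: "1 + (k * (Suc a + j) + j) = j + 1 + (a + 1 + j) * k" for j by (simp add: algebra_simps)
    have R1: "const_c q k b (c * ?Q ^ (2 * k)) a = (\<Prod>j<b. p (2 * k + (j + 1 + (a' + j) * k)) / p (2 * k)) * (p (2 * k + 2) / p (2 * k)) ^ b /
         ((\<Prod>i<a. p (2 * k + (a' + i) * k) / p (2 * k)) * (\<Prod>J<2*b. p (2 * k + (J + 1 + (2 * a' + 1 + J) * k)) / p (2 * k)))"
      unfolding Suc const_c.simps sh ..
    have r1: "2 * k + (j + 1 + (a' + j) * k) = j + 1 + (a + 1 + j) * k" for j by (simp add: Suc algebra_simps)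
    have r2: "2 * k + (a' + i) * k = (a + 1 + i) * k" for i by (simp add: Suc algebra_simps)
    have r3: "2 * k + (J + 1 + (2 * a' + 1 + J) * k) = J + 1 + (2 * a + 1 + J) * k" for J by (simp add: Suc algebra_simps)
    have R: "const_c q k b (c * ?Q ^ (2 * k)) a = (\<Prod>j<b. p (j + 1 + (a + 1 + j) * k)) * p (2 + 2 * k) ^ b * p (2 * k) ^ a /
         ((\<Prod>i<a. p ((a + 1 + i) * k)) * (\<Prod>J<2*b. p (J + 1 + (2 * a + 1 + J) * k)))"
    proof -
      have "x / P ^ b * (y / P) ^ b / (z / P ^ a * (w / P ^ (2 * b))) = x * y ^ b * P ^ a / (z * w)"
        if "P \<noteq> 0" for x y z w P :: complex
        using that by (simp add: field_simps power_mult_distrib power_divide power_mult power2_eq_square)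
      from this[OF p0] show ?thesis
        unfolding R1 r1 r2 r3 prod_dividef prod_constant card_lessThan by (simp add: add.commute)
    qed
    have P: "poly (chain_poly q k a (a + b)) c = (\<Prod>u<a. p (k * u)) * ((\<Prod>j<b. p (j + 1 + (a + j) * k)) / p 1 ^ b)"
    proof -
      have e: "1 + (k * (a + j) + j) = j + 1 + (a + j) * k" for j by (simp add: algebra_simps)
      show ?thesis unfolding chain_poly_split sh1 p_def[symmetric] prod_dividef e by simp
    qed
    have S2: "qpoch q (c * ?Q ^ 2) (2 * k) = p (2 + 2 * k) / p 2" by (rule sh)
    define X1 X2 X3 X4 X5 where "X1 = (\<Prod>j<b. p (j + 1 + (a + j) * k))" and "X2 = (\<Prod>i<a. p ((a + 1 + i) * k))"
      and "X3 = (\<Prod>J<2*b. p (J + 1 + (2 * a + 1 + J) * k))" and "X4 = (\<Prod>j<b. p (j + 1 + (a + 1 + j) * k))"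
      and "X5 = (\<Prod>u<a. p (k * u))"
    have nz: "X1 \<noteq> 0" "X2 \<noteq> 0" "X3 \<noteq> 0" "X4 \<noteq> 0" "X5 \<noteq> 0"
      unfolding X1_def X2_def X3_def X4_def X5_def using p0 by (auto simp: prod_zero_iff)
    have ak: "k * a = a * k" by simp
    show ?thesis
      unfolding L R P S2 j1 p_def[symmetric] ak X1_def[symmetric] X2_def[symmetric] X3_def[symmetric] X4_def[symmetric] X5_def[symmetric]
      using nz p0 by (simp add: field_simps power_divide)
  qed
qed

lemma one_minus_q_power: "m \<ge> 1 \<Longrightarrow> 1 - complex_of_real q ^ m \<noteq> 0"
proof
  assume "m \<ge> 1" "1 - complex_of_real q ^ m = 0"
  hence "q ^ m = 1" by (metis eq_iff_diff_eq_0 of_real_1 of_real_eq_iff of_real_power)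
  moreover have "q ^ m < 1" using q \<open>m \<ge> 1\<close> power_Suc_less_one[of q "m - 1"] by simp
  ultimately show False by simp
qed

lemma norm_q: "norm (complex_of_real q) < 1"
  using q by simp

text \<open>This is the part of the limit relation free of \<open>c\<close>. The quotient of
  \<open>1 - q^(k (a + 1))\<close> by \<open>1 - q^k\<close> is the geometric sum over the positions
  of the variable sent to zero.\<close>

lemma const_q_recursion:
  assumes k: "k \<ge> 1"
  shows "const_q q k (Suc a) b * ((\<Prod>u<a. qpoch q (complex_of_real q) (k * Suc u - 1)) *
      (\<Prod>j<b. qpoch q (complex_of_real q) (k * (Suc a + j) + j)))
    = (1 - complex_of_real q ^ (k * Suc a)) / (1 - complex_of_real q ^ k) * const_q q k a b *
      (qpoch q (complex_of_real q) (2 * k - 1) ^ a * qpoch q (complex_of_real q) (2 * k) ^ b *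
       poly (chain_poly q k a (a + b)) (complex_of_real q ^ (2 * k)))"
proof -
  let ?Q = "complex_of_real q"
  define f where "f = qpoch q ?Q"
  have f0: "f m \<noteq> 0" for m unfolding f_def by (rule qpoch_nonzero[OF q norm_q])
  have fS: "f (Suc m) = f m * (1 - ?Q ^ Suc m)" for m by (simp add: f_def qpoch_Suc)
  have sh: "f n * qpoch q (?Q ^ Suc n) m = f (n + m)" for n m
    unfolding f_def qpoch_add by simp
  have "f (2 * k - 1) ^ a * f (2 * k) ^ b * poly (chain_poly q k a (a + b)) (?Q ^ (2 * k))
     = (\<Prod>u<a. f (2 * k - 1) * qpoch q (?Q ^ (2 * k)) (k * u)) *
       (\<Prod>j<b. f (2 * k) * qpoch q (?Q ^ (2 * k) * ?Q) (k * (a + j) + j))"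
    unfolding chain_poly_split by (simp add: prod.distrib)
  also have "(\<Prod>u<a. f (2 * k - 1) * qpoch q (?Q ^ (2 * k)) (k * u)) = (\<Prod>u<a. f (k * Suc (Suc u) - 1))"
  proof (intro prod.cong refl)
    fix u
    have "Suc (2 * k - 1) = 2 * k" "2 * k - 1 + k * u = k * Suc (Suc u) - 1" using k by auto
    thus "f (2 * k - 1) * qpoch q (?Q ^ (2 * k)) (k * u) = f (k * Suc (Suc u) - 1)"
      using sh[of "2 * k - 1" "k * u"] by simp
  qed
  also have "(\<Prod>j<b. f (2 * k) * qpoch q (?Q ^ (2 * k) * ?Q) (k * (a + j) + j)) = (\<Prod>j<b. f (j * (k + 1) + (Suc a + 1) * k))"
  proof (intro prod.cong refl)
    fix j
    have e: "2 * k + (k * (a + j) + j) = j * (k + 1) + (Suc a + 1) * k" by (simp add: algebra_simps)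
    show "f (2 * k) * qpoch q (?Q ^ (2 * k) * ?Q) (k * (a + j) + j) = f (j * (k + 1) + (Suc a + 1) * k)"
      using sh[of "2 * k" "k * (a + j) + j"] unfolding power_Suc2 e .
  qed
  finally have R: "f (2 * k - 1) ^ a * f (2 * k) ^ b * poly (chain_poly q k a (a + b)) (?Q ^ (2 * k))
     = (\<Prod>u<a. f (k * Suc (Suc u) - 1)) * (\<Prod>j<b. f (j * (k + 1) + (Suc a + 1) * k))" .
  \<comment> \<open>The two products run over the same values shifted by one step, so only their end
    factors remain.\<close>
  have tele: "f (k * Suc a) / f k * (\<Prod>u<a. f (k * Suc u - 1))
     = (1 - ?Q ^ (k * Suc a)) / (1 - ?Q ^ k) * (\<Prod>u<a. f (k * Suc (Suc u) - 1))"
  proof -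
    have 1: "f (k * Suc u) = f (k * Suc u - 1) * (1 - ?Q ^ (k * Suc u))" for u
      using fS[of "k * Suc u - 1"] k by simp
    have 2: "f (k - 1) * (\<Prod>u<a. f (k * Suc (Suc u) - 1)) = (\<Prod>u<a. f (k * Suc u - 1)) * f (k * Suc a - 1)"
      using prod.lessThan_Suc_shift[of "\<lambda>u. f (k * Suc u - 1)" a] by simp
    have 3: "f k = f (k - 1) * (1 - ?Q ^ k)" using 1[of 0] by simp
    have "f (k * Suc a) / f k * (\<Prod>u<a. f (k * Suc u - 1)) =
        (1 - ?Q ^ (k * Suc a)) * ((\<Prod>u<a. f (k * Suc u - 1)) * f (k * Suc a - 1)) / (f (k - 1) * (1 - ?Q ^ k))"
      unfolding 1[of a] 3 by simp
    also have "\<dots> = (1 - ?Q ^ (k * Suc a)) / (1 - ?Q ^ k) * (\<Prod>u<a. f (k * Suc (Suc u) - 1))"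
      unfolding 2[symmetric] using f0[of "k - 1"] by simp
    finally show ?thesis .
  qed
  have ix: "k * (Suc a + j) + j = j * (k + 1) + (a + 1) * k" for j by (simp add: algebra_simps)
  define Y1 Y2 where "Y1 = (\<Prod>j<b. f (j * (k + 1) + (a + 1) * k))" and "Y2 = (\<Prod>j<b. f (j * (k + 1) + (Suc a + 1) * k))"
  define Y3 where "Y3 = (\<Prod>j<b. (1 - ?Q ^ ((k + 1) * Suc j)))"
  define Y4 where "Y4 = (\<Prod>i<a. f (k * Suc i) / f k)"
  have "const_q q k (Suc a) b * ((\<Prod>u<a. f (k * Suc u - 1)) * (\<Prod>j<b. f (k * (Suc a + j) + j)))
     = Y4 * (f (k * Suc a) / f k * (\<Prod>u<a. f (k * Suc u - 1))) * (Y3 * Y2 / f (k + 1) ^ b) * Y1"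
    unfolding const_q_def Let_def f_def[symmetric] ix Y1_def Y2_def Y3_def Y4_def
    by (simp add: prod.distrib prod_dividef mult_ac)
  also have "\<dots> = (1 - ?Q ^ (k * Suc a)) / (1 - ?Q ^ k) * (Y4 * (Y3 * Y1 / f (k + 1) ^ b)) *
      ((\<Prod>u<a. f (k * Suc (Suc u) - 1)) * Y2)"
    unfolding tele by simp
  also have "Y4 * (Y3 * Y1 / f (k + 1) ^ b) = const_q q k a b"
    unfolding const_q_def Let_def f_def[symmetric] Y1_def Y3_def Y4_def
    by (simp add: prod.distrib prod_dividef)
  finally show ?thesis unfolding f_def[symmetric] R Y2_def .
qed

end

section \<open>Induction on the number of variables of the first type\<close>

context
  fixes q :: real
  assumes q: "0 < q" "q < 1"
begin

lemma Q_nonzero: "complex_of_real q \<noteq> 0"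
  using q by simp

text \<open>The limit relation expresses \<open>\<kappa>\<close> by the smaller sum at
  \<open>q^(2k)\<close> and \<open>c q^(2k)\<close>. By the two recursions the constant of the
  closed form satisfies the same relation, and all factors that accompany \<open>\<kappa>\<close> in
  it are nonzero.\<close>

lemma moment_closed_step:
  assumes "k \<ge> 1" and ST: "finite S" "finite T" "\<And>i j. i \<in> S \<Longrightarrow> j \<in> T \<Longrightarrow> i < j"
    and S: "card S = Suc a" and T: "card T = b" and c: "c \<noteq> 0" "norm c < 1" and "A \<noteq> 0"
    and IH: "\<And>i c A. i \<in> S \<Longrightarrow> c \<noteq> 0 \<Longrightarrow> norm c < 1 \<Longrightarrow> A \<noteq> 0 \<Longrightarrow>
      moment_sum q k (S - {i}) T A c = moment_closed q k a b A c"
  shows "moment_sum q k S T A c = moment_closed q k (Suc a) b A c"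
proof -
  let ?Q = "complex_of_real q"
  define Y where "Y = k * (Suc a + b choose 2) + (b choose 2)"
  let ?R = "poly (chain_poly q k (Suc a) (Suc a + b))" and ?R' = "poly (chain_poly q k a (a + b))"
  obtain \<kappa> where \<kappa>: "\<And>A. A \<noteq> 0 \<Longrightarrow> moment_sum q k S T A c = \<kappa> * A ^ Y * ?R A * ?R (c / A)"
    using moment_sum_factor[OF q ST c, of k] unfolding S T Y_def by auto
  define f where "f = qpoch q ?Q"
  define F1 F2 P1 P2 where "F1 = f (2 * k - 1)" and "F2 = f (2 * k)" and "P1 = qpoch q c (2 * k)" and "P2 = qpoch q (c * ?Q ^ 2) (2 * k)"
  define X where "X = (\<Prod>u<a. f (k * Suc u - 1)) * (\<Prod>j<b. f (k * (Suc a + j) + j))"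
  define s where "s = (1 - ?Q ^ (k * Suc a)) / (1 - ?Q ^ k)"
  define Y' where "Y' = k * (a + b choose 2) + (b choose 2)"
  define c' where "c' = c * ?Q ^ (2 * k)"
  define G where "G = moment_closed q k a b (?Q ^ (2 * k)) c'"
  have disj: "S \<inter> T = {}" using ST(3) by force
  have c': "c' \<noteq> 0" "norm c' < 1"
    unfolding c'_def using c Q_nonzero norm_q_shift[OF q c(2)] by auto
  have "\<kappa> * X * ?R c = (\<Sum>i\<in>S. ?Q ^ (k * card {j\<in>S \<union> T. i < j}) *
      ((F1 / P1) ^ a * (F2 / P2) ^ b * moment_sum q k (S - {i}) T (?Q ^ (2 * k)) c'))"
    unfolding X_def F1_def F2_def P1_def P2_def f_def c'_def mult.assoc[symmetric, of \<kappa>]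
    by (rule moment_sum_limit[OF q ST(1,2) _ assms(1) S T]) (use ST(3) \<kappa> in auto)
  also have "\<dots> = (\<Sum>i\<in>S. ?Q ^ (k * b) * (?Q ^ k) ^ card {j\<in>S. i < j} * ((F1 / P1) ^ a * (F2 / P2) ^ b * G))"
  proof (intro sum.cong refl arg_cong2[where f = "(*)"])
    fix i assume i: "i \<in> S"
    \<comment> \<open>Every index of \<open>T\<close> exceeds \<open>i\<close>, so the position of
      \<open>i\<close> is counted inside \<open>S\<close> and raised by \<open>b\<close>.\<close>
    have "{j\<in>S \<union> T. i < j} = {j\<in>S. i < j} \<union> T" using ST(3) i by auto
    also have "card \<dots> = card {j\<in>S. i < j} + b"
      using ST disj T by (subst card_Un_disjoint) auto
    finally show "?Q ^ (k * card {j\<in>S \<union> T. i < j}) = ?Q ^ (k * b) * (?Q ^ k) ^ card {j\<in>S. i < j}"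
      by (simp add: distrib_left power_add power_mult mult.commute)
    show "moment_sum q k (S - {i}) T (?Q ^ (2 * k)) c' = G"
      unfolding G_def using i c' Q_nonzero by (intro IH) auto
  qed
  also have "\<dots> = ?Q ^ (k * b) * (\<Sum>i\<in>S. (?Q ^ k) ^ card {j\<in>S. i < j}) * ((F1 / P1) ^ a * (F2 / P2) ^ b * G)"
    by (simp only: sum_distrib_left sum_distrib_right)
  also have "(\<Sum>i\<in>S. (?Q ^ k) ^ card {j\<in>S. i < j}) = s"
    using one_minus_q_power[OF q assms(1)] unfolding sum_power_rank[OF ST(1)] S s_def power_mult
    by (subst sum_gp_strict) auto
  finally have lim: "\<kappa> * X * ?R c = ?Q ^ (k * b) * s * ((F1 / P1) ^ a * (F2 / P2) ^ b * G)" .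
  have G: "G = ?Q ^ const_exp k b a * const_q q k a b * const_c q k b c' a * ?Q ^ (2 * k * Y') * ?R' (?Q ^ (2 * k)) * ?R' c"
    unfolding G_def moment_closed_def c'_def Y'_def[symmetric] using Q_nonzero by (simp add: power_mult)
  define C where "C = ?Q ^ const_exp k b (Suc a) * const_q q k (Suc a) b * const_c q k b c (Suc a)"
  have rc: "const_c q k b c (Suc a) * ?R c * (P1 ^ a * P2 ^ b) = const_c q k b c' a * ?R' c"
    unfolding P1_def P2_def c'_def by (rule const_c_recursion[OF q c(2)])
  have rq: "const_q q k (Suc a) b * X = s * const_q q k a b * (F1 ^ a * F2 ^ b * ?R' (?Q ^ (2 * k)))"
    unfolding X_def s_def F1_def F2_def f_def by (rule const_q_recursion[OF q assms(1)])
  have e: "?Q ^ const_exp k b (Suc a) = ?Q ^ const_exp k b a * ?Q ^ (k * b) * ?Q ^ (2 * k * Y')"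
    by (simp add: Y'_def power_add)
  have nz: "P1 \<noteq> 0" "P2 \<noteq> 0" "X \<noteq> 0" "?R c \<noteq> 0"
  proof -
    show "P1 \<noteq> 0" "P2 \<noteq> 0"
      unfolding P1_def P2_def using c norm_q_shift[OF q c(2)] by (auto intro!: qpoch_nonzero[OF q])
    show "X \<noteq> 0" unfolding X_def f_def using qpoch_nonzero[OF q norm_q[OF q]] by (auto simp: prod_zero_iff)
    have "qpoch q c m \<noteq> 0" "qpoch q (c * ?Q) m \<noteq> 0" for m
      using c norm_q_shift[OF q c(2), of 1] by (auto intro!: qpoch_nonzero[OF q])
    thus "?R c \<noteq> 0" unfolding chain_poly_split by (auto simp: prod_zero_iff)
  qed
  have "\<kappa> * X * ?R c * (P1 ^ a * P2 ^ b) = ?Q ^ (k * b) * s * (F1 ^ a * F2 ^ b * G)"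
    unfolding lim using nz by (simp add: power_divide)
  also have "\<dots> = (?Q ^ const_exp k b a * ?Q ^ (k * b) * ?Q ^ (2 * k * Y')) *
      (s * const_q q k a b * (F1 ^ a * F2 ^ b * ?R' (?Q ^ (2 * k)))) * (const_c q k b c' a * ?R' c)"
    unfolding G by (simp only: mult_ac)
  also have "\<dots> = C * X * ?R c * (P1 ^ a * P2 ^ b)"
    unfolding C_def e rq[symmetric] rc[symmetric] by (simp only: mult_ac)
  finally have "\<kappa> = C" using nz by simp
  show ?thesis
    unfolding \<kappa>[OF \<open>A \<noteq> 0\<close>] moment_closed_def \<open>\<kappa> = C\<close> C_def Y_def ..
qed

lemma moment_sum_empty: "moment_sum q k {} {} A c = 1"
  by (simp add: moment_sum_def kernel_deg_def pairs_def multi_exps_def mcoeff_def pair_kernel_def)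

lemma moment_closed_induct:
  assumes "k \<ge> 1" "finite S" "finite T" "\<And>i j. i \<in> S \<Longrightarrow> j \<in> T \<Longrightarrow> i < j" "c \<noteq> 0" "norm c < 1" "A \<noteq> 0"
    and base: "\<And>c A. c \<noteq> 0 \<Longrightarrow> norm c < 1 \<Longrightarrow> A \<noteq> 0 \<Longrightarrow>
      moment_sum q k {} T A c = moment_closed q k 0 (card T) A c"
  shows "moment_sum q k S T A c = moment_closed q k (card S) (card T) A c"
  using assms(2,4-7)
proof (induction "card S" arbitrary: S c A)
  case 0
  thus ?case using base by simp
next
  case (Suc a)
  have "moment_sum q k S T A c = moment_closed q k (Suc a) (card T) A c"
  proof (rule moment_closed_step[OF assms(1)])
    fix i and c A :: complex assume i: "i \<in> S" "c \<noteq> 0" "norm c < 1" "A \<noteq> 0"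
    have "card (S - {i}) = a" using i(1) Suc.hyps(2) Suc.prems(1) by simp
    thus "moment_sum q k (S - {i}) T A c = moment_closed q k a (card T) A c"
      using Suc.hyps(1)[of "S - {i}" c A] i Suc.prems(1,2) by simp
  qed (use Suc assms(3) in auto)
  thus ?case using Suc.hyps(2) by simp
qed

text \<open>Without second type variables the induction can run down to no variables at all, where
  the sum is 1. Used at \<open>Suc k\<close>, this supplies the base case in which only the second
  type is left.\<close>

lemma moment_closed_only_S:
  assumes "k \<ge> 1" "finite S" "c \<noteq> 0" "norm c < 1" "A \<noteq> 0"
  shows "moment_sum q k S {} A c = moment_closed q k (card S) 0 A c"
  using moment_closed_induct[of k S "{}" c A] assms
  by (simp add: moment_sum_empty moment_closed_def const_q_def chain_poly_def binomial_eq_0)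

lemma const_exp_only_S: "const_exp k 0 b = 2 * k\<^sup>2 * (b choose 3)"
  by (induction b) (simp_all add: numeral_2_eq_2 numeral_3_eq_3 algebra_simps)

lemma moment_closed_only_T:
  assumes c: "norm c < 1"
  shows "moment_closed q (Suc k) b 0 (A * complex_of_real q) (c * complex_of_real q ^ 2) = moment_closed q k 0 b A c"
proof -
  let ?Q = "complex_of_real q"
  define f where "f = qpoch q ?Q"
  have 1: "const_q q (Suc k) b 0 = const_q q k 0 b"
  proof -
    have "f (Suc k * Suc i) = f (i * (k + 1) + (0 + 1) * k) * (1 - ?Q ^ ((k + 1) * Suc i))" for i
    proof -
      have e: "Suc k * Suc i = Suc (i * (k + 1) + (0 + 1) * k)" "(k + 1) * Suc i = Suc (i * (k + 1) + (0 + 1) * k)"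
        by (simp_all add: algebra_simps)
      show ?thesis unfolding e f_def qpoch_Suc by simp
    qed
    thus ?thesis unfolding const_q_def Let_def f_def[symmetric] by (simp add: mult.commute)
  qed
  have 2: "const_c q (Suc k) 0 (c * ?Q ^ 2) b = const_c q k b c 0"
  proof (cases b)
    case (Suc b')
    have sh: "qpoch q (c * ?Q ^ 2) m = qpoch q c (2 + m) / qpoch q c 2" for m
      by (rule qpoch_shift[OF q c])
    have "2 + (b' + i) * Suc k = Suc b' + i + 1 + (Suc b' + i - 1) * k" for i by (simp add: algebra_simps)
    thus ?thesis unfolding Suc by (simp only: const_c.simps sh) (simp add: prod_dividef divide_simps)
  qed simp
  have 3: "poly (chain_poly q (Suc k) b (b + 0)) (x * ?Q) = poly (chain_poly q k 0 (0 + b)) x" for x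
    unfolding chain_poly_split by (simp add: algebra_simps)
  have 4: "c * ?Q ^ 2 / (A * ?Q) = (c / A) * ?Q" using Q_nonzero by (simp add: power2_eq_square)
  have 5: "?Q ^ const_exp (Suc k) 0 b * (A * ?Q) ^ (Suc k * (b + 0 choose 2) + (0 choose 2))
      = ?Q ^ const_exp k b 0 * A ^ (k * (0 + b choose 2) + (b choose 2))"
    by (simp add: const_exp_only_S power_mult_distrib power_add[symmetric] numeral_2_eq_2 numeral_3_eq_3 algebra_simps)
  have "moment_closed q (Suc k) b 0 (A * ?Q) (c * ?Q ^ 2) = (?Q ^ const_exp (Suc k) 0 b * (A * ?Q) ^ (Suc k * (b + 0 choose 2) + (0 choose 2))) *
    const_q q (Suc k) b 0 * const_c q (Suc k) 0 (c * ?Q ^ 2) b * poly (chain_poly q (Suc k) b (b + 0)) (A * ?Q) *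
    poly (chain_poly q (Suc k) b (b + 0)) (c / A * ?Q)"
    unfolding moment_closed_def 4 by (simp only: mult_ac)
  also have "\<dots> = moment_closed q k 0 b A c"
    unfolding 1 2 3 5 moment_closed_def by (simp only: mult_ac)
  finally show ?thesis .
qed

lemma moment_closed_k0:
  assumes c: "norm c < 1"
  shows "moment_closed q 0 a b A c = moment_closed q 0 0 b A c"
proof -
  have 1: "const_exp 0 b a = const_exp 0 b 0" by (induction a) auto
  have 2: "const_q q 0 a b = const_q q 0 0 b"
    by (simp add: const_q_def qpoch_def)
  have 3: "const_c q 0 b c a = const_c q 0 b c 0"
  proof (cases a)
    case (Suc a')
    have nz: "(\<Prod>j<b. qpoch q c (Suc j)) \<noteq> 0"
      using qpoch_nonzero[OF q c] by (auto simp: prod_zero_iff)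
    have "(\<Prod>J<2*b. qpoch q c (Suc J)) = (\<Prod>j<b. qpoch q c (Suc j)) * (\<Prod>j<b. qpoch q c (Suc (b + j)))"
      using prod_lessThan_add[of "\<lambda>J. qpoch q c (Suc J)" b b] by (simp add: mult_2)
    moreover have "qpoch q c 0 = 1" by (simp add: qpoch_def)
    ultimately show ?thesis unfolding Suc using nz by (simp add: prod_dividef)
  qed simp
  have 4: "poly (chain_poly q 0 a (a + b)) x = poly (chain_poly q 0 0 (0 + b)) x" for x
    unfolding chain_poly_split by (simp add: qpoch_def)
  show ?thesis unfolding moment_closed_def 1 2 3 4 by simp
qed

theorem moment_sum_closed:
  assumes "finite S" "finite T" "\<And>i j. i \<in> S \<Longrightarrow> j \<in> T \<Longrightarrow> i < j" "c \<noteq> 0" "norm c < 1" "A \<noteq> 0"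
  shows "moment_sum q k S T A c = moment_closed q k (card S) (card T) A c"
proof -
  \<comment> \<open>The exchange of types leads to \<open>Suc k\<close>, which is positive even for
    \<open>k = 0\<close>; this is why the base case precedes the distinction on
    \<open>k\<close>.\<close>
  have T_only: "moment_sum q k {} T A c = moment_closed q k 0 (card T) A c"
    if "c \<noteq> 0" "norm c < 1" "A \<noteq> 0" for c A
    unfolding moment_sum_only_T moment_closed_only_T[OF that(2), symmetric]
    by (rule moment_closed_only_S) (use that assms Q_nonzero norm_q_shift[OF q that(2)] in auto)
  show ?thesis
  proof (cases "k = 0")
    case True
    have "S \<inter> T = {}" using assms(3) by force
    from moment_sum_k0[OF q assms(1,2) this]
    show ?thesis using T_only[OF assms(4-6)] moment_closed_k0[OF assms(5), of "card S" "card T" A]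
      unfolding True by simp
  next
    case False
    hence k: "k \<ge> 1" by simp
    show ?thesis by (rule moment_closed_induct[OF k assms T_only])
  qed
qed

end

subsection \<open>The \<open>q\<close>-binomial theorem\<close>

context
  fixes q :: real
  assumes q: "0 < q" "q < 1"
begin

lemma convergent_qpoch: "convergent_prod (\<lambda>i. 1 - x * complex_of_real q ^ i)"
proof -
  have "summable (\<lambda>i. norm x * q ^ i)"
    using q by (intro summable_mult summable_geometric) auto
  hence "summable (\<lambda>i. norm ((1 - x * complex_of_real q ^ i) - 1))"
    using q by (simp add: norm_mult norm_power)
  thus ?thesis by (intro abs_convergent_prod_imp_convergent_prod summable_imp_abs_convergent_prod)
qed

lemma qpoch_LIMSEQ: "(\<lambda>m. qpoch q x m) \<longlonglongrightarrow> qpoch_inf q x"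
proof -
  have "(\<lambda>n. \<Prod>i\<le>n. 1 - x * complex_of_real q ^ i) \<longlonglongrightarrow> qpoch_inf q x"
    unfolding qpoch_inf_def by (rule convergent_prod_LIMSEQ[OF convergent_qpoch])
  hence "(\<lambda>n. qpoch q x (Suc n)) \<longlonglongrightarrow> qpoch_inf q x"
    by (simp only: qpoch_def lessThan_Suc_atMost)
  thus ?thesis by (rule LIMSEQ_imp_Suc)
qed

lemma qpoch_inf_split: "qpoch_inf q x = qpoch q x m * qpoch_inf q (x * complex_of_real q ^ m)"
proof (rule LIMSEQ_unique)
  show "(\<lambda>n. qpoch q x (n + m)) \<longlonglongrightarrow> qpoch_inf q x"
    by (rule LIMSEQ_ignore_initial_segment[OF qpoch_LIMSEQ])
  have "(\<lambda>n. qpoch q x m * qpoch q (x * complex_of_real q ^ m) n) \<longlonglongrightarrow> qpoch q x m * qpoch_inf q (x * complex_of_real q ^ m)"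
    by (intro tendsto_mult tendsto_const qpoch_LIMSEQ)
  thus "(\<lambda>n. qpoch q x (n + m)) \<longlonglongrightarrow> qpoch q x m * qpoch_inf q (x * complex_of_real q ^ m)"
    by (simp add: add.commute[of _ m] qpoch_add)
qed

lemma qpoch_inf_nonzero:
  assumes "norm x < 1"
  shows "qpoch_inf q x \<noteq> 0"
  unfolding qpoch_inf_def
proof (rule prodinf_nonzero[OF convergent_qpoch])
  fix i
  have "qpoch q x (Suc i) \<noteq> 0" by (rule qpoch_nonzero[OF q assms])
  thus "1 - x * complex_of_real q ^ i \<noteq> 0" by (simp add: qpoch_def)
qed

lemma summable_q_binomial:
  assumes "norm z < 1"
  shows "summable (\<lambda>e. norm (qpoch q B e / qpoch q (complex_of_real q) e * z ^ e))"
proof -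
  have "(\<lambda>e. qpoch q B e / qpoch q (complex_of_real q) e) \<longlonglongrightarrow> qpoch_inf q B / qpoch_inf q (complex_of_real q)"
    using qpoch_inf_nonzero[OF norm_q[OF q]] by (intro tendsto_divide qpoch_LIMSEQ)
  hence "Bseq (\<lambda>e. qpoch q B e / qpoch q (complex_of_real q) e)"
    by (intro convergent_imp_Bseq convergentI)
  then obtain K where K: "\<And>e. norm (qpoch q B e / qpoch q (complex_of_real q) e) \<le> K"
    by (auto simp: Bseq_def)
  show ?thesis
  proof (rule summable_comparison_test')
    show "summable (\<lambda>e. K * norm z ^ e)" using assms by (intro summable_mult summable_geometric) auto
    show "norm (norm (qpoch q B e / qpoch q (complex_of_real q) e * z ^ e)) \<le> K * norm z ^ e" if "e \<ge> 0" for e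
      using mult_right_mono[OF K[of e], of "norm z ^ e"] by (simp add: norm_mult norm_power norm_divide)
  qed
qed

text \<open>The series satisfies \<open>(1 - z) F(z) = (1 - B z) F(q z)\<close>. Iteration moves the
  argument to 0, where \<open>F\<close> is continuous with value 1, and the accumulated factors
  converge to the infinite products.\<close>

lemma sums_q_binomial:
  assumes z: "norm z < 1"
  shows "(\<lambda>e. qpoch q B e / qpoch q (complex_of_real q) e * z ^ e) sums (qpoch_inf q (B * z) / qpoch_inf q z)"
proof -
  let ?Q = "complex_of_real q"
  define a where "a = (\<lambda>e. qpoch q B e / qpoch q ?Q e)"
  define F where "F = (\<lambda>z. \<Sum>e. a e * z ^ e)"
  have sm: "summable (\<lambda>e. a e * z ^ e)" if "norm z < 1" for z
    using summable_norm_cancel[OF summable_q_binomial[OF that]] by (simp add: a_def)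
  have a0: "a 0 = 1" by (simp add: a_def qpoch_def)
  have aS: "a (Suc e) - a e = a (Suc e) * ?Q ^ Suc e - B * (a e * ?Q ^ e)" for e
  proof -
    have "1 - ?Q * ?Q ^ e \<noteq> 0" "qpoch q ?Q e \<noteq> 0"
      using one_minus_q_power[OF q, of "Suc e"] qpoch_nonzero[OF q norm_q[OF q]] by auto
    thus ?thesis unfolding a_def qpoch_Suc by (simp add: field_simps)
  qed
  have nq: "norm (?Q * z) < 1" if "norm z < 1" for z
    using norm_q_shift[OF q that, of 1] by (simp add: mult.commute)
  have feq: "(1 - z) * F z = (1 - B * z) * F (?Q * z)" if z: "norm z < 1" for z
  proof -
    have s1: "(\<lambda>e. a e * z ^ e) sums F z" and s2: "(\<lambda>e. a e * (?Q * z) ^ e) sums F (?Q * z)"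
      using sm[OF z] sm[OF nq[OF z]] by (auto simp: F_def summable_sums)
    have t1: "(\<lambda>e. a (Suc e) * z ^ Suc e - z * (a e * z ^ e)) sums (F z - 1 - z * F z)"
    proof (rule sums_diff[OF _ sums_mult[OF s1]])
      show "(\<lambda>e. a (Suc e) * z ^ Suc e) sums (F z - 1)"
        using s1 sums_Suc_iff[of "\<lambda>e. a e * z ^ e" "F z - 1"] by (simp add: a0)
    qed
    have t2: "(\<lambda>e. a (Suc e) * (?Q * z) ^ Suc e - B * z * (a e * (?Q * z) ^ e)) sums (F (?Q * z) - 1 - B * z * F (?Q * z))"
    proof (rule sums_diff[OF _ sums_mult[OF s2]])
      show "(\<lambda>e. a (Suc e) * (?Q * z) ^ Suc e) sums (F (?Q * z) - 1)"
        using s2 sums_Suc_iff[of "\<lambda>e. a e * (?Q * z) ^ e" "F (?Q * z) - 1"] by (simp add: a0)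
    qed
    have "a (Suc e) * z ^ Suc e - z * (a e * z ^ e) = a (Suc e) * (?Q * z) ^ Suc e - B * z * (a e * (?Q * z) ^ e)" for e
    proof -
      have "a (Suc e) * z ^ Suc e - z * (a e * z ^ e) = (a (Suc e) - a e) * z ^ Suc e" by (simp add: algebra_simps)
      thus ?thesis unfolding aS by (simp add: algebra_simps power_mult_distrib)
    qed
    from t1[unfolded this] t2 have "F z - 1 - z * F z = F (?Q * z) - 1 - B * z * F (?Q * z)"
      by (rule sums_unique2)
    thus ?thesis by (simp add: algebra_simps)
  qed
  have nqn: "norm (?Q ^ n * z) < 1" for n
    using norm_q_shift[OF q z, of n] by (simp add: mult.commute)
  have it: "qpoch q z n * F z = qpoch q (B * z) n * F (?Q ^ n * z)" for n
  proof (induction n)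
    case (Suc n)
    have "qpoch q z (Suc n) * F z = qpoch q (B * z) n * ((1 - ?Q ^ n * z) * F (?Q ^ n * z))"
      using Suc by (simp add: qpoch_Suc mult_ac)
    also have "\<dots> = qpoch q (B * z) (Suc n) * F (?Q ^ Suc n * z)"
      unfolding feq[OF nqn] by (simp add: qpoch_Suc mult_ac)
    finally show ?case .
  qed (simp add: qpoch_def)
  have "isCont F 0"
  proof -
    have "isCont (\<lambda>x. \<Sum>n. a n * x ^ n) (0::complex)"
      by (rule isCont_powser[where K = "1/2"]) (auto intro: sm)
    thus ?thesis by (simp add: F_def)
  qed
  moreover have "(\<lambda>n. ?Q ^ n * z) \<longlonglongrightarrow> 0"
    using tendsto_mult_right[OF LIMSEQ_power_zero[OF norm_q[OF q]], of z] by simp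
  ultimately have "(\<lambda>n. F (?Q ^ n * z)) \<longlonglongrightarrow> F 0" by (rule isCont_tendsto_compose)
  moreover have "F 0 = 1" by (simp add: F_def a0)
  ultimately have "(\<lambda>n. qpoch q (B * z) n * F (?Q ^ n * z)) \<longlonglongrightarrow> qpoch_inf q (B * z) * 1"
    by (intro tendsto_mult qpoch_LIMSEQ) simp
  moreover have "(\<lambda>n. qpoch q z n * F z) \<longlonglongrightarrow> qpoch_inf q z * F z"
    by (intro tendsto_mult qpoch_LIMSEQ tendsto_const)
  ultimately have "qpoch_inf q z * F z = qpoch_inf q (B * z)"
    unfolding it using LIMSEQ_unique by fastforce
  hence "F z = qpoch_inf q (B * z) / qpoch_inf q z"
    using qpoch_inf_nonzero[OF z] by (simp add: field_simps)
  thus ?thesis using summable_sums[OF sm[OF z]] unfolding a_def F_def by simp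
qed

end

text \<open>For a finite combination of products of one-variable functions, convergence over the
  whole grid reduces to absolute convergence in each variable. Summability is thus obtained together
  with the value.\<close>

lemma polynomial_grid_sum:
  assumes "finite I" "finite Y"
    and F: "\<And>e. F e = (\<Sum>d\<in>Y. C d * (\<Prod>i\<in>I. g' d i (e i)))"
    and sm: "\<And>d i. d \<in> Y \<Longrightarrow> i \<in> I \<Longrightarrow> summable (\<lambda>e. norm (g' d i e))"
    and s: "\<And>d i. d \<in> Y \<Longrightarrow> i \<in> I \<Longrightarrow> g' d i sums (s d i :: complex)"
  shows "(F has_sum (\<Sum>d\<in>Y. C d * (\<Prod>i\<in>I. s d i))) (PiE I (\<lambda>_. UNIV))"
proof -
  have "((\<lambda>e. \<Prod>i\<in>I. g' d i (e i)) has_sum (\<Prod>i\<in>I. s d i)) (PiE I (\<lambda>_. UNIV))" if d: "d \<in> Y" for d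
  proof -
    have abs: "(\<lambda>e. norm (g' d i e)) summable_on UNIV" if "i \<in> I" for i
      using sm[OF d that] by (intro norm_summable_imp_summable_on) simp
    have "Infinite_Set_Sum.abs_summable_on (\<lambda>e. \<Prod>i\<in>I. g' d i (e i)) (PiE I (\<lambda>_. UNIV))"
      by (rule Infinite_Set_Sum.abs_summable_on_prod_PiE) (use assms(1) abs in \<open>auto simp: abs_summable_equivalent[symmetric]\<close>)
    hence "(\<lambda>e. \<Prod>i\<in>I. g' d i (e i)) summable_on (PiE I (\<lambda>_. UNIV))"
      by (simp add: abs_summable_equivalent[symmetric] abs_summable_summable)
    moreover have "infsum (\<lambda>e. \<Prod>i\<in>I. g' d i (e i)) (PiE I (\<lambda>_. UNIV)) = (\<Prod>i\<in>I. infsum (g' d i) UNIV)"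
      by (rule infsum_prod_PiE_abs) (use assms(1) abs in auto)
    moreover have "infsum (g' d i) UNIV = s d i" if "i \<in> I" for i
      using norm_summable_imp_has_sum[OF sm[OF d that] s[OF d that]] by (rule infsumI)
    ultimately show ?thesis by (simp add: has_sum_iff)
  qed
  with assms(2) have "((\<lambda>e. \<Sum>d\<in>Y. C d * (\<Prod>i\<in>I. g' d i (e i))) has_sum (\<Sum>d\<in>Y. C d * (\<Prod>i\<in>I. s d i))) (PiE I (\<lambda>_. UNIV))"
  proof (induction Y rule: finite_induct)
    case (insert d Y)
    thus ?case by (simp add: has_sum_add has_sum_cmult_right)
  qed simp
  thus ?thesis unfolding F .
qed

subsection \<open>The two integrals as moment sums\<close>

text \<open>The moment of degree 0 of one variable, without the factor \<open>1 - q\<close> of the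
  q-integral. For the second type the factor \<open>1 - B\<close> stems from
  \<open>(1 - B q^e) (B)_e = (1 - B) (B q)_e\<close>.\<close>

definition mass :: "real \<Rightarrow> nat set \<Rightarrow> complex \<Rightarrow> complex \<Rightarrow> nat \<Rightarrow> complex" where
  "mass q T A B i = (let Q = complex_of_real q; r = type_shift T i in
     qpoch_inf q Q / qpoch_inf q B * (1 - B) ^ r * qpoch_inf q (A * B * Q ^ (2 * r)) / qpoch_inf q (A * Q ^ r))"

definition pair_kernel' :: "real \<Rightarrow> nat \<Rightarrow> nat set \<Rightarrow> nat set \<Rightarrow> (nat \<Rightarrow> complex) \<Rightarrow> complex" where
  "pair_kernel' q k S T t = (\<Prod>(i, j)\<in>pairs (S \<union> T). pair_factor q (pair_mult k T i j) (t i) (t j / complex_of_real q))"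

lemma pair_factor_scale: "pair_factor q k (z * a) (z * b) = z ^ (2 * k) * pair_factor q k a b"
proof -
  have "pair_factor q k (z * a) (z * b) = (\<Prod>s<2 * k. z * (a - complex_of_real q powi (1 - int k + int s) * b))"
    unfolding pair_factor_def by (intro prod.cong) (auto simp: algebra_simps)
  thus ?thesis by (simp add: pair_factor_def prod.distrib)
qed

lemma pair_factor_qpoch:
  assumes "a \<noteq> 0" "q \<noteq> 0"
  shows "a ^ (2 * k) * qpoch q (complex_of_real q powi (1 - int k) * (b / a)) (2 * k) = pair_factor q k a b"
proof -
  have "a ^ (2 * k) * qpoch q (complex_of_real q powi (1 - int k) * (b / a)) (2 * k)
     = (\<Prod>s<2 * k. a * (1 - complex_of_real q powi (1 - int k) * (b / a) * complex_of_real q ^ s))"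
    by (simp add: prod.distrib qpoch_def)
  also have "\<dots> = pair_factor q k a b"
    unfolding pair_factor_def
  proof (intro prod.cong refl)
    fix s
    have "complex_of_real q powi (1 - int k + int s) = complex_of_real q powi (1 - int k) * complex_of_real q ^ s"
      using assms(2) by (subst power_int_add) auto
    thus "a * (1 - complex_of_real q powi (1 - int k) * (b / a) * complex_of_real q ^ s)
        = a - complex_of_real q powi (1 - int k + int s) * b"
      using assms(1) by (simp add: field_simps)
  qed
  finally show ?thesis .
qed

text \<open>The left-hand product has the exponents \<open>-k\<close>, ..., \<open>k - 1\<close>,
  the negatives of those on the right. Taking \<open>-q^s\<close> out of each of the
  \<open>2 * k\<close> factors gives \<open>q^(-k)\<close> in total and no sign.\<close>

lemma pair_factor_swap:
  assumes "q \<noteq> 0"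
  shows "complex_of_real q ^ k * pair_factor q k a (b / complex_of_real q) = pair_factor q k b a"
proof (induction k)
  case (Suc k)
  let ?Q = "complex_of_real q"
  have p: "?Q powi (- int k) = inverse (?Q ^ k)" by (simp add: power_int_minus)
  have "?Q * ((a - inverse (?Q ^ k) * (b / ?Q)) * (a - ?Q ^ (k + 1) * (b / ?Q)))
      = (b - inverse (?Q ^ k) * a) * (b - ?Q ^ (k + 1) * a)"
    using assms by (simp add: field_simps)
  hence "?Q ^ Suc k * pair_factor q (Suc k) a (b / ?Q)
      = (b - inverse (?Q ^ k) * a) * (b - ?Q ^ (k + 1) * a) * (?Q ^ k * pair_factor q k a (b / ?Q))"
    unfolding pair_factor_Suc p by (simp add: mult_ac)
  thus ?case unfolding Suc pair_factor_Suc p by (simp add: mult_ac)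
qed (simp add: pair_factor_def)

section \<open>The integrands at powers of q\<close>

context
  fixes q :: real
  assumes q: "0 < q" "q < 1"
begin

lemma weight_ratio:
  assumes "norm B < 1"
  shows "qpoch_inf q (complex_of_real q * complex_of_real q ^ e) / qpoch_inf q (B * complex_of_real q ^ e)
    = qpoch_inf q (complex_of_real q) / qpoch_inf q B * (qpoch q B e / qpoch q (complex_of_real q) e)"
proof -
  have "qpoch_inf q B \<noteq> 0" "qpoch_inf q (B * complex_of_real q ^ e) \<noteq> 0"
    using qpoch_inf_nonzero[OF q] assms norm_q_shift[OF q assms] by auto
  thus ?thesis
    using qpoch_nonzero[OF q norm_q[OF q], of e] qpoch_inf_split[OF q, of B e]
      qpoch_inf_split[OF q, of "complex_of_real q" e] by (simp add: field_simps)
qed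

text \<open>With the powers collected this is a q-binomial series at \<open>A q^(r + \<nu>)\<close>.
  Splitting the infinite products in its value separates the mass from a quotient of finite
  products.\<close>

lemma mass_moment:
  fixes A B :: complex and T :: "nat set" and i \<nu> :: nat
  assumes AB: "norm A < 1" "norm B < 1"
  defines "K \<equiv> qpoch_inf q (complex_of_real q) / qpoch_inf q B"
  defines "r \<equiv> type_shift T i"
  defines "h \<equiv> \<lambda>e. (complex_of_real q ^ e) ^ \<nu> * (K * (1 - B) ^ r * (A * complex_of_real q ^ r) ^ e *
      (qpoch q (B * complex_of_real q ^ r) e / qpoch q (complex_of_real q) e))"
  shows "summable (\<lambda>e. norm (h e))" "h sums (mass q T A B i * type_moment q T A (A * B) i \<nu>)"
proof -
  let ?Q = "complex_of_real q"
  define z where "z = A * ?Q ^ r * ?Q ^ \<nu>"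
  have z: "norm z < 1" unfolding z_def by (intro norm_q_shift[OF q] AB)
  have h: "h = (\<lambda>e. K * (1 - B) ^ r * (qpoch q (B * ?Q ^ r) e / qpoch q ?Q e * z ^ e))"
    unfolding h_def z_def by (auto simp: power_mult_distrib power_mult[symmetric] mult_ac)
  show "summable (\<lambda>e. norm (h e))"
    unfolding h norm_mult[of "K * (1 - B) ^ r"] by (intro summable_mult summable_q_binomial[OF q z])
  have "h sums (K * (1 - B) ^ r * (qpoch_inf q (B * ?Q ^ r * z) / qpoch_inf q z))"
    unfolding h by (intro sums_mult sums_q_binomial[OF q z])
  also have "B * ?Q ^ r * z = A * B * ?Q ^ (2 * r) * ?Q ^ \<nu>"
    by (simp add: z_def mult_2 power_add)
  also have "K * (1 - B) ^ r * (qpoch_inf q (A * B * ?Q ^ (2 * r) * ?Q ^ \<nu>) / qpoch_inf q z)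
      = mass q T A B i * type_moment q T A (A * B) i \<nu>"
  proof -
    have cB: "norm (A * B) < 1" using AB by (simp add: norm_mult mult_strict_mono'[of "norm A" 1 "norm B" 1, simplified])
    have "qpoch q (A * B * ?Q ^ (2 * r)) \<nu> \<noteq> 0" "qpoch q (A * ?Q ^ r) \<nu> \<noteq> 0" "qpoch_inf q z \<noteq> 0"
      using z AB cB by (auto intro!: qpoch_nonzero[OF q] qpoch_inf_nonzero[OF q] norm_q_shift[OF q])
    thus ?thesis
      unfolding mass_def type_moment_def Let_def r_def[symmetric] K_def
      using qpoch_inf_split[OF q, of "A * B * ?Q ^ (2 * r)" \<nu>] qpoch_inf_split[OF q, of "A * ?Q ^ r" \<nu>]
      by (simp add: z_def)
  qed
  finally show "h sums (mass q T A B i * type_moment q T A (A * B) i \<nu>)" .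
qed

text \<open>The factor \<open>1 - t\<close> of the second integral vanishes at \<open>e = 0\<close>.
  Shifting the summation index by one reproduces the weight of the first integral, multiplied by
  \<open>A q\<close> and by one more \<open>q\<close> for each degree.\<close>

lemma mass_moment':
  fixes A B :: complex and T :: "nat set" and i \<nu> :: nat
  assumes AB: "norm A < 1" "norm B < 1"
  defines "K \<equiv> qpoch_inf q (complex_of_real q) / qpoch_inf q B"
  defines "r \<equiv> type_shift T i"
  defines "h \<equiv> \<lambda>e. (complex_of_real q ^ e) ^ \<nu> * (K * (1 - complex_of_real q ^ e) ^ r * (A * complex_of_real q ^ r) ^ e *
      (qpoch q B e / qpoch q (complex_of_real q) e))"
  shows "summable (\<lambda>e. norm (h e))"
    "h sums ((A * complex_of_real q * complex_of_real q ^ \<nu>) ^ r * mass q T A B i * type_moment q T A (A * B) i \<nu>)"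
proof -
  let ?Q = "complex_of_real q"
  note m = mass_moment[OF AB, of \<nu> T i, folded K_def r_def]
  have "summable (\<lambda>e. norm (h e)) \<and> h sums ((A * ?Q * ?Q ^ \<nu>) ^ r * (mass q T A B i * type_moment q T A (A * B) i \<nu>))"
  proof (cases "r = 0")
    case True
    thus ?thesis using m unfolding h_def by simp
  next
    case False
    hence r: "r = 1" by (auto simp: r_def type_shift_def)
    define g where "g = (\<lambda>e. (?Q ^ e) ^ \<nu> * (K * (1 - B) ^ r * (A * ?Q ^ r) ^ e * (qpoch q (B * ?Q ^ r) e / qpoch q ?Q e)))"
    have g: "summable (\<lambda>e. norm (g e))" "g sums (mass q T A B i * type_moment q T A (A * B) i \<nu>)"
      using m unfolding g_def by auto
    have hS: "h (Suc e) = A * ?Q * ?Q ^ \<nu> * g e" for e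
    proof -
      have "1 - ?Q ^ Suc e \<noteq> 0" by (intro one_minus_q_power[OF q]) simp
      moreover have "qpoch q ?Q (Suc e) = qpoch q ?Q e * (1 - ?Q ^ Suc e)" by (simp add: qpoch_Suc)
      ultimately have "(1 - ?Q ^ Suc e) * (qpoch q B (Suc e) / qpoch q ?Q (Suc e)) = (1 - B) * (qpoch q (B * ?Q) e / qpoch q ?Q e)"
        by (simp add: qpoch_Suc_shift[of q B])
      hence "h (Suc e) = (?Q ^ Suc e) ^ \<nu> * K * (A * ?Q) ^ Suc e * ((1 - B) * (qpoch q (B * ?Q) e / qpoch q ?Q e))"
        unfolding h_def r by (simp add: mult_ac)
      thus ?thesis unfolding g_def r by (simp add: power_mult_distrib mult_ac)
    qed
    have h0: "h 0 = 0" by (simp add: h_def r)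
    have "summable (\<lambda>e. norm (h (Suc e)))"
      unfolding hS norm_mult[of "A * ?Q * ?Q ^ \<nu>"] by (intro summable_mult g(1))
    hence "summable (\<lambda>e. norm (h e))" using summable_Suc_iff[of "\<lambda>e. norm (h e)"] by blast
    moreover have "(\<lambda>e. h (Suc e)) sums (A * ?Q * ?Q ^ \<nu> * (mass q T A B i * type_moment q T A (A * B) i \<nu>))"
      unfolding hS by (intro sums_mult g(2))
    hence "h sums (A * ?Q * ?Q ^ \<nu> * (mass q T A B i * type_moment q T A (A * B) i \<nu>))"
      using sums_Suc_iff[of h] h0 by simp
    ultimately show ?thesis by (simp add: r)
  qed
  thus "summable (\<lambda>e. norm (h e))"
    "h sums ((A * ?Q * ?Q ^ \<nu>) ^ r * mass q T A B i * type_moment q T A (A * B) i \<nu>)"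
    by (simp_all add: mult.assoc)
qed

lemma norm_q_powr: "Re \<alpha> > 0 \<Longrightarrow> norm (complex_of_real q powr \<alpha>) < 1"
  using q by (simp add: norm_powr_real_powr) (simp add: powr_def mult_pos_neg)

lemma q_power_powr: "complex_of_real (q ^ e) powr (\<alpha> - 1) * complex_of_real q ^ e = (complex_of_real q powr \<alpha>) ^ e"
proof -
  have "complex_of_real (q ^ e) powr (\<alpha> - 1) * complex_of_real (q ^ e) = complex_of_real (q ^ e) powr (\<alpha> - 1) * complex_of_real (q ^ e) powr 1"
    using q by simp
  also have "\<dots> = complex_of_real (q ^ e) powr \<alpha>" by (subst powr_add[symmetric]) simp
  also have "\<dots> = (complex_of_real q powr \<alpha>) ^ e"
  proof -
    have "Ln (complex_of_real (q ^ e)) = of_nat e * Ln (complex_of_real q)"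
      using q by (simp only: Ln_of_real zero_less_power ln_realpow) simp
    thus ?thesis using q by (simp add: powr_def exp_of_nat_mult[symmetric] mult_ac)
  qed
  finally show ?thesis by simp
qed

lemma weighted_power:
  fixes \<alpha> :: complex
  assumes "norm B < 1"
  defines "Q \<equiv> complex_of_real q"
  shows "(Q ^ e) powr (\<alpha> - 1) * (qpoch_inf q (Q * Q ^ e) / qpoch_inf q (B * Q ^ e)) * Q ^ e
    = (Q powr \<alpha>) ^ e * (qpoch_inf q Q / qpoch_inf q B * (qpoch q B e / qpoch q Q e))"
  using q_power_powr[of e \<alpha>] weight_ratio[OF assms(1), of e] unfolding Q_def by (simp add: mult_ac)

lemma prod_pairs: "(\<Prod>i=a..n. \<Prod>j=i+1..n. f i j) = (\<Prod>(i,j)\<in>pairs {a..n}. f i j)"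
proof -
  have "pairs {a..n} = Sigma {a..n} (\<lambda>i. {i+1..n})" by (auto simp: pairs_def)
  thus ?thesis by (simp add: prod.Sigma)
qed

text \<open>A common form of both integrands: \<open>z\<close> is 1 in the first and
  \<open>1 / q\<close> in the second, and \<open>v\<close> stands for \<open>1 - B t\<close> or
  \<open>1 - t\<close>. The factors of pairs inside \<open>T\<close> are merged into the kernel, and
  the remaining ones are grouped by variable.\<close>

lemma grid_split:
  fixes t v w :: "nat \<Rightarrow> complex" and z :: complex
  assumes n: "n = n0 + n1" and S: "S = {1..n0}" and T: "T = {n0+1..n}"
  defines "Q \<equiv> complex_of_real q"
  shows "(\<Prod>i=n0+1..n. t i * v i) *
      (\<Prod>i=n0+1..n. \<Prod>j=i+1..n. (t i - Q powi (- int k) * (t j * z)) * (t i - Q ^ (k + 1) * (t j * z))) *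
      (\<Prod>i=1..n. w i) * (\<Prod>i=1..n. \<Prod>j=i+1..n. pair_factor q k (t i) (t j * z)) * (\<Prod>i=1..n. t i)
    = (\<Prod>(i, j)\<in>pairs (S \<union> T). pair_factor q (pair_mult k T i j) (t i) (t j * z)) *
      (\<Prod>i\<in>S \<union> T. (t i * v i) ^ type_shift T i * (w i * t i))"
proof -
  have I: "{1..n} = S \<union> T" using n by (auto simp: S T)
  let ?g = "\<lambda>i j. (t i - Q powi (- int k) * (t j * z)) * (t i - Q ^ (k + 1) * (t j * z))"
  have "(\<Prod>i=n0+1..n. \<Prod>j=i+1..n. ?g i j) = (\<Prod>(i,j)\<in>pairs T. ?g i j)"
    unfolding T by (rule prod_pairs)
  also have "\<dots> = (\<Prod>(i,j)\<in>pairs {1..n}. if i \<in> T \<and> j \<in> T then ?g i j else 1)"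
    by (rule prod.mono_neutral_cong_left) (simp, auto simp: pairs_def T split: if_splits)
  finally have e1: "(\<Prod>i=n0+1..n. \<Prod>j=i+1..n. ?g i j) * (\<Prod>i=1..n. \<Prod>j=i+1..n. pair_factor q k (t i) (t j * z))
      = (\<Prod>(i, j)\<in>pairs (S \<union> T). pair_factor q (pair_mult k T i j) (t i) (t j * z))"
    unfolding prod_pairs I[symmetric]
    by (simp only: prod.distrib[symmetric])
      (intro prod.cong refl, auto simp: pair_mult_def pair_factor_Suc Q_def mult_ac)
  have e2: "(\<Prod>i=n0+1..n. t i * v i) = (\<Prod>i\<in>S \<union> T. (t i * v i) ^ type_shift T i)"
    by (rule prod.mono_neutral_cong_left) (auto simp: S T type_shift_def)
  have e3: "(\<Prod>i=1..n. w i) * (\<Prod>i=1..n. t i) = (\<Prod>i\<in>S \<union> T. w i * t i)"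
    unfolding I by (simp add: prod.distrib)
  have "a * b * c * d * e = b * d * (a * (c * e))" for a b c d e :: complex by (simp only: mult_ac)
  thus ?thesis unfolding e1[symmetric] prod.distrib[of "\<lambda>i. (t i * v i) ^ type_shift T i"] e2[symmetric] e3[symmetric] .
qed

lemma integrand_I_grid:
  fixes \<alpha> \<beta> :: complex and e :: "nat \<Rightarrow> nat"
  assumes "Re \<beta> > 0" and n: "n = n0 + n1"
  defines "Q \<equiv> complex_of_real q" and "S \<equiv> {1..n0}" and "T \<equiv> {n0+1..n}"
  defines "A \<equiv> Q powr \<alpha>" and "B \<equiv> Q powr \<beta>"
  shows "integrand_I q n0 n1 \<alpha> \<beta> k (\<lambda>i. q ^ e i) * complex_of_real (q ^ (\<Sum>i=1..n. e i))
    = pair_kernel q k S T (\<lambda>i. Q ^ e i) * (\<Prod>i\<in>S \<union> T. qpoch_inf q Q / qpoch_inf q B * (1 - B) ^ type_shift T i *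
       (A * Q ^ type_shift T i) ^ e i * (qpoch q (B * Q ^ type_shift T i) (e i) / qpoch q Q (e i)))"
proof -
  have Q0: "Q \<noteq> 0" "q \<noteq> 0" using q by (auto simp: Q_def)
  have nB: "norm B < 1" unfolding B_def Q_def by (rule norm_q_powr[OF assms(1)])
  define t where "t = (\<lambda>i. complex_of_real (q ^ e i))"
  have t: "t i = Q ^ e i" for i by (simp add: t_def Q_def)
  have t0: "t i \<noteq> 0" for i using Q0 by (simp add: t)
  define w where "w = (\<lambda>i. t i powr (\<alpha> - 1) * (qpoch_inf q (Q * t i) / qpoch_inf q (B * t i)))"
  have w: "w i * t i = A ^ e i * (qpoch_inf q Q / qpoch_inf q B * (qpoch q B (e i) / qpoch q Q (e i)))" for i
    unfolding w_def t A_def Q_def by (rule weighted_power[OF nB])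
  have pf: "t i ^ (2 * k) * qpoch q (Q powi (1 - int k) * (t j / t i)) (2 * k) = pair_factor q k (t i) (t j)" for i j
    unfolding Q_def by (rule pair_factor_qpoch[OF t0 Q0(2)])
  have "complex_of_real (q ^ (\<Sum>i=1..n. e i)) = (\<Prod>i=1..n. t i)" by (simp add: t power_sum Q_def)
  hence "integrand_I q n0 n1 \<alpha> \<beta> k (\<lambda>i. q ^ e i) * complex_of_real (q ^ (\<Sum>i=1..n. e i))
     = pair_kernel q k S T (\<lambda>i. Q ^ e i) * (\<Prod>i\<in>S \<union> T. (t i * (1 - B * t i)) ^ type_shift T i * (w i * t i))"
    using grid_split[OF n S_def[THEN meta_eq_to_obj_eq] T_def[THEN meta_eq_to_obj_eq], of t "\<lambda>i. 1 - B * t i" k 1 w]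
    unfolding integrand_I_def Let_def n[symmetric] Q_def[symmetric] B_def[symmetric] t_def[symmetric]
      w_def[symmetric] pf pair_kernel_def t[symmetric] by simp
  also have "(\<Prod>i\<in>S \<union> T. (t i * (1 - B * t i)) ^ type_shift T i * (w i * t i)) =
     (\<Prod>i\<in>S \<union> T. qpoch_inf q Q / qpoch_inf q B * (1 - B) ^ type_shift T i *
       (A * Q ^ type_shift T i) ^ e i * (qpoch q (B * Q ^ type_shift T i) (e i) / qpoch q Q (e i)))"
  proof (intro prod.cong refl)
    fix i
    have "qpoch q B (e i) * (1 - B * t i) = (1 - B) * qpoch q (B * Q) (e i)"
      using qpoch_Suc[of q B "e i"] qpoch_Suc_shift[of q B "e i"] by (simp add: t Q_def)
    hence h1: "(t i * (1 - B * t i)) * (w i * t i) = t i * A ^ e i * (qpoch_inf q Q / qpoch_inf q B) * ((1 - B) * qpoch q (B * Q) (e i)) / qpoch q Q (e i)"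
      unfolding w by (simp add: mult_ac)
    show "(t i * (1 - B * t i)) ^ type_shift T i * (w i * t i) = qpoch_inf q Q / qpoch_inf q B * (1 - B) ^ type_shift T i *
       (A * Q ^ type_shift T i) ^ e i * (qpoch q (B * Q ^ type_shift T i) (e i) / qpoch q Q (e i))"
    proof (cases "i \<in> T")
      case True
      hence r: "type_shift T i = 1" by (simp add: type_shift_def)
      show ?thesis unfolding r power_one_right h1 by (simp add: t power_mult_distrib mult_ac)
    next
      case False
      thus ?thesis using w[of i] by (simp add: type_shift_def mult_ac)
    qed
  qed
  finally show ?thesis .
qed

lemma integrand_II_grid:
  fixes \<alpha> \<beta> :: complex and e :: "nat \<Rightarrow> nat"
  assumes "Re \<beta> > 0" and n: "n = n0 + n1"
  defines "Q \<equiv> complex_of_real q" and "S \<equiv> {1..n0}" and "T \<equiv> {n0+1..n}"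
  defines "A \<equiv> Q powr \<alpha>" and "B \<equiv> Q powr \<beta>"
  shows "integrand_II q n0 n1 \<alpha> \<beta> k (\<lambda>i. q ^ e i) * complex_of_real (q ^ (\<Sum>i=1..n. e i))
    = pair_kernel' q k S T (\<lambda>i. Q ^ e i) * (\<Prod>i\<in>S \<union> T. qpoch_inf q Q / qpoch_inf q B * (1 - Q ^ e i) ^ type_shift T i *
       (A * Q ^ type_shift T i) ^ e i * (qpoch q B (e i) / qpoch q Q (e i)))"
proof -
  have Q0: "Q \<noteq> 0" "q \<noteq> 0" using q by (auto simp: Q_def)
  have nB: "norm B < 1" unfolding B_def Q_def by (rule norm_q_powr[OF assms(1)])
  define t where "t = (\<lambda>i. complex_of_real (q ^ e i))"
  have t: "t i = Q ^ e i" for i by (simp add: t_def Q_def)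
  have t0: "t i \<noteq> 0" for i using Q0 by (simp add: t)
  define w where "w = (\<lambda>i. t i powr (\<alpha> - 1) * (qpoch_inf q (Q * t i) / qpoch_inf q (B * t i)))"
  have w: "w i * t i = A ^ e i * (qpoch_inf q Q / qpoch_inf q B * (qpoch q B (e i) / qpoch q Q (e i)))" for i
    unfolding w_def t A_def Q_def by (rule weighted_power[OF nB])
  have pf: "t i ^ (2 * k) * qpoch q (Q powi (- int k) * (t j / t i)) (2 * k) = pair_factor q k (t i) (t j * inverse Q)" for i j
  proof -
    have "Q powi (- int k) * (t j / t i) = complex_of_real q powi (1 - int k) * (t j * inverse Q / t i)"
      using Q0 power_int_add[of Q "- int k" 1] by (simp add: Q_def field_simps)
    thus ?thesis by (simp only: pair_factor_qpoch[OF t0 Q0(2)])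
  qed
  have pQ: "Q powi (- int k - 1) * x = Q powi (- int k) * (x * inverse Q)" "Q ^ k * x = Q ^ (k + 1) * (x * inverse Q)" for x
    using Q0 power_int_add[of Q "- int k - 1" 1] by (simp_all add: field_simps)
  have K: "pair_kernel' q k S T t = (\<Prod>(i, j)\<in>pairs (S \<union> T). pair_factor q (pair_mult k T i j) (t i) (t j * inverse Q))"
    by (simp add: pair_kernel'_def Q_def divide_inverse)
  have "complex_of_real (q ^ (\<Sum>i=1..n. e i)) = (\<Prod>i=1..n. t i)" by (simp add: t power_sum Q_def)
  hence "integrand_II q n0 n1 \<alpha> \<beta> k (\<lambda>i. q ^ e i) * complex_of_real (q ^ (\<Sum>i=1..n. e i))
     = pair_kernel' q k S T (\<lambda>i. Q ^ e i) * (\<Prod>i\<in>S \<union> T. (t i * (1 - t i)) ^ type_shift T i * (w i * t i))"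
    using grid_split[OF n S_def[THEN meta_eq_to_obj_eq] T_def[THEN meta_eq_to_obj_eq], of t "\<lambda>i. 1 - t i" k "inverse Q" w]
    unfolding integrand_II_def Let_def n[symmetric] Q_def[symmetric] B_def[symmetric] t_def[symmetric]
      w_def[symmetric] pf pQ t[symmetric] K by (simp only:)
  also have "(\<Prod>i\<in>S \<union> T. (t i * (1 - t i)) ^ type_shift T i * (w i * t i)) =
     (\<Prod>i\<in>S \<union> T. qpoch_inf q Q / qpoch_inf q B * (1 - Q ^ e i) ^ type_shift T i *
       (A * Q ^ type_shift T i) ^ e i * (qpoch q B (e i) / qpoch q Q (e i)))"
  proof (intro prod.cong refl)
    fix i
    show "(t i * (1 - t i)) ^ type_shift T i * (w i * t i) = qpoch_inf q Q / qpoch_inf q B * (1 - Q ^ e i) ^ type_shift T i *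
       (A * Q ^ type_shift T i) ^ e i * (qpoch q B (e i) / qpoch q Q (e i))"
      unfolding w by (cases "i \<in> T") (simp_all add: type_shift_def t power_mult_distrib mult_ac)
  qed
  finally show ?thesis .
qed

lemma has_sum_integrand_I:
  fixes \<alpha> \<beta> :: complex
  assumes re: "Re \<alpha> > 0" "Re \<beta> > 0" and n: "n = n0 + n1"
  defines "Q \<equiv> complex_of_real q" and "S \<equiv> {1..n0}" and "T \<equiv> {n0+1..n}"
  defines "A \<equiv> Q powr \<alpha>" and "B \<equiv> Q powr \<beta>"
  shows "((\<lambda>e. integrand_I q n0 n1 \<alpha> \<beta> k (\<lambda>i. q ^ e i) * complex_of_real (q ^ (\<Sum>i=1..n. e i)))
     has_sum ((\<Prod>i\<in>S \<union> T. mass q T A B i) * moment_sum q k S T A (A * B))) (PiE {1..n} (\<lambda>_. UNIV))"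
proof -
  have I: "{1..n} = S \<union> T" using n by (auto simp: S_def T_def)
  have fin: "finite S" "finite T" "finite (S \<union> T)" by (auto simp: S_def T_def)
  have AB: "norm A < 1" "norm B < 1" unfolding A_def B_def Q_def by (auto intro: norm_q_powr re)
  let ?D = "multi_exps (S \<union> T) (kernel_deg k S T)"
  let ?cf = "mcoeff (\<lambda>e. Q ^ e) (S \<union> T) (pair_kernel q k S T)"
  define g where "g = (\<lambda>d i e. (Q ^ e) ^ d i * (qpoch_inf q Q / qpoch_inf q B * (1 - B) ^ type_shift T i *
       (A * Q ^ type_shift T i) ^ e * (qpoch q (B * Q ^ type_shift T i) e / qpoch q Q e)))"
  have hom: "homogeneous (\<lambda>e. Q ^ e) (S \<union> T) (kernel_deg k S T) (pair_kernel q k S T)"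
    unfolding Q_def using fin by (intro kernel_homogeneous inj_powers[OF q])
  have "((\<lambda>e. integrand_I q n0 n1 \<alpha> \<beta> k (\<lambda>i. q ^ e i) * complex_of_real (q ^ (\<Sum>i=1..n. e i)))
     has_sum (\<Sum>d\<in>?D. ?cf d * (\<Prod>i\<in>S \<union> T. mass q T A B i * type_moment q T A (A * B) i (d i)))) (PiE (S \<union> T) (\<lambda>_. UNIV))"
  proof (rule polynomial_grid_sum[where g' = g])
    fix e :: "nat \<Rightarrow> nat"
    have K: "pair_kernel q k S T (\<lambda>i. Q ^ e i) = (\<Sum>d\<in>?D. ?cf d * (\<Prod>i\<in>S \<union> T. (Q ^ e i) ^ d i))"
      using hom unfolding homogeneous_def by blast
    show "integrand_I q n0 n1 \<alpha> \<beta> k (\<lambda>i. q ^ e i) * complex_of_real (q ^ (\<Sum>i=1..n. e i))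
        = (\<Sum>d\<in>?D. ?cf d * (\<Prod>i\<in>S \<union> T. g d i (e i)))"
      unfolding integrand_I_grid[OF re(2) n, folded Q_def S_def T_def, folded A_def B_def] K sum_distrib_right g_def
      by (intro sum.cong refl) (simp only: prod.distrib mult.assoc A_def)
  next
    fix d i
    show "summable (\<lambda>e. norm (g d i e))" "g d i sums (mass q T A B i * type_moment q T A (A * B) i (d i))"
      unfolding g_def Q_def by (rule mass_moment[OF AB])+
  qed (use fin in auto)
  also have "(\<Sum>d\<in>?D. ?cf d * (\<Prod>i\<in>S \<union> T. mass q T A B i * type_moment q T A (A * B) i (d i)))
     = (\<Prod>i\<in>S \<union> T. mass q T A B i) * moment_sum q k S T A (A * B)"
    unfolding moment_sum_def Q_def sum_distrib_left by (intro sum.cong refl) (simp only: prod.distrib mult_ac)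
  finally show ?thesis unfolding I .
qed

end

section \<open>Reversal of the variables in both groups\<close>

definition reflect_index :: "nat \<Rightarrow> nat \<Rightarrow> nat \<Rightarrow> nat" where
  "reflect_index n0 n i = (if i \<le> n0 then n0 + 1 - i else n0 + 1 + n - i)"

lemma prod_pairs_Un:
  assumes "finite S" "finite T" "\<And>i j. i \<in> S \<Longrightarrow> j \<in> T \<Longrightarrow> i < j"
  shows "prod f (pairs (S \<union> T)) = prod f (pairs S) * prod f (pairs T) * (prod f (S \<times> T) :: complex)"
proof -
  have disj: "S \<inter> T = {}" using assms(3) by force
  have "pairs (S \<union> T) = pairs S \<union> pairs T \<union> S \<times> T"
    using assms(3) by (fastforce simp: pairs_def)
  moreover have "(pairs S \<union> pairs T) \<inter> S \<times> T = {}" "pairs S \<inter> pairs T = {}"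
    using disj by (auto simp: pairs_def)
  moreover have "finite (pairs S)" "finite (pairs T)" using assms by auto
  ultimately show ?thesis using assms(1,2) by (simp add: prod.union_disjoint)
qed

context
  fixes n0 n1 n :: nat and S T :: "nat set" and \<rho> :: "nat \<Rightarrow> nat"
  assumes n: "n = n0 + n1" and S: "S = {1..n0}" and T: "T = {n0+1..n}" and \<rho>: "\<rho> = reflect_index n0 n"
begin

lemma reflect_index_S: "i \<in> S \<Longrightarrow> \<rho> i \<in> S" and reflect_index_T: "i \<in> T \<Longrightarrow> \<rho> i \<in> T"
  and reflect_index_invol: "i \<in> S \<union> T \<Longrightarrow> \<rho> (\<rho> i) = i"
  by (auto simp: \<rho> S T reflect_index_def n)

lemma reflect_index_pairs:
  "p \<in> pairs S \<Longrightarrow> (\<rho> (snd p), \<rho> (fst p)) \<in> pairs S"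
  "p \<in> pairs T \<Longrightarrow> (\<rho> (snd p), \<rho> (fst p)) \<in> pairs T"
  by (auto simp: \<rho> S T reflect_index_def n pairs_def)

lemma prod_reflect_pairs:
  fixes f :: "nat \<Rightarrow> nat \<Rightarrow> complex"
  assumes "R = S \<or> R = T"
  shows "(\<Prod>(i,j)\<in>pairs R. f (\<rho> i) (\<rho> j)) = (\<Prod>(i,j)\<in>pairs R. f j i)"
proof (rule prod.reindex_bij_witness[of _ "\<lambda>p. (\<rho> (snd p), \<rho> (fst p))" "\<lambda>p. (\<rho> (snd p), \<rho> (fst p))"])
  fix p assume p: "p \<in> pairs R"
  hence m: "fst p \<in> S \<union> T" "snd p \<in> S \<union> T" using assms by (auto simp: pairs_def)
  show "(\<rho> (snd p), \<rho> (fst p)) \<in> pairs R" "(\<rho> (snd p), \<rho> (fst p)) \<in> pairs R"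
    using p assms reflect_index_pairs by auto
  show "(\<rho> (snd (\<rho> (snd p), \<rho> (fst p))), \<rho> (fst (\<rho> (snd p), \<rho> (fst p)))) = p"
    "(\<rho> (snd (\<rho> (snd p), \<rho> (fst p))), \<rho> (fst (\<rho> (snd p), \<rho> (fst p)))) = p"
    using m by (simp_all add: reflect_index_invol)
  show "(case (\<rho> (snd p), \<rho> (fst p)) of (i, j) \<Rightarrow> f j i) = (case p of (i, j) \<Rightarrow> f (\<rho> i) (\<rho> j))"
    by (simp add: case_prod_unfold)
qed

lemma prod_reflect: "(\<Prod>i\<in>S \<union> T. f (\<rho> i)) = (\<Prod>i\<in>S \<union> T. f i :: complex)"
  by (rule prod.reindex_bij_witness[of _ \<rho> \<rho>]) (use reflect_index_S reflect_index_T reflect_index_invol in auto)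

lemma type_shift_reflect: "i \<in> S \<union> T \<Longrightarrow> type_shift T (\<rho> i) = type_shift T i"
  by (auto simp: type_shift_def \<rho> S T reflect_index_def n)

text \<open>Reversal exchanges the arguments of the pairs inside a group, and by
  \<open>pair_factor_swap\<close> this compensates the division by \<open>q\<close>. A mixed pair
  keeps its order; there the division is achieved by scaling the second group by
  \<open>1 / q\<close>, at the cost of a power of \<open>q\<close> for the pairs inside
  \<open>T\<close>.\<close>

lemma pair_kernel'_reflect:
  assumes "q \<noteq> 0"
  defines "Q \<equiv> complex_of_real q"
  shows "Q ^ (k * (n0 choose 2)) * pair_kernel' q k S T t =
    Q ^ ((k + 1) * (n1 choose 2)) * pair_kernel q k S T (\<lambda>i. t (\<rho> i) / Q ^ type_shift T i)"
proof -
  have Q0: "Q \<noteq> 0" using assms by simp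
  have fin: "finite S" "finite T" by (auto simp: S T)
  have lt: "i < j" if "i \<in> S" "j \<in> T" for i j using that by (auto simp: S T)
  have nT: "i \<notin> T" if "i \<in> S" for i using that by (auto simp: S T)
  define u where "u = (\<lambda>i. t (\<rho> i) / Q ^ type_shift T i)"
  have uS: "u i = t (\<rho> i)" if "i \<in> S" for i using nT[OF that] by (simp add: u_def type_shift_def)
  have uT: "u i = inverse Q * t (\<rho> i)" if "i \<in> T" for i using that by (simp add: u_def type_shift_def field_simps)
  let ?f = "\<lambda>(i, j). pair_factor q (pair_mult k T i j) (t i) (t j / Q)"
  let ?g = "\<lambda>(i, j). pair_factor q (pair_mult k T i j) (u i) (u j)"
  have cS: "card (pairs S) = n0 choose 2" and cT: "card (pairs T) = n1 choose 2"
    by (auto simp: card_pairs S T n)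
  have 1: "prod ?g (pairs S) = Q ^ (k * (n0 choose 2)) * prod ?f (pairs S)"
  proof -
    have "prod ?g (pairs S) = (\<Prod>(i,j)\<in>pairs S. pair_factor q k (t (\<rho> i)) (t (\<rho> j)))"
      by (intro prod.cong refl) (auto simp: pairs_def uS pair_mult_def nT)
    also have "\<dots> = (\<Prod>(i,j)\<in>pairs S. pair_factor q k (t j) (t i))"
      by (rule prod_reflect_pairs[of S "\<lambda>i j. pair_factor q k (t i) (t j)"]) simp
    also have "\<dots> = (\<Prod>p\<in>pairs S. Q ^ k * ?f p)"
      by (intro prod.cong refl) (auto simp: pairs_def pair_mult_def nT Q_def pair_factor_swap[OF assms(1)])
    finally show ?thesis by (simp add: prod.distrib cS power_mult)
  qed
  have 2: "Q ^ ((k + 1) * (n1 choose 2)) * prod ?g (pairs T) = prod ?f (pairs T)"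
  proof -
    have "prod ?g (pairs T) = (\<Prod>(i,j)\<in>pairs T. inverse Q ^ (2 * (k + 1)) * pair_factor q (k + 1) (t (\<rho> i)) (t (\<rho> j)))"
      by (intro prod.cong refl) (auto simp: pairs_def uT pair_mult_def pair_factor_scale simp del: mult_Suc_right)
    also have "\<dots> = (\<Prod>(i,j)\<in>pairs T. inverse Q ^ (2 * (k + 1)) * pair_factor q (k + 1) (t j) (t i))"
      by (rule prod_reflect_pairs[of T "\<lambda>i j. inverse Q ^ (2 * (k + 1)) * pair_factor q (k + 1) (t i) (t j)"]) simp
    also have "\<dots> = (\<Prod>p\<in>pairs T. inverse (Q ^ (k + 1)) * ?f p)"
    proof (intro prod.cong refl, clarify)
      fix i j assume "(i, j) \<in> pairs T"
      hence m: "pair_mult k T i j = k + 1" by (auto simp: pairs_def pair_mult_def)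
      have "inverse Q ^ (2 * (k + 1)) * Q ^ (k + 1) = inverse (Q ^ (k + 1))"
        using Q0 by (simp only: mult_2 power_add power_inverse) (simp add: field_simps)
      thus "inverse Q ^ (2 * (k + 1)) * pair_factor q (k + 1) (t j) (t i) = inverse (Q ^ (k + 1)) * pair_factor q (pair_mult k T i j) (t i) (t j / Q)"
        unfolding m pair_factor_swap[OF assms(1), of "k + 1" "t i" "t j", symmetric] Q_def by (simp only: mult.assoc[symmetric])
    qed
    also have "\<dots> = inverse (Q ^ ((k + 1) * (n1 choose 2))) * prod ?f (pairs T)"
      by (simp only: prod.distrib prod_constant cT power_mult power_inverse)
    finally show ?thesis using Q0 by simp
  qed
  have 3: "prod ?g (S \<times> T) = prod ?f (S \<times> T)"
  proof (rule prod.reindex_bij_witness[of _ "\<lambda>(i, j). (\<rho> i, \<rho> j)" "\<lambda>(i, j). (\<rho> i, \<rho> j)"])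
    fix p assume p: "p \<in> S \<times> T"
    show "?f ((\<lambda>(i, j). (\<rho> i, \<rho> j)) p) = ?g p"
      using p reflect_index_S reflect_index_T nT by (auto simp: uS uT pair_mult_def field_simps)
  qed (use reflect_index_S reflect_index_T reflect_index_invol in auto)
  have "pair_kernel' q k S T t = prod ?f (pairs S) * prod ?f (pairs T) * prod ?f (S \<times> T)"
    unfolding pair_kernel'_def Q_def[symmetric] by (rule prod_pairs_Un[OF fin lt])
  moreover have "pair_kernel q k S T u = prod ?g (pairs S) * prod ?g (pairs T) * prod ?g (S \<times> T)"
    unfolding pair_kernel_def by (rule prod_pairs_Un[OF fin lt])
  ultimately show ?thesis unfolding u_def[symmetric] 1 3 2[symmetric] by (simp only: mult_ac)
qed

lemma has_sum_integrand_II: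
  fixes q :: real and \<alpha> \<beta> :: complex
  assumes q: "0 < q" "q < 1" and re: "Re \<alpha> > 0" "Re \<beta> > 0"
  defines "Q \<equiv> complex_of_real q"
  defines "A \<equiv> Q powr \<alpha>" and "B \<equiv> Q powr \<beta>"
  shows "((\<lambda>e. integrand_II q n0 n1 \<alpha> \<beta> k (\<lambda>i. q ^ e i) * complex_of_real (q ^ (\<Sum>i=1..n. e i)))
     has_sum (Q ^ ((k + 1) * (n1 choose 2)) / Q ^ (k * (n0 choose 2)) * (A * Q) ^ n1 *
       ((\<Prod>i\<in>S \<union> T. mass q T A B i) * moment_sum q k S T A (A * B)))) (PiE {1..n} (\<lambda>_. UNIV))"
proof -
  have Q0: "Q \<noteq> 0" using q by (simp add: Q_def)
  have I: "{1..n} = S \<union> T" using n by (auto simp: S T)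
  have fin: "finite S" "finite T" "finite (S \<union> T)" by (auto simp: S T)
  have AB: "norm A < 1" "norm B < 1" unfolding A_def B_def Q_def by (auto intro: norm_q_powr[OF q] re)
  let ?D = "multi_exps (S \<union> T) (kernel_deg k S T)"
  let ?cf = "mcoeff (\<lambda>e. Q ^ e) (S \<union> T) (pair_kernel q k S T)"
  define Z where "Z = Q ^ ((k + 1) * (n1 choose 2)) / Q ^ (k * (n0 choose 2))"
  define g where "g = (\<lambda>d i e. (Q ^ e) ^ d (\<rho> i) * (qpoch_inf q Q / qpoch_inf q B * (1 - Q ^ e) ^ type_shift T i *
       (A * Q ^ type_shift T i) ^ e * (qpoch q B e / qpoch q Q e)))"
  define s where "s = (\<lambda>d i. (A * Q * Q ^ d) ^ type_shift T i * mass q T A B i * type_moment q T A (A * B) i d)"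
  have hom: "homogeneous (\<lambda>e. Q ^ e) (S \<union> T) (kernel_deg k S T) (pair_kernel q k S T)"
    unfolding Q_def using fin by (intro kernel_homogeneous inj_powers[OF q])
  have "((\<lambda>e. integrand_II q n0 n1 \<alpha> \<beta> k (\<lambda>i. q ^ e i) * complex_of_real (q ^ (\<Sum>i=1..n. e i)))
     has_sum (\<Sum>d\<in>?D. Z * ?cf d / (\<Prod>i\<in>S \<union> T. (Q ^ type_shift T i) ^ d i) * (\<Prod>i\<in>S \<union> T. s (d (\<rho> i)) i))) (PiE (S \<union> T) (\<lambda>_. UNIV))"
  proof (rule polynomial_grid_sum[where g' = g])
    fix e :: "nat \<Rightarrow> nat"
    have "pair_kernel q k S T (\<lambda>i. Q ^ e (\<rho> i) / Q ^ type_shift T i) =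
      (\<Sum>d\<in>?D. ?cf d * (\<Prod>i\<in>S \<union> T. (Q ^ e (\<rho> i) / Q ^ type_shift T i) ^ d i))"
      using hom unfolding homogeneous_def by blast
    moreover have "pair_kernel' q k S T (\<lambda>i. Q ^ e i) = Z * pair_kernel q k S T (\<lambda>i. Q ^ e (\<rho> i) / Q ^ type_shift T i)"
      using pair_kernel'_reflect[of q k "\<lambda>i. Q ^ e i"] q Q0 unfolding Z_def Q_def[symmetric] by (simp add: field_simps)
    ultimately have K: "pair_kernel' q k S T (\<lambda>i. Q ^ e i) =
      (\<Sum>d\<in>?D. Z * ?cf d / (\<Prod>i\<in>S \<union> T. (Q ^ type_shift T i) ^ d i) * (\<Prod>i\<in>S \<union> T. (Q ^ e (\<rho> i)) ^ d i))"
      by (simp add: sum_distrib_left power_divide prod_dividef mult.assoc)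
    have R: "(\<Prod>i\<in>S \<union> T. (Q ^ e (\<rho> i)) ^ d i) = (\<Prod>i\<in>S \<union> T. (Q ^ e i) ^ d (\<rho> i))" for d
    proof -
      have "(\<Prod>i\<in>S \<union> T. (Q ^ e i) ^ d (\<rho> i)) = (\<Prod>i\<in>S \<union> T. (Q ^ e (\<rho> i)) ^ d (\<rho> (\<rho> i)))"
        using prod_reflect[of "\<lambda>i. (Q ^ e i) ^ d (\<rho> i)"] by simp
      thus ?thesis using reflect_index_invol by simp
    qed
    show "integrand_II q n0 n1 \<alpha> \<beta> k (\<lambda>i. q ^ e i) * complex_of_real (q ^ (\<Sum>i=1..n. e i))
        = (\<Sum>d\<in>?D. Z * ?cf d / (\<Prod>i\<in>S \<union> T. (Q ^ type_shift T i) ^ d i) * (\<Prod>i\<in>S \<union> T. g d i (e i)))"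
      unfolding integrand_II_grid[OF q re(2) n, folded Q_def, folded S T, folded B_def] K R sum_distrib_right g_def
      by (intro sum.cong refl) (simp only: prod.distrib mult.assoc A_def)
  next
    fix d i
    show "summable (\<lambda>e. norm (g d i e))" "g d i sums s (d (\<rho> i)) i"
      unfolding g_def Q_def s_def by (rule mass_moment'[OF q AB])+
  qed (use fin in auto)
  also have "(\<Sum>d\<in>?D. Z * ?cf d / (\<Prod>i\<in>S \<union> T. (Q ^ type_shift T i) ^ d i) * (\<Prod>i\<in>S \<union> T. s (d (\<rho> i)) i))
     = Z * (A * Q) ^ n1 * ((\<Prod>i\<in>S \<union> T. mass q T A B i) * moment_sum q k S T A (A * B))"
    unfolding moment_sum_def Q_def[symmetric] sum_distrib_left
  proof (intro sum.cong refl)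
    fix d
    have sr: "s (d (\<rho> i)) i = s (d (\<rho> i)) (\<rho> i)" if "i \<in> S \<union> T" for i
      unfolding s_def mass_def type_moment_def type_shift_reflect[OF that] ..
    have "(\<Prod>i\<in>S \<union> T. s (d (\<rho> i)) i) = (\<Prod>i\<in>S \<union> T. s (d (\<rho> i)) (\<rho> i))"
      by (intro prod.cong refl sr)
    also have "\<dots> = (\<Prod>i\<in>S \<union> T. s (d i) i)" by (rule prod_reflect)
    \<comment> \<open>The index shift in \<open>mass_moment'\<close> produces \<open>q\<close> to
      the degree of each second type variable. This is cancelled by the scaling of the same
      variables in the reflected kernel, so only \<open>A q\<close> per variable remains.\<close>
    also have "\<dots> = (\<Prod>i\<in>S \<union> T. (A * Q) ^ type_shift T i) * (\<Prod>i\<in>S \<union> T. (Q ^ type_shift T i) ^ d i) *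
        ((\<Prod>i\<in>S \<union> T. mass q T A B i) * (\<Prod>i\<in>S \<union> T. type_moment q T A (A * B) i (d i)))"
      unfolding s_def prod.distrib[symmetric]
      by (intro prod.cong refl) (simp add: power_mult_distrib power_mult[symmetric] mult_ac)
    also have "(\<Prod>i\<in>S \<union> T. (A * Q) ^ type_shift T i) = (A * Q) ^ n1"
    proof -
      have "(\<Sum>i\<in>S \<union> T. type_shift T i) = (\<Sum>i\<in>T. 1)"
        by (rule sum.mono_neutral_cong_right) (auto simp: S T type_shift_def)
      thus ?thesis by (simp add: power_sum[symmetric] T n)
    qed
    finally show "Z * ?cf d / (\<Prod>i\<in>S \<union> T. (Q ^ type_shift T i) ^ d i) * (\<Prod>i\<in>S \<union> T. s (d (\<rho> i)) i)
      = Z * (A * Q) ^ n1 * ((\<Prod>i\<in>S \<union> T. mass q T A B i) * (?cf d * (\<Prod>i\<in>S \<union> T. type_moment q T A (A * B) i (d i))))"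
      using Q0 fin by (simp add: prod_zero_iff)
  qed
  finally show ?thesis unfolding I Z_def .
qed

end

subsection \<open>Gamma functions\<close>

lemma prod_power_int:
  fixes h :: complex
  assumes "h \<noteq> 0" "finite J"
  shows "(\<Prod>j\<in>J. h powi f j) = h powi (\<Sum>j\<in>J. f j)"
  using assms(2) by (induction J rule: finite_induct) (simp_all add: power_int_add assms(1))

context
  fixes q :: real
  assumes q: "0 < q" "q < 1"
begin

lemma qGamma_1: "qGamma q 1 = 1"
proof -
  have "complex_of_real (1 - q) powr (1 - 1) = 1" using q by (simp del: of_real_diff)
  thus ?thesis using qpoch_inf_nonzero[OF q norm_q[OF q]] Q_nonzero[OF q] by (simp add: qGamma_def)
qed

lemma qGamma_add:
  assumes "Re x > 0"
  shows "qGamma q (x + of_nat m) = qGamma q x * qpoch q (complex_of_real q powr x) m * complex_of_real (1 - q) powi (- int m)"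
proof -
  let ?Q = "complex_of_real q" and ?h = "complex_of_real (1 - q)"
  have h0: "?h \<noteq> 0" using q by (simp del: of_real_diff)
  have Q0: "?Q \<noteq> 0" using q by simp
  have e: "?Q powr (x + of_nat m) = ?Q powr x * ?Q ^ m"
    using Q0 by (simp add: powr_add powr_nat')
  have h: "?h powr (1 - (x + of_nat m)) = ?h powr (1 - x) * ?h powi (- int m)"
  proof -
    have "?h powr (1 - (x + of_nat m)) = ?h powr (1 - x - of_nat m)" by (simp add: algebra_simps)
    also have "\<dots> = ?h powr (1 - x) / ?h ^ m"
      using h0 by (subst powr_diff) (simp add: powr_nat')
    finally show ?thesis by (simp only: power_int_minus power_int_of_nat divide_inverse)
  qed
  have "qpoch q (?Q powr x) m \<noteq> 0" by (rule qpoch_nonzero[OF q norm_q_powr[OF q assms]])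
  thus ?thesis unfolding qGamma_def e h using qpoch_inf_split[OF q, of "?Q powr x" m] by simp
qed

lemma qGamma_Suc:
  "qGamma q (1 + of_nat m) = qpoch q (complex_of_real q) m * complex_of_real (1 - q) powi (- int m)"
  using qGamma_add[of 1 m] q by (simp add: qGamma_1)

lemma qGamma_nonzero: "Re x > 0 \<Longrightarrow> qGamma q x \<noteq> 0"
  using q qpoch_inf_nonzero[OF q norm_q[OF q]] qpoch_inf_nonzero[OF q norm_q_powr[OF q]]
  unfolding qGamma_def by (simp del: of_real_diff)

text \<open>For the first type this is the q-beta integral. For the second type both parameters are
  raised by one, which multiplies the beta value by
  \<open>(1 - A) (1 - B) / (A B)_2\<close>.\<close>

lemma mass_qGamma:
  fixes \<alpha> \<beta> :: complex
  assumes re: "Re \<alpha> > 0" "Re \<beta> > 0"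
  defines "Q \<equiv> complex_of_real q"
  defines "A \<equiv> Q powr \<alpha>" and "B \<equiv> Q powr \<beta>"
  shows "complex_of_real (1 - q) * mass q T A B i =
    qGamma q \<alpha> * qGamma q \<beta> / qGamma q (\<alpha> + \<beta>) * ((1 - A) * (1 - B) / qpoch q (A * B) 2) ^ type_shift T i"
proof -
  let ?h = "complex_of_real (1 - q)"
  have h0: "?h \<noteq> 0" using q by (simp del: of_real_diff)
  have Q0: "Q \<noteq> 0" using q by (simp add: Q_def)
  have AB: "norm A < 1" "norm B < 1" unfolding A_def B_def Q_def by (auto intro: norm_q_powr[OF q] re)
  have c: "A * B = Q powr (\<alpha> + \<beta>)" unfolding A_def B_def using Q0 by (simp add: powr_add)
  have nc: "norm (A * B) < 1" unfolding c Q_def by (rule norm_q_powr[OF q]) (use re in simp)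
  have hp: "?h powr (1 - \<alpha>) * ?h powr (1 - \<beta>) = ?h powr (1 - (\<alpha> + \<beta>)) * ?h"
  proof -
    have "?h powr (1 - \<alpha>) * ?h powr (1 - \<beta>) = ?h powr (1 - (\<alpha> + \<beta>)) * ?h powr 1"
      unfolding powr_add[symmetric] by (simp add: algebra_simps)
    thus ?thesis using h0 by (simp del: of_real_diff)
  qed
  have nz: "qpoch_inf q A \<noteq> 0" "qpoch_inf q B \<noteq> 0" "qpoch_inf q (A * B) \<noteq> 0" "qpoch_inf q Q \<noteq> 0"
    "?h powr (1 - (\<alpha> + \<beta>)) \<noteq> 0" "1 - A \<noteq> 0" "1 - B \<noteq> 0" "qpoch q (A * B) 2 \<noteq> 0"
    using AB nc h0 norm_q[OF q] by (auto simp: Q_def intro!: qpoch_inf_nonzero[OF q] qpoch_nonzero[OF q])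
  have "qGamma q \<alpha> * qGamma q \<beta> / qGamma q (\<alpha> + \<beta>) =
      (qpoch_inf q Q * qpoch_inf q (A * B) / (qpoch_inf q A * qpoch_inf q B)) *
      (?h powr (1 - \<alpha>) * ?h powr (1 - \<beta>) / ?h powr (1 - (\<alpha> + \<beta>)))"
    unfolding qGamma_def Q_def[symmetric] A_def[symmetric] B_def[symmetric] c[symmetric] using nz by (simp add: field_simps)
  also have "?h powr (1 - \<alpha>) * ?h powr (1 - \<beta>) / ?h powr (1 - (\<alpha> + \<beta>)) = ?h"
    unfolding hp using nz by simp
  finally have G: "qGamma q \<alpha> * qGamma q \<beta> / qGamma q (\<alpha> + \<beta>) =
      qpoch_inf q Q * qpoch_inf q (A * B) / (qpoch_inf q A * qpoch_inf q B) * ?h" .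
  show ?thesis
  proof (cases "i \<in> T")
    case False
    thus ?thesis unfolding G mass_def Let_def Q_def[symmetric] by (simp add: type_shift_def mult_ac)
  next
    case True
    have 1: "qpoch_inf q A = (1 - A) * qpoch_inf q (A * Q)"
      using qpoch_inf_split[OF q, of A 1] by (simp add: qpoch_def Q_def)
    have 2: "qpoch_inf q (A * B) = qpoch q (A * B) 2 * qpoch_inf q (A * B * Q ^ 2)"
      using qpoch_inf_split[OF q, of "A * B" 2] by (simp add: Q_def)
    have r: "type_shift T i = 1" using True by (simp add: type_shift_def)
    have "qpoch_inf q (A * Q) \<noteq> 0" using nz 1 by auto
    moreover have "h * (a / b * y * x / z) = a * (p * x) / (w * z * b) * h * (w * y / p)"
      if "p \<noteq> 0" "w \<noteq> 0" for h a b y x z p w :: complex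
      using that by (simp add: mult_ac)
    ultimately show ?thesis
      using nz(6,8) unfolding G mass_def Let_def Q_def[symmetric] 1 2 r power_one_right mult_1_right by blast
  qed
qed

end

lemma sum_linear_int: "2 * (\<Sum>v<m. a + b * int v) = 2 * a * int m + b * (int m * (int m - 1))"
  by (induction m) (simp_all add: algebra_simps)

lemma prod_1_to: "(\<Prod>i=1..m. f i) = (\<Prod>u<m. f (Suc u) :: complex)"
  using prod.atLeast1_atMost_eq[of f m] by simp

context
  fixes q :: real and \<alpha> \<beta> :: complex and k n0 n1 :: nat
  assumes q: "0 < q" "q < 1" and re: "Re \<alpha> > 0" "Re \<beta> > 0"
begin

text \<open>For \<open>n0 = 0\<close> the factors \<open>j = 2\<close>, ..., \<open>n1\<close> of
  numerator and denominator are the same and cancel, which leaves the separate equation of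
  \<open>const_c\<close> at 0. For \<open>n0 > 0\<close> all factors are kept. The exponent
  \<open>E\<close> of \<open>1 - q\<close> is described by its double to avoid a division; both
  cases yield the same formula for it.\<close>

lemma gamma_tail:
  fixes N0 K :: complex
  assumes "n1 \<ge> 1"
  defines "p \<equiv> qpoch q (complex_of_real q powr (\<alpha> + \<beta>))"
  defines "N0 \<equiv> of_nat n0" and "K \<equiv> of_nat k" and "j0 \<equiv> (if n0 = 0 then 2 else 1)"
  shows "\<exists>E. 2 * E = (4 + 6 * int n0 * int k) * int n1 + 3 * (int k + 1) * (int n1 * (int n1 - 1)) \<and>
    (\<Prod>j=j0..n1. qGamma q (\<alpha> + \<beta> + of_nat j + (N0 + of_nat j - 2) * K)) *
    (\<Prod>j=j0..2*n1. inverse (qGamma q (\<alpha> + \<beta> + of_nat j + (2 * N0 + of_nat j - 2) * K)))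
    = const_c q k n1 (complex_of_real q powr (\<alpha> + \<beta>)) n0 / p 2 ^ n1 * (\<Prod>u<n0. p ((n0 + u - 1) * k)) /
       qGamma q (\<alpha> + \<beta>) ^ n1 * complex_of_real (1 - q) powi E"
proof -
  let ?\<gamma> = "\<alpha> + \<beta>" and ?h = "complex_of_real (1 - q)"
  let ?G = "qGamma q ?\<gamma>"
  have h0: "?h \<noteq> 0" using q by (simp del: of_real_diff)
  have re\<gamma>: "Re ?\<gamma> > 0" using re by simp
  have p0: "p m \<noteq> 0" for m unfolding p_def by (rule qpoch_nonzero[OF q norm_q_powr[OF q re\<gamma>]])
  have G0: "?G \<noteq> 0" by (rule qGamma_nonzero[OF q re\<gamma>])
  have gm: "qGamma q (?\<gamma> + of_nat m) = ?G * p m * ?h powi (- int m)" for m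
    unfolding p_def by (rule qGamma_add[OF q re\<gamma>])
  have gmi: "inverse (qGamma q (?\<gamma> + of_nat m)) = inverse ?G * inverse (p m) * ?h powi int m" for m
    unfolding gm by (simp add: power_int_minus)
  show ?thesis
  proof (cases n0)
    case 0
    define m where "m = (\<lambda>v. n1 + v + 1 + (n1 + v - 1) * k)"
    define E where "E = (\<Sum>v<n1. int (m v))"
    have "int (m v) = (int n1 + 1 + (int n1 - 1) * int k) + (1 + int k) * int v" if "v < n1" for v
      using assms(1) unfolding m_def by (cases n1) (simp_all add: algebra_simps)
    hence "E = (\<Sum>v<n1. (int n1 + 1 + (int n1 - 1) * int k) + (1 + int k) * int v)"
      unfolding E_def by (intro sum.cong) auto
    hence E: "2 * E = (4 + 6 * int n0 * int k) * int n1 + 3 * (int k + 1) * (int n1 * (int n1 - 1))"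
      unfolding 0 by (simp only: sum_linear_int) (simp add: algebra_simps)
    have split: "{2..2*n1} = {2..n1} \<union> {n1+1..2*n1}" "{2..n1} \<inter> {n1+1..2*n1} = {}"
      using assms(1) by auto
    have nzj: "qGamma q (?\<gamma> + of_nat j + (of_nat j - 2) * K) \<noteq> 0" if "j \<ge> 2" for j
    proof -
      have "?\<gamma> + of_nat j + (of_nat j - 2) * K = ?\<gamma> + of_nat (j + (j - 2) * k)"
        using that by (simp add: of_nat_diff K_def)
      thus ?thesis using re by (simp only:) (rule qGamma_nonzero[OF q], simp add: add_pos_nonneg)
    qed
    have "(\<Prod>j=j0..n1. qGamma q (?\<gamma> + of_nat j + (N0 + of_nat j - 2) * K)) *
      (\<Prod>j=j0..2*n1. inverse (qGamma q (?\<gamma> + of_nat j + (2 * N0 + of_nat j - 2) * K)))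
      = (\<Prod>j=2..n1. qGamma q (?\<gamma> + of_nat j + (of_nat j - 2) * K)) *
      ((\<Prod>j=2..n1. inverse (qGamma q (?\<gamma> + of_nat j + (of_nat j - 2) * K))) *
       (\<Prod>j=n1+1..2*n1. inverse (qGamma q (?\<gamma> + of_nat j + (of_nat j - 2) * K))))"
    proof -
      have j0: "j0 = 2" by (simp add: j0_def 0)
      have N: "N0 = 0" by (simp add: N0_def 0)
      show ?thesis unfolding j0 N split(1) by (subst prod.union_disjoint) (use split(2) in auto)
    qed
    also have "\<dots> = (\<Prod>j=n1+1..2*n1. inverse (qGamma q (?\<gamma> + of_nat j + (of_nat j - 2) * K)))"
    proof -
      have "(\<Prod>j=2..n1. qGamma q (?\<gamma> + of_nat j + (of_nat j - 2) * K)) *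
        (\<Prod>j=2..n1. inverse (qGamma q (?\<gamma> + of_nat j + (of_nat j - 2) * K))) = 1"
        unfolding prod.distrib[symmetric] by (rule prod.neutral) (use nzj in auto)
      thus ?thesis by (simp add: mult.assoc[symmetric])
    qed
    also have "\<dots> = (\<Prod>v<n1. inverse (qGamma q (?\<gamma> + of_nat (m v))))"
    proof (rule prod.reindex_bij_witness[of _ "\<lambda>v. n1 + 1 + v" "\<lambda>j. j - (n1 + 1)"])
      fix j assume j: "j \<in> {n1+1..2*n1}"
      have "n1 + (j - (n1 + 1)) + 1 = j" "n1 + (j - (n1 + 1)) - 1 = j - 2" using j assms(1) by auto
      hence "m (j - (n1 + 1)) = j + (j - 2) * k" unfolding m_def by simp
      moreover have "complex_of_nat (j - 2) = of_nat j - 2" using j assms(1) by (simp add: of_nat_diff)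
      ultimately show "inverse (qGamma q (?\<gamma> + of_nat (m (j - (n1 + 1))))) = inverse (qGamma q (?\<gamma> + of_nat j + (of_nat j - 2) * K))"
        by (simp add: K_def add.assoc)
    qed auto
    also have "\<dots> = inverse ?G ^ n1 * (\<Prod>v<n1. inverse (p (m v))) * ?h powi E"
      unfolding gmi prod.distrib prod_power_int[OF h0 finite_lessThan] E_def by simp
    also have "\<dots> = const_c q k n1 (complex_of_real q powr ?\<gamma>) n0 / p 2 ^ n1 * (\<Prod>u<n0. p ((n0 + u - 1) * k)) / ?G ^ n1 * ?h powi E"
      unfolding 0 const_c.simps p_def[symmetric] m_def using p0[of 2]
      by (simp add: prod_dividef divide_inverse prod_inversef power_inverse prod.distrib)
    finally show ?thesis using E by blast
  next
    case (Suc a)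
    define m where "m = (\<lambda>v. v + 1 + (a + v) * k)"
    define m' where "m' = (\<lambda>v. v + 1 + (2 * a + 1 + v) * k)"
    define E where "E = (\<Sum>v<n1. - int (m v)) + (\<Sum>v<2*n1. int (m' v))"
    have "- int (m v) = (- 1 - int a * int k) + (- 1 - int k) * int v" for v
      by (simp add: m_def algebra_simps)
    hence e1: "(\<Sum>v<n1. - int (m v)) = (\<Sum>v<n1. (- 1 - int a * int k) + (- 1 - int k) * int v)" by simp
    have "int (m' v) = (1 + (2 * int a + 1) * int k) + (1 + int k) * int v" for v
      by (simp add: m'_def algebra_simps)
    hence e2: "(\<Sum>v<2*n1. int (m' v)) = (\<Sum>v<2*n1. (1 + (2 * int a + 1) * int k) + (1 + int k) * int v)" by simp
    have E: "2 * E = (4 + 6 * int n0 * int k) * int n1 + 3 * (int k + 1) * (int n1 * (int n1 - 1))"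
      unfolding E_def e1 e2 distrib_left[of 2] sum_linear_int Suc by (simp add: algebra_simps)
    have "(\<Prod>j=j0..n1. qGamma q (?\<gamma> + of_nat j + (N0 + of_nat j - 2) * K)) *
      (\<Prod>j=j0..2*n1. inverse (qGamma q (?\<gamma> + of_nat j + (2 * N0 + of_nat j - 2) * K)))
      = (\<Prod>v<n1. qGamma q (?\<gamma> + of_nat (m v))) * (\<Prod>v<2*n1. inverse (qGamma q (?\<gamma> + of_nat (m' v))))"
    proof -
      have j0: "j0 = 1" by (simp add: j0_def Suc)
      have x1: "?\<gamma> + of_nat (Suc v) + (N0 + of_nat (Suc v) - 2) * K = ?\<gamma> + of_nat (m v)" for v
        by (simp add: m_def N0_def Suc K_def algebra_simps)
      have x2: "?\<gamma> + of_nat (Suc v) + (2 * N0 + of_nat (Suc v) - 2) * K = ?\<gamma> + of_nat (m' v)" for v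
        by (simp add: m'_def N0_def Suc K_def algebra_simps)
      show ?thesis unfolding j0 prod_1_to x1 x2 ..
    qed
    also have "\<dots> = ?G ^ n1 * (\<Prod>v<n1. p (m v)) * (inverse ?G ^ (2 * n1) * (\<Prod>v<2*n1. inverse (p (m' v)))) * ?h powi E"
      unfolding gmi unfolding gm prod.distrib prod_power_int[OF h0 finite_lessThan] E_def
      using h0 by (simp add: power_int_add del: of_real_diff)
    also have "?G ^ n1 * (\<Prod>v<n1. p (m v)) * (inverse ?G ^ (2 * n1) * (\<Prod>v<2*n1. inverse (p (m' v))))
       = (\<Prod>v<n1. p (m v)) / (\<Prod>v<2*n1. p (m' v)) / ?G ^ n1"
    proof -
      have "(\<Prod>v<2*n1. inverse (p (m' v))) = inverse (\<Prod>v<2*n1. p (m' v))"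
        using prod_inversef[of "\<lambda>v. p (m' v)" "{..<2*n1}"] by (simp add: o_def)
      moreover have "g ^ n1 * x * (inverse g ^ (2 * n1) * inverse y) = x / y / g ^ n1" if "g \<noteq> 0" for x y g :: complex
        using that by (simp add: mult_2 power_add divide_inverse power_inverse)
      ultimately show ?thesis using G0 by simp
    qed
    also have "\<dots> = const_c q k n1 (complex_of_real q powr ?\<gamma>) n0 / p 2 ^ n1 * (\<Prod>u<n0. p ((n0 + u - 1) * k)) / ?G ^ n1"
    proof -
      have "(\<Prod>u<n0. p ((n0 + u - 1) * k)) = (\<Prod>i<Suc a. p ((a + i) * k))" by (simp add: Suc)
      moreover have "(\<Prod>i<Suc a. p ((a + i) * k)) \<noteq> 0" using p0 by (auto simp: prod_zero_iff)
      ultimately show ?thesis unfolding Suc const_c.simps p_def[symmetric] m_def m'_def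
        using p0[of 2] by (simp del: prod.lessThan_Suc)
    qed
    finally show ?thesis using E by blast
  qed
qed

text \<open>Every argument is \<open>\<alpha>\<close>, \<open>\<beta>\<close>,
  \<open>\<alpha> + \<beta>\<close> or 1 plus a natural number. Each \<open>qGamma\<close> thus
  reduces to its value at the starting point, a finite product and a power of \<open>1 - q\<close>,
  and the powers cancel altogether.\<close>

lemma gamma_product_closed:
  assumes n1: "n1 \<ge> 1"
  defines "Q \<equiv> complex_of_real q"
  defines "A \<equiv> Q powr \<alpha>" and "B \<equiv> Q powr \<beta>"
  shows "(qGamma q \<alpha> * qGamma q \<beta> / qGamma q (\<alpha> + \<beta>)) ^ (n0 + n1) * ((1 - A) * (1 - B) / qpoch q (A * B) 2) ^ n1 *
     (const_q q k n0 n1 * const_c q k n1 (A * B) n0 *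
      (poly (chain_poly q k n0 (n0 + n1)) A * poly (chain_poly q k n0 (n0 + n1)) B)) = gamma_product q n0 n1 \<alpha> \<beta> k"
proof -
  let ?h = "complex_of_real (1 - q)" and ?\<gamma> = "\<alpha> + \<beta>"
  let ?G = "qGamma q (\<alpha> + \<beta>)"
  define N0 K where "N0 = complex_of_nat n0" and "K = complex_of_nat k"
  define f where "f = qpoch q Q"
  define p where "p = qpoch q (Q powr (\<alpha> + \<beta>))"
  have h0: "?h \<noteq> 0" using q by (simp del: of_real_diff)
  have Q0: "Q \<noteq> 0" using q by (simp add: Q_def)
  have c: "A * B = Q powr (\<alpha> + \<beta>)" unfolding A_def B_def using Q0 by (simp add: powr_add)
  have re\<gamma>: "Re ?\<gamma> > 0" using re by simp
  have p0: "p m \<noteq> 0" for m unfolding p_def Q_def by (rule qpoch_nonzero[OF q norm_q_powr[OF q re\<gamma>]])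
  have f0: "f m \<noteq> 0" for m unfolding f_def Q_def by (rule qpoch_nonzero[OF q norm_q[OF q]])
  have G0: "?G \<noteq> 0" by (rule qGamma_nonzero[OF q re\<gamma>])
  have gA: "qGamma q (\<alpha> + of_nat m) = qGamma q \<alpha> * qpoch q A m * ?h powi (- int m)" for m
    unfolding A_def Q_def by (rule qGamma_add[OF q re(1)])
  have gB: "qGamma q (\<beta> + of_nat m) = qGamma q \<beta> * qpoch q B m * ?h powi (- int m)" for m
    unfolding B_def Q_def by (rule qGamma_add[OF q re(2)])
  have gC: "qGamma q (?\<gamma> + of_nat m) = ?G * p m * ?h powi (- int m)" for m
    unfolding p_def Q_def by (rule qGamma_add[OF q re\<gamma>])
  have g1: "qGamma q (1 + of_nat m) = f m * ?h powi (- int m)" for m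
    unfolding f_def Q_def by (rule qGamma_Suc[OF q])
  \<comment> \<open>The exponents of \<open>1 - q\<close> from the first three products, written as
    sums of linear terms to fit \<open>sum_linear_int\<close>. Together with \<open>E\<close> from
    \<open>gamma_tail\<close> they add up to zero.\<close>
  define E1 where "E1 = (\<Sum>u<n0. (int n0 - 1) * int k + (- 2 * int k) * int u)"
  define E2 where "E2 = (\<Sum>v<n1. - int n0 * int k + (- 1 - int k) * int v)"
  define E3 where "E3 = (\<Sum>v<n1. (- 2 - 2 * int n0 * int k) + (- 2 - 2 * int k) * int v)"
  have P1: "(\<Prod>i=1..n0. qGamma q (1 + of_nat i * K) * qGamma q (\<alpha> + (of_nat i - 1) * K) * qGamma q (\<beta> + (of_nat i - 1) * K)
          / (qGamma q (1 + K) * qGamma q (?\<gamma> + (N0 + of_nat i - 2) * K)))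
      = (\<Prod>u<n0. f (k * Suc u) / f k) * (qGamma q \<alpha> * qGamma q \<beta> / ?G) ^ n0 *
        ((\<Prod>u<n0. qpoch q A (k * u)) * (\<Prod>u<n0. qpoch q B (k * u))) / (\<Prod>u<n0. p ((n0 + u - 1) * k)) * ?h powi E1"
  proof -
    have "qGamma q (1 + of_nat (Suc u) * K) * qGamma q (\<alpha> + (of_nat (Suc u) - 1) * K) * qGamma q (\<beta> + (of_nat (Suc u) - 1) * K)
          / (qGamma q (1 + K) * qGamma q (?\<gamma> + (N0 + of_nat (Suc u) - 2) * K))
        = f (k * Suc u) / f k * (qGamma q \<alpha> * qGamma q \<beta> / ?G) * (qpoch q A (k * u) * qpoch q B (k * u)) / p ((n0 + u - 1) * k) *
          ?h powi ((int n0 - 1) * int k + (- 2 * int k) * int u)" if "u < n0" for u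
    proof -
      have a1: "1 + of_nat (Suc u) * K = 1 + complex_of_nat (k * Suc u)" by (simp add: K_def algebra_simps)
      have a2: "x + (of_nat (Suc u) - 1) * K = x + complex_of_nat (k * u)" for x by (simp add: K_def)
      have a3: "?\<gamma> + (N0 + of_nat (Suc u) - 2) * K = ?\<gamma> + of_nat ((n0 + u - 1) * k)"
        using that by (simp add: K_def N0_def of_nat_diff)
      have e: "(int n0 - 1) * int k + (- 2 * int k) * int u =
          (- int (k * Suc u)) + (- int (k * u)) + (- int (k * u)) - (- int k) - (- int ((n0 + u - 1) * k))"
        using that by (cases n0) (simp_all add: algebra_simps)
      show ?thesis
        unfolding a1 a2 a3 e unfolding K_def g1 gA gB gC using h0
        by (simp only: power_int_add power_int_diff not_False_eq_True simp_thms) (simp add: mult_ac)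
    qed
    thus ?thesis
      unfolding prod_1_to E1_def
      by (simp add: prod.distrib prod_dividef prod_power_int[OF h0] power_divide power_mult_distrib del: of_real_diff)
  qed
  have P2: "(\<Prod>j=1..n1. qnumber q ((1 + K) * of_nat j) * qGamma q (of_nat j + (N0 + of_nat j) * K) / qGamma q (2 + K))
      = (\<Prod>v<n1. (1 - Q ^ ((k + 1) * Suc v)) * f (v * (k + 1) + (n0 + 1) * k) / f (k + 1)) * ?h powi E2"
  proof -
    have "qnumber q ((1 + K) * of_nat (Suc v)) * qGamma q (of_nat (Suc v) + (N0 + of_nat (Suc v)) * K) / qGamma q (2 + K)
       = (1 - Q ^ ((k + 1) * Suc v)) * f (v * (k + 1) + (n0 + 1) * k) / f (k + 1) * ?h powi (- int n0 * int k + (- 1 - int k) * int v)" for v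
    proof -
      have a0: "(1 + K) * of_nat (Suc v) = of_nat ((k + 1) * Suc v)" by (simp add: K_def algebra_simps)
      have pw: "Q powr of_nat m = Q ^ m" for m using Q0 by (simp add: powr_nat')
      have a1: "qnumber q ((1 + K) * of_nat (Suc v)) = (1 - Q ^ ((k + 1) * Suc v)) / ?h powi 1"
        unfolding qnumber_def Q_def[symmetric] a0 pw by (simp add: Q_def)
      have a2: "of_nat (Suc v) + (N0 + of_nat (Suc v)) * K = 1 + of_nat (v * (k + 1) + (n0 + 1) * k)"
        by (simp add: K_def N0_def algebra_simps)
      have a3: "2 + K = 1 + of_nat (k + 1)" by (simp add: K_def)
      have e: "- int n0 * int k + (- 1 - int k) * int v = - 1 + (- int (v * (k + 1) + (n0 + 1) * k)) - (- int (k + 1))"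
        by (simp add: algebra_simps)
      show ?thesis unfolding a1 a2 a3 e g1 using h0
        by (simp only: power_int_add power_int_diff power_int_minus not_False_eq_True simp_thms) (simp add: field_simps)
    qed
    thus ?thesis
      unfolding prod_1_to E2_def by (simp only: prod.distrib prod_power_int[OF h0 finite_lessThan])
  qed
  have P3: "(\<Prod>j=1..n1. qGamma q (\<alpha> + of_nat j + (N0 + of_nat j - 1) * K) * qGamma q (\<beta> + of_nat j + (N0 + of_nat j - 1) * K))
      = (qGamma q \<alpha> * qGamma q \<beta>) ^ n1 * ((1 - A) * (1 - B)) ^ n1 *
        ((\<Prod>v<n1. qpoch q (A * Q) (k * (n0 + v) + v)) * (\<Prod>v<n1. qpoch q (B * Q) (k * (n0 + v) + v))) * ?h powi E3"
  proof -
    have "qGamma q (\<alpha> + of_nat (Suc v) + (N0 + of_nat (Suc v) - 1) * K) * qGamma q (\<beta> + of_nat (Suc v) + (N0 + of_nat (Suc v) - 1) * K)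
       = (qGamma q \<alpha> * qGamma q \<beta>) * ((1 - A) * (1 - B)) * (qpoch q (A * Q) (k * (n0 + v) + v) * qpoch q (B * Q) (k * (n0 + v) + v)) *
         ?h powi ((- 2 - 2 * int n0 * int k) + (- 2 - 2 * int k) * int v)" for v
    proof -
      have a: "x + of_nat (Suc v) + (N0 + of_nat (Suc v) - 1) * K = x + complex_of_nat (Suc (k * (n0 + v) + v))" for x
        by (simp add: K_def N0_def algebra_simps)
      have e: "(- 2 - 2 * int n0 * int k) + (- 2 - 2 * int k) * int v = (- int (Suc (k * (n0 + v) + v))) + (- int (Suc (k * (n0 + v) + v)))"
        by (simp add: algebra_simps)
      show ?thesis unfolding a e gA gB qpoch_Suc_shift using h0
        by (simp only: power_int_add not_False_eq_True simp_thms) (simp add: Q_def mult_ac)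
    qed
    thus ?thesis
      unfolding prod_1_to E3_def by (simp add: prod.distrib prod_power_int[OF h0] power_mult_distrib del: of_real_diff)
  qed
  obtain E where E: "2 * E = (4 + 6 * int n0 * int k) * int n1 + 3 * (int k + 1) * (int n1 * (int n1 - 1))"
    and P4: "(\<Prod>j=(if n0 = 0 then 2 else 1)..n1. qGamma q (?\<gamma> + of_nat j + (N0 + of_nat j - 2) * K)) *
      (\<Prod>j=(if n0 = 0 then 2 else 1)..2*n1. inverse (qGamma q (?\<gamma> + of_nat j + (2 * N0 + of_nat j - 2) * K)))
    = const_c q k n1 (A * B) n0 / p 2 ^ n1 * (\<Prod>u<n0. p ((n0 + u - 1) * k)) / ?G ^ n1 * ?h powi E"
    using gamma_tail[OF n1] unfolding N0_def K_def p_def c Q_def by blast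
  have "2 * (E1 + E2 + E3 + E) = 0"
    unfolding distrib_left[of 2] E1_def E2_def E3_def E sum_linear_int by (simp add: algebra_simps)
  hence "E1 + E2 + E3 + E = 0" by (metis mult_eq_0_iff zero_neq_numeral)
  hence EE: "?h powi E1 * ?h powi E2 * ?h powi E3 * ?h powi E = 1"
    using h0 by (simp add: power_int_add[symmetric] del: of_real_diff)
  define X where "X = (\<Prod>u<n0. p ((n0 + u - 1) * k))"
  have X0: "X \<noteq> 0" unfolding X_def using p0 by (auto simp: prod_zero_iff)
  have "gamma_product q n0 n1 \<alpha> \<beta> k =
     ((\<Prod>u<n0. f (k * Suc u) / f k) * (qGamma q \<alpha> * qGamma q \<beta> / ?G) ^ n0 *
        ((\<Prod>u<n0. qpoch q A (k * u)) * (\<Prod>u<n0. qpoch q B (k * u))) / X * ?h powi E1) *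
     ((\<Prod>v<n1. (1 - Q ^ ((k + 1) * Suc v)) * f (v * (k + 1) + (n0 + 1) * k) / f (k + 1)) * ?h powi E2) *
     ((qGamma q \<alpha> * qGamma q \<beta>) ^ n1 * ((1 - A) * (1 - B)) ^ n1 *
        ((\<Prod>v<n1. qpoch q (A * Q) (k * (n0 + v) + v)) * (\<Prod>v<n1. qpoch q (B * Q) (k * (n0 + v) + v))) * ?h powi E3) *
     (const_c q k n1 (A * B) n0 / p 2 ^ n1 * X / ?G ^ n1 * ?h powi E)"
    unfolding gamma_product_def Let_def N0_def[symmetric] K_def[symmetric] P1 P2 P3 X_def
    unfolding P4[symmetric] by (simp only: mult.assoc)
  also have "\<dots> = ((\<Prod>u<n0. f (k * Suc u) / f k) *
      (\<Prod>v<n1. (1 - Q ^ ((k + 1) * Suc v)) * f (v * (k + 1) + (n0 + 1) * k) / f (k + 1))) *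
     ((qGamma q \<alpha> * qGamma q \<beta> / ?G) ^ n0 * ((qGamma q \<alpha> * qGamma q \<beta>) ^ n1 / ?G ^ n1)) *
     (((1 - A) * (1 - B)) ^ n1 / p 2 ^ n1) * const_c q k n1 (A * B) n0 *
     (((\<Prod>u<n0. qpoch q A (k * u)) * (\<Prod>v<n1. qpoch q (A * Q) (k * (n0 + v) + v))) *
      ((\<Prod>u<n0. qpoch q B (k * u)) * (\<Prod>v<n1. qpoch q (B * Q) (k * (n0 + v) + v)))) *
     (?h powi E1 * ?h powi E2 * ?h powi E3 * ?h powi E) * (X / X)"
    by (simp only: divide_inverse mult_ac)
  also have "\<dots> = (qGamma q \<alpha> * qGamma q \<beta> / ?G) ^ (n0 + n1) * ((1 - A) * (1 - B) / p 2) ^ n1 *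
     (const_q q k n0 n1 * const_c q k n1 (A * B) n0 *
      (poly (chain_poly q k n0 (n0 + n1)) A * poly (chain_poly q k n0 (n0 + n1)) B))"
  proof -
    have cq: "(\<Prod>u<n0. f (k * Suc u) / f k) *
      (\<Prod>v<n1. (1 - Q ^ ((k + 1) * Suc v)) * f (v * (k + 1) + (n0 + 1) * k) / f (k + 1)) = const_q q k n0 n1"
      unfolding const_q_def Let_def f_def Q_def ..
    have XX: "X / X = 1" using X0 by simp
    have g: "(qGamma q \<alpha> * qGamma q \<beta>) ^ n1 / ?G ^ n1 = (qGamma q \<alpha> * qGamma q \<beta> / ?G) ^ n1"
      "((1 - A) * (1 - B)) ^ n1 / p 2 ^ n1 = ((1 - A) * (1 - B) / p 2) ^ n1"
      by (simp_all only: power_divide)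
    show ?thesis unfolding cq EE XX g chain_poly_split Q_def[symmetric] power_add by (simp only: mult_1_left mult_1_right mult_ac)
  qed
  finally show ?thesis unfolding p_def c[symmetric] ..
qed

end

section \<open>Comparison of the exponents of q, and the two integrals\<close>

lemma of_nat_choose_2: "(of_nat (n choose 2) :: complex) = of_nat n * (of_nat n - 1) / 2"
  by (induction n) (simp_all add: numeral_2_eq_2 field_simps)

lemma of_nat_choose_3: "(of_nat (n choose 3) :: complex) = of_nat n * (of_nat n - 1) * (of_nat n - 2) / 6"
proof (induction n)
  case (Suc n)
  have step: "of_nat (Suc n choose 3) = (of_nat (n choose 2) + of_nat (n choose 3) :: complex)"
    by (simp add: numeral_3_eq_3 numeral_2_eq_2)
  show ?case unfolding step Suc.IH of_nat_choose_2 by (simp add: field_simps)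
qed simp

lemma of_nat_const_exp:
  "(of_nat (const_exp k b a) :: complex) = of_nat b * (of_nat b - 1) * (2 * of_nat b - 1) / 6
     + (of_nat a * (of_nat b)\<^sup>2 + of_nat b * (of_nat b - 1) * (4 * of_nat b - 5) / 6) * of_nat k
     + 2 * of_nat ((a + b) choose 3) * (of_nat k)\<^sup>2"
proof (induction a)
  case 0
  show ?case by (simp add: of_nat_choose_2 of_nat_choose_3 field_simps power2_eq_square)
next
  case (Suc a)
  have step: "of_nat (const_exp k b (Suc a)) = (of_nat (const_exp k b a) :: complex) + of_nat k * of_nat b
      + 2 * of_nat k * (of_nat k * of_nat (a + b choose 2) + of_nat (b choose 2))" by simp
  show ?case
    unfolding step Suc.IH of_nat_choose_2 of_nat_choose_3 by (simp add: field_simps power2_eq_square)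
qed

lemma exponent_I_eq:
  "exponent_I n0 n1 \<alpha> k = of_nat (const_exp k n1 n0) + of_nat (k * (n0 + n1 choose 2) + (n1 choose 2)) * \<alpha>"
  unfolding exponent_I_def Let_def of_nat_const_exp by (simp add: algebra_simps)

text \<open>The exponents differ by the powers of \<open>q\<close> in
  \<open>pair_kernel'_reflect\<close> and by one factor \<open>A q\<close> for each of the
  \<open>n1\<close> variables of the second type.\<close>

lemma exponent_II_eq:
  "exponent_II n0 n1 \<alpha> k + of_nat (k * (n0 choose 2)) =
     exponent_I n0 n1 \<alpha> k + of_nat ((k + 1) * (n1 choose 2)) + of_nat n1 * (\<alpha> + 1)"
  unfolding exponent_I_def exponent_II_def Let_def
  by (simp add: of_nat_choose_2 of_nat_choose_3 field_simps power2_eq_square)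

theorem theorem7p3:
  fixes q :: real and n0 n1 n k :: nat and \<alpha> \<beta> :: complex
  assumes "0 < q" and "q < 1"
    and "n1 \<ge> 2" and "n = n0 + n1"
    and "Re \<alpha> > 0" and "Re \<beta> > 0"
  shows "q_integrable q n (integrand_I q n0 n1 \<alpha> \<beta> k) \<and>
         q_integral q n (integrand_I q n0 n1 \<alpha> \<beta> k)
           = complex_of_real q powr exponent_I n0 n1 \<alpha> k * gamma_product q n0 n1 \<alpha> \<beta> k \<and>
         q_integrable q n (integrand_II q n0 n1 \<alpha> \<beta> k) \<and>
         q_integral q n (integrand_II q n0 n1 \<alpha> \<beta> k)
           = complex_of_real q powr exponent_II n0 n1 \<alpha> k * gamma_product q n0 n1 \<alpha> \<beta> k"
proof -
  note q = assms(1,2) and re = assms(5,6)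
  define Q where "Q = complex_of_real q"
  define A B where "A = Q powr \<alpha>" and "B = Q powr \<beta>"
  define S T where "S = {1..n0}" and "T = {n0+1..n}"
  define M where "M = (\<Prod>i\<in>S \<union> T. mass q T A B i) * moment_sum q k S T A (A * B)"
  have Q0: "Q \<noteq> 0" using q by (simp add: Q_def)
  have A0: "A \<noteq> 0" "B \<noteq> 0" unfolding A_def B_def using Q0 by auto
  have I: "{1..n} = S \<union> T" using assms(4) by (auto simp: S_def T_def)
  have card: "card S = n0" "card T = n1" "card (S \<union> T) = n0 + n1"
    using assms(4) I[symmetric] by (auto simp: S_def T_def)
  have lt: "i < j" if "i \<in> S" "j \<in> T" for i j using that by (auto simp: S_def T_def)
  have AB: "norm A < 1" "norm B < 1" unfolding A_def B_def Q_def by (auto intro: norm_q_powr[OF q] re)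
  have c: "A * B = Q powr (\<alpha> + \<beta>)" unfolding A_def B_def using Q0 by (simp add: powr_add)
  have nc: "norm (A * B) < 1" unfolding c Q_def by (rule norm_q_powr[OF q]) (use re in simp)
  let ?h = "complex_of_real (1 - q)"
  \<comment> \<open>The prefactor of the q-integral is distributed as one factor
    \<open>1 - q\<close> per variable, which makes each mass a quotient of q-gamma values.\<close>
  have "?h ^ n * M = (\<Prod>i\<in>S \<union> T. ?h * mass q T A B i) * moment_sum q k S T A (A * B)"
    unfolding M_def using card assms(4) by (simp add: prod.distrib del: of_real_diff)
  also have "(\<Prod>i\<in>S \<union> T. ?h * mass q T A B i) = (\<Prod>i\<in>S \<union> T.
      qGamma q \<alpha> * qGamma q \<beta> / qGamma q (\<alpha> + \<beta>) * ((1 - A) * (1 - B) / qpoch q (A * B) 2) ^ type_shift T i)"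
    unfolding A_def B_def Q_def by (intro prod.cong refl mass_qGamma[OF q re])
  also have "\<dots> = (qGamma q \<alpha> * qGamma q \<beta> / qGamma q (\<alpha> + \<beta>)) ^ (n0 + n1) *
      ((1 - A) * (1 - B) / qpoch q (A * B) 2) ^ n1"
  proof -
    have "(\<Sum>i\<in>S \<union> T. type_shift T i) = (\<Sum>i\<in>T. 1)"
      by (rule sum.mono_neutral_cong_right) (auto simp: S_def T_def type_shift_def)
    thus ?thesis unfolding prod.distrib prod_constant card power_sum[symmetric] by (simp add: card)
  qed
  also have "moment_sum q k S T A (A * B) = moment_closed q k n0 n1 A (A * B)"
    using moment_sum_closed[OF q _ _ lt, of S T "A * B" A k] A0 nc card by (simp add: S_def T_def)
  also have "moment_closed q k n0 n1 A (A * B) = (Q ^ const_exp k n1 n0 * A ^ (k * (n0 + n1 choose 2) + (n1 choose 2))) *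
      (const_q q k n0 n1 * const_c q k n1 (A * B) n0 *
      (poly (chain_poly q k n0 (n0 + n1)) A * poly (chain_poly q k n0 (n0 + n1)) B))"
    unfolding moment_closed_def Q_def[symmetric] using A0 by simp
  also have "Q ^ const_exp k n1 n0 * A ^ (k * (n0 + n1 choose 2) + (n1 choose 2)) = Q powr exponent_I n0 n1 \<alpha> k"
  proof -
    have "Q powr (of_nat m * \<alpha>) = A ^ m" for m
      unfolding A_def powr_def using Q0 by (simp add: exp_of_nat_mult[symmetric] mult_ac)
    moreover have "Q powr of_nat m = Q ^ m" for m using Q0 by (simp add: powr_nat')
    ultimately show ?thesis unfolding exponent_I_eq powr_add by (simp only:)
  qed
  finally have M: "?h ^ n * M = Q powr exponent_I n0 n1 \<alpha> k * gamma_product q n0 n1 \<alpha> \<beta> k"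
    using gamma_product_closed[OF q re, of n1 n0 k] assms(3) unfolding A_def B_def Q_def by (simp add: mult_ac)
  have powr_II: "Q ^ ((k + 1) * (n1 choose 2)) / Q ^ (k * (n0 choose 2)) * (A * Q) ^ n1 * Q powr exponent_I n0 n1 \<alpha> k
      = Q powr exponent_II n0 n1 \<alpha> k"
  proof -
    have 1: "Q powr of_nat m = Q ^ m" for m using Q0 by (simp add: powr_nat')
    have 2: "Q powr (of_nat n1 * (\<alpha> + 1)) = (A * Q) ^ n1"
    proof -
      have "Q powr (of_nat n1 * (\<alpha> + 1)) = (Q powr (\<alpha> + 1)) ^ n1"
        unfolding powr_def using Q0 by (simp add: exp_of_nat_mult[symmetric] mult_ac)
      thus ?thesis using Q0 by (simp add: A_def powr_add)
    qed
    have "Q powr exponent_II n0 n1 \<alpha> k * Q ^ (k * (n0 choose 2)) =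
        Q powr exponent_I n0 n1 \<alpha> k * Q ^ ((k + 1) * (n1 choose 2)) * (A * Q) ^ n1"
      unfolding 1[symmetric] 2[symmetric] powr_add[symmetric] exponent_II_eq ..
    thus ?thesis using Q0 by (simp add: field_simps)
  qed
  have s1: "((\<lambda>e. integrand_I q n0 n1 \<alpha> \<beta> k (\<lambda>i. q ^ e i) * complex_of_real (q ^ (\<Sum>i=1..n. e i))) has_sum M)
      (PiE {1..n} (\<lambda>_. UNIV))"
    unfolding M_def S_def T_def A_def B_def Q_def by (rule has_sum_integrand_I[OF q re assms(4)])
  have s2: "((\<lambda>e. integrand_II q n0 n1 \<alpha> \<beta> k (\<lambda>i. q ^ e i) * complex_of_real (q ^ (\<Sum>i=1..n. e i))) has_sum
      (Q ^ ((k + 1) * (n1 choose 2)) / Q ^ (k * (n0 choose 2)) * (A * Q) ^ n1 * M)) (PiE {1..n} (\<lambda>_. UNIV))"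
    unfolding M_def A_def B_def Q_def by (rule has_sum_integrand_II[OF assms(4) S_def T_def refl q re])
  have i1: "q_integrable q n (integrand_I q n0 n1 \<alpha> \<beta> k)" and i2: "q_integrable q n (integrand_II q n0 n1 \<alpha> \<beta> k)"
    unfolding q_integrable_def using s1 s2 by (auto simp: summable_on_def)
  have "q_integral q n (integrand_I q n0 n1 \<alpha> \<beta> k) = Q powr exponent_I n0 n1 \<alpha> k * gamma_product q n0 n1 \<alpha> \<beta> k"
    unfolding q_integral_def infsumI[OF s1] by (rule M)
  moreover have "q_integral q n (integrand_II q n0 n1 \<alpha> \<beta> k)
      = Q powr exponent_II n0 n1 \<alpha> k * gamma_product q n0 n1 \<alpha> \<beta> k"
  proof -
    have "q_integral q n (integrand_II q n0 n1 \<alpha> \<beta> k)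
        = Q ^ ((k + 1) * (n1 choose 2)) / Q ^ (k * (n0 choose 2)) * (A * Q) ^ n1 * (?h ^ n * M)"
      unfolding q_integral_def infsumI[OF s2] by (simp only: mult_ac)
    also have "\<dots> = (Q ^ ((k + 1) * (n1 choose 2)) / Q ^ (k * (n0 choose 2)) * (A * Q) ^ n1 * Q powr exponent_I n0 n1 \<alpha> k) *
        gamma_product q n0 n1 \<alpha> \<beta> k"
      unfolding M by (simp only: mult.assoc)
    finally show ?thesis unfolding powr_II .
  qed
  ultimately show ?thesis using i1 i2 unfolding Q_def by blast
qed

end
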